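(* Let $X \subseteq \mathbb{R}^n$ be open and let $F \colon X \to \mathbb{R}^n$ be of class $C^2$. Assume that for every $x_0 \in X$ the solution of the initial value problem $\dot x = F(x)$, $x(0)=x_0$, is extendable to $\mathbb{R}_+$, and let $\varphi \colon \mathbb{R}_+\times X \to X$ denote the flow of $\dot x = F(x)$. Let $s,t>0$ and let $\Omega \subseteq X$ be $s$-convex and closed with $\Omega \neq \mathbb{R}^n$. Let $\lambda_-,\lambda_+ \in \mathbb{R}$ be such that $$\lambda_- \leq \mu_-(F'(x)) \leq \mu_+(F'(x)) \leq \lambda_+ \quad\text{for all } x \in \varphi([0,t],\Omega).$$ Let $D_2 \varphi(\tau,x)$ denote the partial derivative of $\varphi$ with respect to $x$. Assume further that there exists a constant $L_1\in \mathbb{R}_+$ such that $$\left \| \int_{0}^\delta D_2\varphi(\tau,x)^{-1} F''(\varphi(\tau,x))(D_2\varphi(\tau,x)h)^2\, d \tau \right \| \leq L_1 \|h\|^2$$ for all $x \in \Omega$, $\delta \in [0,t]$, and $h \in \mathbb{R}^n$. If $sL_1 <1$, then the attainable set $\varphi(\tau, \Omega)$ is $r$-convex for all $\tau \in [0,t]$ with $$r = \frac{s\exp((2 \lambda_+-\lambda_-)t)}{1-sL_1}.$$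
   Context: $\mathbb{R}^n$ carries the Euclidean inner product and norm $\|\cdot\|$; $\mathbb{R}_+ = [0,\infty)$. For a bilinear map $B$, $Bh^2 := B(h,h)$. The flow $\varphi$ satisfies $\varphi(0,x_0)=x_0$ and $\frac{d}{d\rho}\varphi(\rho,x_0)=F(\varphi(\rho,x_0))$ for all $\rho\ge 0$, $x_0\in X$; $\varphi(\tau,\Omega)$ and $\varphi([0,t],\Omega)$ denote image sets. For $A \in \mathbb{R}^{n\times n}$, $\mu_+(A)$ and $\mu_-(A)$ denote the maximum and minimum, respectively, eigenvalues of the symmetric part $(A+A^* )/2$ of $A$. For $r>0$, a set $\Omega \subseteq \mathbb{R}^n$ is $r$-convex if for all $x,y \in \Omega$ the intersection of all closed balls of radius $r$ (centered at any $c \in \mathbb{R}^n$) that contain both $x$ and $y$ is a subset of $\Omega$; this intersection is considered equal to $\mathbb{R}^n$ if no such ball exists.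
   Formalization: As stated the claim fails if 2λ₊−λ₋<0 (F(x)=−x, Ω a closed ball of radius s, τ=0). Proved: for all τ∈[0,t], φ(τ,Ω) is r-convex with r=s·exp((2λ₊−λ₋)τ)/(1−sL₁); the stated radius, uniform in τ∈[0,t], holds when 2λ₊−λ₋≥0. *)

theory Defs
  imports "HOL-Analysis.Analysis"
begin

(* F is of class C^2 on the (open) set X, with first and second derivatives F' and F''.
   On an open set both are determined by F; their values outside X are irrelevant. *)
definition C2_on ::
  "(real^'n) set \<Rightarrow> (real^'n \<Rightarrow> real^'n) \<Rightarrow> (real^'n \<Rightarrow> ((real^'n) \<Rightarrow>\<^sub>L (real^'n))) \<Rightarrow>
   (real^'n \<Rightarrow> ((real^'n) \<Rightarrow>\<^sub>L ((real^'n) \<Rightarrow>\<^sub>L (real^'n)))) \<Rightarrow> bool"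
  where "C2_on X F F' F'' \<longleftrightarrow>
    (\<forall>x\<in>X. (F has_derivative blinfun_apply (F' x)) (at x)) \<and>
    (\<forall>x\<in>X. (F' has_derivative blinfun_apply (F'' x)) (at x)) \<and>
    continuous_on X F''"

(* The values of u at negative times are irrelevant; at time 0 the derivative is one-sided. *)
definition solves_ivp ::
  "(real^'n) set \<Rightarrow> (real^'n \<Rightarrow> real^'n) \<Rightarrow> real^'n \<Rightarrow> (real \<Rightarrow> real^'n) \<Rightarrow> bool"
  where "solves_ivp X F x0 u \<longleftrightarrow>
    u 0 = x0 \<and>
    (\<forall>\<rho>\<ge>0. u \<rho> \<in> X \<and> (u has_vector_derivative F (u \<rho>)) (at \<rho> within {0..}))"

definition is_flow ::
  "(real^'n) set \<Rightarrow> (real^'n \<Rightarrow> real^'n) \<Rightarrow> (real \<Rightarrow> real^'n \<Rightarrow> real^'n) \<Rightarrow> bool"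
  where "is_flow X F \<phi> \<longleftrightarrow> (\<forall>x0\<in>X. solves_ivp X F x0 (\<lambda>\<rho>. \<phi> \<rho> x0))"

(* The Jacobian matrix of the time-tau map. The library's derivative is a choice term, meaningful
   only where the map is differentiable; for the flow of a C^2 field this is a theorem. *)
definition D2 :: "(real \<Rightarrow> real^'n \<Rightarrow> real^'n) \<Rightarrow> real \<Rightarrow> real^'n \<Rightarrow> real^'n^'n"
  where "D2 \<phi> \<tau> x = jacobian (\<phi> \<tau>) (at x)"

definition eigenvalues :: "real^'n^'n \<Rightarrow> real set"
  where "eigenvalues A = {c. \<exists>v. v \<noteq> 0 \<and> A *v v = c *\<^sub>R v}"

definition sym_part :: "real^'n^'n \<Rightarrow> real^'n^'n"
  where "sym_part A = (1/2) *\<^sub>R (A + transpose A)"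

(* The symmetric part has a finite, nonempty set of real eigenvalues, so Max and Min are proper. *)
definition mu_plus :: "real^'n^'n \<Rightarrow> real"
  where "mu_plus A = Max (eigenvalues (sym_part A))"

definition mu_minus :: "real^'n^'n \<Rightarrow> real"
  where "mu_minus A = Min (eigenvalues (sym_part A))"

(* If no ball of radius r contains both points, the intersection below is UNIV. *)
definition r_convex :: "real \<Rightarrow> (real^'n) set \<Rightarrow> bool"
  where "r_convex r \<Omega> \<longleftrightarrow>
    (\<forall>x\<in>\<Omega>. \<forall>y\<in>\<Omega>. \<Inter>{cball c r | c. x \<in> cball c r \<and> y \<in> cball c r} \<subseteq> \<Omega>)"

end

theory Submission
  imports Defs
begin

text \<open>
  Write \<open>D\<close> for \<open>D2 \<phi> \<tau> x\<close> and \<open>\<Delta> = \<phi> \<tau> y - \<phi> \<tau> x\<close>. The proof characterizes \<open>r\<close>-convexity by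
  supporting balls: a closed set with interior points is \<open>r\<close>-convex as soon as every frontier point
  lies on the boundary of a ball of radius \<open>r\<close> that contains the set
  (\<open>r_convex_of_supporting_balls\<close>), and conversely an \<open>s\<close>-convex set lies in a ball of radius \<open>s\<close>
  touching it at any given frontier point (\<open>r_convex_supporting_ball\<close>). Since \<open>\<Omega> \<noteq> UNIV\<close>, two points
  of \<open>\<Omega>\<close> are at distance at most \<open>2 * s\<close>, so \<open>\<Omega>\<close> is compact; it is also convex. A unit normal \<open>\<nu>\<close> of
  such a ball at \<open>x\<close> is carried by the flow to the normal \<open>q = D\<^sup>-\<^sup>T \<nu>\<close> at \<open>\<phi> \<tau> x\<close>, and the claim
  becomes the support inequality \<open>\<bar>\<Delta>\<bar>\<^sup>2 * \<bar>q\<bar> + 2 * r * (\<Delta> \<bullet> q) \<le> 0\<close> for all \<open>y\<close> in \<open>\<Omega>\<close>.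

  For \<open>y\<close> near \<open>x\<close> this is a curvature computation. Put \<open>k = y - x\<close>. By variation of constants,
  \<open>\<Delta> = D (k + I / 2) + o(\<bar>k\<bar>\<^sup>2)\<close>, where \<open>I\<close> is the integral that \<open>L1\<close> controls
  (\<open>flow_expansion2\<close>), so that \<open>\<Delta> \<bullet> q = k \<bullet> \<nu> + (I \<bullet> \<nu>) / 2 + o(\<bar>k\<bar>\<^sup>2)\<close>, which is at most
  \<open>- (1 - s * L1) / (2 * s) * \<bar>k\<bar>\<^sup>2 + o(\<bar>k\<bar>\<^sup>2)\<close>. The bounds on the symmetric part of the Jacobian give
  \<open>\<bar>\<Delta>\<bar> \<le> exp (lp * \<tau>) * \<bar>k\<bar>\<close> and \<open>\<bar>q\<bar> \<le> exp (- lm * \<tau>)\<close>. Together they yield the support inequality,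
  even strictly and uniformly in \<open>\<tau>\<close>, \<open>x\<close>, \<open>\<nu>\<close>, for the radius \<open>(1 + \<epsilon>) * r\<close> with any \<open>\<epsilon> > 0\<close>.

  The passage from near \<open>y\<close> to all \<open>y\<close> is by continuation in \<open>\<tau>\<close> (\<open>support_continuation\<close>). At a
  time at which the support inequality holds everywhere, the image is \<open>r\<close>-convex. Equality at some
  \<open>y \<noteq> x\<close> is then impossible: the hull of \<open>\<phi> \<tau> x\<close> and \<open>\<phi> \<tau> y\<close> contains an arc of the supporting
  sphere, and the points of that arc close to \<open>\<phi> \<tau> x\<close> would violate the local strict inequality. So
  at such a time the inequality is strict for \<open>y \<noteq> x\<close>, and by compactness it cannot start to fail
  later. Letting \<open>\<epsilon>\<close> tend to \<open>0\<close> gives the theorem, because the inequality is linear in the radius.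

  The facts about the flow are obtained from Gronwall estimates alone. In particular, the solutions
  of the linearized equation are constructed as limits of difference quotients of the flow.
\<close>

section \<open>Hulls by balls of a fixed radius\<close>

lemma r_convexD:
  assumes "r_convex r K" "x \<in> K" "y \<in> K"
    and "\<And>c. norm (x - c) \<le> r \<Longrightarrow> norm (y - c) \<le> r \<Longrightarrow> norm (w - c) \<le> r"
  shows "w \<in> K"
proof -
  have "w \<in> \<Inter> {cball c r |c. x \<in> cball c r \<and> y \<in> cball c r}"
    using assms(4) by (auto simp: dist_norm norm_minus_commute)
  then show ?thesis using assms(1-3) unfolding r_convex_def by blast
qed

lemma r_convexI:
  assumes "\<And>x y w. x \<in> K \<Longrightarrow> y \<in> K \<Longrightarrow>
    (\<And>c. norm (x - c) \<le> r \<Longrightarrow> norm (y - c) \<le> r \<Longrightarrow> norm (w - c) \<le> r) \<Longrightarrow> w \<in> K"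
  shows "r_convex r K"
  unfolding r_convex_def
proof safe
  fix x y w assume xy: "x \<in> K" "y \<in> K" and w: "w \<in> \<Inter> {cball c r |c. x \<in> cball c r \<and> y \<in> cball c r}"
  show "w \<in> K"
  proof (rule assms[OF xy])
    fix c assume "norm (x - c) \<le> r" "norm (y - c) \<le> r"
    then have "w \<in> cball c r" using w by (auto simp: dist_norm norm_minus_commute)
    then show "norm (w - c) \<le> r" by (simp add: dist_norm norm_minus_commute)
  qed
qed

lemma norm_le_iff_inner: "norm (v::'a::real_inner) \<le> r \<longleftrightarrow> 0 \<le> r \<and> v \<bullet> v \<le> r\<^sup>2"
proof -
  have "norm v \<le> r \<longleftrightarrow> 0 \<le> r \<and> (norm v)\<^sup>2 \<le> r\<^sup>2"
    using norm_ge_zero[of v] power2_le_imp_le[of "norm v" r] power_mono[of "norm v" r 2] by linarith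
  then show ?thesis by (simp add: power2_norm_eq_inner)
qed

lemma inner_add_self: "(a + b) \<bullet> (a + b) = a \<bullet> a + 2 * (a \<bullet> b) + b \<bullet> b" for a b :: "'a::real_inner"
  by (simp add: inner_add_left inner_add_right inner_commute[of b a])

text \<open>
  A ball of the smaller radius is the intersection of the balls of the larger radius that contain it.
\<close>
lemma r_convex_mono:
  assumes "r_convex r K" "0 < r" "r \<le> R"
  shows "r_convex R K"
proof (rule r_convexI)
  fix x y w assume xy: "x \<in> K" "y \<in> K"
    and w: "\<And>c. norm (x - c) \<le> R \<Longrightarrow> norm (y - c) \<le> R \<Longrightarrow> norm (w - c) \<le> R"
  show "w \<in> K"
  proof (rule r_convexD[OF assms(1) xy], rule ccontr)
    fix c assume c: "norm (x - c) \<le> r" "norm (y - c) \<le> r" and nw: "\<not> norm (w - c) \<le> r"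
    \<comment> \<open>shift the centre away from \<open>w\<close>: the ball of radius \<open>R\<close> contains the old one but still misses \<open>w\<close>\<close>
    define c' where "c' = c - ((R - r) / norm (w - c)) *\<^sub>R (w - c)"
    have n: "norm (w - c) > 0" using nw assms by linarith
    have "norm (c - c') = R - r" using n assms unfolding c'_def by simp
    then have "norm (x - c') \<le> R" "norm (y - c') \<le> R"
      using c norm_triangle_ineq[of "x - c" "c - c'"] norm_triangle_ineq[of "y - c" "c - c'"] by auto
    then have "norm (w - c') \<le> R" by (rule w)
    moreover have "w - c' = (1 + (R - r) / norm (w - c)) *\<^sub>R (w - c)"
      unfolding c'_def by (simp add: algebra_simps)
    then have "norm (w - c') = (1 + (R - r) / norm (w - c)) * norm (w - c)"
      using n assms by simp
    then have "norm (w - c') = norm (w - c) + (R - r)" using n by (simp add: distrib_right)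
    ultimately show False using nw by linarith
  qed
qed

text \<open>
  For points farther apart than \<open>2 * r\<close> the hull is by convention the whole space.
\<close>
lemma r_convex_dist_le:
  assumes "r_convex r K" "K \<noteq> UNIV" "x \<in> K" "y \<in> K"
  shows "norm (x - y) \<le> 2 * r"
proof (rule ccontr)
  assume n: "\<not> ?thesis"
  have "w \<in> K" for w
  proof (rule r_convexD[OF assms(1,3,4)])
    fix c assume "norm (x - c) \<le> r" "norm (y - c) \<le> r"
    then have "norm (x - y) \<le> 2 * r" using norm_triangle_ineq4[of "x - c" "y - c"] by simp
    with n show "norm (w - c) \<le> r" by blast
  qed
  then show False using assms(2) by (metis UNIV_eq_I)
qed

lemma r_convex_imp_convex:
  assumes "r_convex r K" shows "convex K"
proof (rule convexI)
  fix x y and u v :: real assume xy: "x \<in> K" "y \<in> K" and uv: "0 \<le> u" "0 \<le> v" "u + v = 1"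
  show "u *\<^sub>R x + v *\<^sub>R y \<in> K"
  proof (rule r_convexD[OF assms xy])
    fix c assume "norm (x - c) \<le> r" "norm (y - c) \<le> r"
    then have "x \<in> cball c r" "y \<in> cball c r" by (auto simp: dist_norm norm_minus_commute)
    then have "u *\<^sub>R x + v *\<^sub>R y \<in> cball c r"
      using convex_cball[of c r] uv by (auto simp: convex_def simp del: mem_cball)
    then show "norm (u *\<^sub>R x + v *\<^sub>R y - c) \<le> r" by (simp add: dist_norm norm_minus_commute)
  qed
qed

text \<open>
  By the parallelogram law, the midpoint of \<open>x\<close> and \<open>y\<close> lies uniformly deep inside every ball of
  radius \<open>r\<close> that contains both points, so the hull contains a ball about it.
\<close>
lemma r_convex_interior_nonempty:
  assumes "r_convex r K" "0 < r" "x \<in> K" "y \<in> K" "x \<noteq> y"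
  shows "interior K \<noteq> {}"
proof -
  define m where "m = (1/2) *\<^sub>R (x + y)"
  define \<rho> where "\<rho> = r - sqrt (r\<^sup>2 - (norm (x - y))\<^sup>2 / 4)"
  have "sqrt (r\<^sup>2 - (norm (x - y))\<^sup>2 / 4) < sqrt (r\<^sup>2)"
    using assms by (intro real_sqrt_less_mono) simp
  then have "\<rho> > 0" using assms unfolding \<rho>_def by simp
  have "ball m \<rho> \<subseteq> K"
  proof
    fix w assume w: "w \<in> ball m \<rho>"
    show "w \<in> K"
    proof (rule r_convexD[OF assms(1,3,4)])
      fix c assume c: "norm (x - c) \<le> r" "norm (y - c) \<le> r"
      have "(norm (m - c))\<^sup>2 = (norm (x - c))\<^sup>2 / 2 + (norm (y - c))\<^sup>2 / 2 - (norm (x - y))\<^sup>2 / 4"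
        unfolding m_def power2_norm_eq_inner
        by (simp add: inner_diff_left inner_diff_right inner_add_left inner_add_right inner_commute field_simps)
      also have "\<dots> \<le> r\<^sup>2 - (norm (x - y))\<^sup>2 / 4"
        using power_mono[OF c(1), of 2] power_mono[OF c(2), of 2] by simp
      finally have "norm (m - c) \<le> sqrt (r\<^sup>2 - (norm (x - y))\<^sup>2 / 4)" by (rule real_le_rsqrt)
      moreover have "norm (w - c) \<le> norm (w - m) + norm (m - c)"
        using norm_triangle_ineq[of "w - m" "m - c"] by simp
      ultimately show "norm (w - c) \<le> r"
        using w by (simp add: \<rho>_def dist_norm norm_minus_commute)
    qed
  qed
  then show ?thesis using \<open>\<rho> > 0\<close> interior_maximal[of "ball m \<rho>" K] by (auto intro!: exI[of _ m])
qed

text \<open>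
  If \<open>y\<close> were outside the ball of radius \<open>r\<close> that touches \<open>K\<close> at \<open>x\<close> with outer normal \<open>\<nu>\<close>, the hull
  of \<open>x\<close> and \<open>y\<close> would be so wide at \<open>x\<close> that it crossed the supporting hyperplane.
\<close>
lemma r_convex_subset_ball:
  assumes rc: "r_convex r K" and "0 < r" and x: "x \<in> K" and y: "y \<in> K" and \<nu>: "norm \<nu> = 1"
    and half: "\<And>z. z \<in> K \<Longrightarrow> (z - x) \<bullet> \<nu> \<le> 0"
  shows "(norm (y - x))\<^sup>2 + 2 * r * ((y - x) \<bullet> \<nu>) \<le> 0"
proof (rule ccontr)
  assume n: "\<not> ?thesis"
  define a where "a = - ((y - x) \<bullet> \<nu>)"
  define D where "D = (norm (y - x))\<^sup>2"
  have aD: "a < D / (2 * r)" using n \<open>0 < r\<close> by (simp add: a_def D_def field_simps)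
  \<comment> \<open>any \<open>\<beta>\<close> between the two bounds: above \<open>a\<close> for \<open>w\<close> to cross the hyperplane, below \<open>D / (2 * r)\<close> for \<open>w\<close> to enter the hull\<close>
  define \<beta> where "\<beta> = (a + D / (2 * r)) / 2"
  have \<beta>: "a < \<beta>" "\<beta> < D / (2 * r)" using aD by (auto simp: \<beta>_def)
  have "a \<ge> 0" using half[OF y] by (simp add: a_def)
  then have "\<beta> > 0" using \<beta> by linarith
  define \<kappa> where "\<kappa> = D / 2 - \<beta> * r"
  have \<kappa>: "\<kappa> > 0" using \<beta> \<open>0 < r\<close> by (simp add: \<kappa>_def field_simps)
  define w where "w = (y - x) + \<beta> *\<^sub>R \<nu>"
  have \<nu>1: "\<nu> \<bullet> \<nu> = 1" using \<nu> by (simp add: norm_eq_1)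
  have w\<nu>: "w \<bullet> \<nu> > 0" using \<beta> \<nu>1 by (simp add: w_def inner_add_left a_def)
  define \<epsilon> where "\<epsilon> = min 1 (2 * \<kappa> / (1 + w \<bullet> w))"
  have pos: "1 + w \<bullet> w > 0" by (smt (verit) inner_ge_zero)
  have \<epsilon>: "0 < \<epsilon>" "\<epsilon> \<le> 1" "\<epsilon> * (w \<bullet> w) \<le> 2 * \<kappa>"
  proof -
    show "0 < \<epsilon>" using pos \<kappa> by (simp add: \<epsilon>_def)
    show "\<epsilon> \<le> 1" by (simp add: \<epsilon>_def)
    have "\<epsilon> * (1 + w \<bullet> w) \<le> 2 * \<kappa>"
      using pos by (simp add: \<epsilon>_def pos_le_divide_eq[symmetric])
    then show "\<epsilon> * (w \<bullet> w) \<le> 2 * \<kappa>" using \<open>0 < \<epsilon>\<close> by (simp add: algebra_simps)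
  qed
  have "x + \<epsilon> *\<^sub>R w \<in> K"
  proof (rule r_convexD[OF rc x y])
    fix c assume c: "norm (x - c) \<le> r" "norm (y - c) \<le> r"
    define p where "p = x - c"
    have p: "p \<bullet> p \<le> r\<^sup>2" using c(1) by (simp add: norm_le_iff_inner p_def)
    have yc: "y - c = p + (y - x)" by (simp add: p_def)
    have "(p + (y - x)) \<bullet> (p + (y - x)) \<le> r\<^sup>2" using c(2) unfolding yc norm_le_iff_inner by blast
    then have 1: "2 * (p \<bullet> (y - x)) \<le> r\<^sup>2 - D - p \<bullet> p"
      unfolding inner_add_self by (simp add: D_def power2_norm_eq_inner)
    have "p \<bullet> \<nu> \<le> norm p * norm \<nu>" by (rule norm_cauchy_schwarz)
    then have "p \<bullet> \<nu> \<le> r" using c(1) \<nu> by (simp add: p_def)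
    then have "\<beta> * (p \<bullet> \<nu>) \<le> \<beta> * r" using \<open>\<beta> > 0\<close> by simp
    then have "2 * (p \<bullet> w) \<le> r\<^sup>2 - p \<bullet> p - 2 * \<kappa>"
      using 1 by (simp add: w_def inner_add_right \<kappa>_def algebra_simps)
    then have "\<epsilon> * (2 * (p \<bullet> w)) \<le> \<epsilon> * (r\<^sup>2 - p \<bullet> p - 2 * \<kappa>)" using \<epsilon> by (intro mult_left_mono) auto
    moreover have "\<epsilon> * (\<epsilon> * (w \<bullet> w)) \<le> \<epsilon> * (2 * \<kappa>)" using \<epsilon> by (intro mult_left_mono) auto
    moreover have "\<epsilon> * (r\<^sup>2 - p \<bullet> p) \<le> 1 * (r\<^sup>2 - p \<bullet> p)" using \<epsilon> p by (intro mult_right_mono) auto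
    moreover have "(p + \<epsilon> *\<^sub>R w) \<bullet> (p + \<epsilon> *\<^sub>R w) = p \<bullet> p + \<epsilon> * (2 * (p \<bullet> w)) + \<epsilon> * (\<epsilon> * (w \<bullet> w))"
      unfolding inner_add_self by simp
    ultimately have "(p + \<epsilon> *\<^sub>R w) \<bullet> (p + \<epsilon> *\<^sub>R w) \<le> r\<^sup>2"
      unfolding right_diff_distrib mult_1 by linarith
    moreover have "x + \<epsilon> *\<^sub>R w - c = p + \<epsilon> *\<^sub>R w" by (simp add: p_def)
    ultimately show "norm (x + \<epsilon> *\<^sub>R w - c) \<le> r" using \<open>0 < r\<close> norm_le_iff_inner by (metis less_imp_le)
  qed
  from half[OF this] show False using w\<nu> \<epsilon> by (simp add: mult_le_0_iff)
qed

text \<open>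
  With \<open>d\<close> as the displacement from a point of a sphere of radius \<open>r\<close> with outer unit normal \<open>u\<close>,
  the quadratic inequality says that the displaced point lies in the ball. It replaces the ball
  from here on.
\<close>
lemma norm_le_iff_support:
  assumes "norm u = 1" "0 < r"
  shows "norm (d + r *\<^sub>R u) \<le> r \<longleftrightarrow> (norm d)\<^sup>2 + 2 * r * (d \<bullet> u) \<le> 0"
proof -
  have "u \<bullet> u = 1" using assms by (simp add: norm_eq_1)
  then have "(d + r *\<^sub>R u) \<bullet> (d + r *\<^sub>R u) = d \<bullet> d + 2 * r * (d \<bullet> u) + r\<^sup>2"
    unfolding inner_add_self by (simp add: power2_eq_square)
  then show ?thesis using assms(2) norm_le_iff_inner[of "d + r *\<^sub>R u" r] by (auto simp: power2_norm_eq_inner)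
qed

lemma r_convex_supporting_ball:
  assumes rc: "r_convex r K" and "0 < r" and x: "x \<in> K" and fr: "x \<notin> interior K"
  obtains \<nu> where "norm \<nu> = 1" "\<And>y. y \<in> K \<Longrightarrow> (norm (y - x))\<^sup>2 + 2 * r * ((y - x) \<bullet> \<nu>) \<le> 0"
proof -
  have cv: "convex K" using rc by (rule r_convex_imp_convex)
  have "\<exists>\<nu>. norm \<nu> = 1 \<and> (\<forall>z\<in>K. (z - x) \<bullet> \<nu> \<le> 0)"
  proof (cases "interior K = {}")
    case True
    then have "K = {x}" using r_convex_interior_nonempty[OF rc \<open>0 < r\<close>] x by blast
    then show ?thesis using norm_axis_1[of undefined] by (intro exI[of _ "axis undefined 1"]) simp
  next
    case False
    then have "x \<notin> rel_interior K" using fr by (simp add: rel_interior_nonempty_interior)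
    then obtain a where a: "a \<noteq> 0" "\<And>y. y \<in> K \<Longrightarrow> a \<bullet> x \<le> a \<bullet> y"
      using supporting_hyperplane_rel_boundary[OF cv x] by metis
    show ?thesis
    proof (intro exI conjI ballI)
      show "norm (- (1 / norm a) *\<^sub>R a) = 1" using a by simp
      fix z assume "z \<in> K"
      then have "0 \<le> (z - x) \<bullet> a" using a(2)[of z] by (simp add: inner_diff_right inner_commute[of _ a])
      then show "(z - x) \<bullet> (- (1 / norm a) *\<^sub>R a) \<le> 0" by simp
    qed
  qed
  then obtain \<nu> where "norm \<nu> = 1" "\<And>z. z \<in> K \<Longrightarrow> (z - x) \<bullet> \<nu> \<le> 0" by auto
  then show ?thesis using r_convex_subset_ball[OF rc \<open>0 < r\<close> x] that by blast
qed

text \<open>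
  A segment from an interior point of \<open>K\<close> to a point outside \<open>K\<close> crosses the frontier, and beyond
  the crossing it has left the ball that supports \<open>K\<close> there. So \<open>K\<close> is an intersection of balls of
  radius \<open>r\<close>.
\<close>
lemma r_convex_of_supporting_balls:
  assumes cl: "closed K" and int: "interior K \<noteq> {}" and "0 < r"
    and supp: "\<And>z. z \<in> frontier K \<Longrightarrow> \<exists>c. norm (z - c) = r \<and> (\<forall>y\<in>K. norm (y - c) \<le> r)"
  shows "r_convex r K"
proof (rule r_convexI, rule ccontr)
  fix x y w assume xy: "x \<in> K" "y \<in> K" and "w \<notin> K"
    and w: "\<And>c. norm (x - c) \<le> r \<Longrightarrow> norm (y - c) \<le> r \<Longrightarrow> norm (w - c) \<le> r"
  obtain p where p: "p \<in> interior K" using int by blast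
  then have "p \<in> K" using interior_subset by blast
  have "closed_segment p w \<inter> frontier K \<noteq> {}"
    using \<open>p \<in> K\<close> \<open>w \<notin> K\<close> by (intro connected_Int_frontier) auto
  then obtain z where z: "z \<in> closed_segment p w" "z \<in> frontier K" by blast
  obtain c where c: "norm (z - c) = r" "\<And>y. y \<in> K \<Longrightarrow> norm (y - c) \<le> r" using supp[OF z(2)] by blast
  have "norm (w - c) \<le> r" using w c xy by blast
  have "K \<subseteq> cball c r" using c by (auto simp: dist_norm norm_minus_commute)
  then have "p \<in> ball c r" using interior_mono[of K "cball c r"] p by auto
  then have pc: "norm (p - c) < r" by (simp add: dist_norm norm_minus_commute)
  obtain u where u: "0 \<le> u" "u \<le> 1" "z = (1 - u) *\<^sub>R p + u *\<^sub>R w" using z by (auto simp: in_segment)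
  have "z \<noteq> w" using z \<open>w \<notin> K\<close> cl frontier_subset_closed by blast
  then have "u \<noteq> 1" using u by auto
  have "z - c = (1 - u) *\<^sub>R (p - c) + u *\<^sub>R (w - c)" using u by (simp add: algebra_simps)
  then have "norm (z - c) \<le> (1 - u) * norm (p - c) + u * norm (w - c)"
    using u norm_triangle_ineq[of "(1 - u) *\<^sub>R (p - c)" "u *\<^sub>R (w - c)"] by simp
  also have "\<dots> < (1 - u) * r + u * r"
    using \<open>u \<noteq> 1\<close> u pc \<open>norm (w - c) \<le> r\<close> by (intro add_less_le_mono mult_strict_left_mono mult_left_mono) auto
  finally show False using c by (simp add: algebra_simps)
qed

text \<open>
  Two points of a sphere of radius \<open>r\<close> that are not antipodal are joined by a shorter great arc,
  and their hull contains this arc. The conclusion picks a point of it close to \<open>x\<close>.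
\<close>
lemma r_convex_short_arc:
  assumes rc: "r_convex r K" and "0 < r" and x: "x \<in> K" and y: "y \<in> K" and "x \<noteq> y"
    and xm: "norm (x - m) = r" and ym: "norm (y - m) = r" and xy: "norm (x - y) < 2 * r" and "0 < \<delta>"
  obtains z where "z \<in> K" "norm (z - m) = r" "z \<noteq> x" "norm (z - x) < \<delta>"
proof -
  define u where "u = (\<lambda>\<sigma>. (x - m) + \<sigma> *\<^sub>R (y - x))"
  \<comment> \<open>the radial projection of the chord onto the sphere\<close>
  define z where "z = (\<lambda>\<sigma>. m + (r / norm (u \<sigma>)) *\<^sub>R u \<sigma>)"
  have xx: "(x - m) \<bullet> (x - m) = r\<^sup>2" "(y - m) \<bullet> (y - m) = r\<^sup>2"
    using xm ym by (auto simp: power2_norm_eq_inner[symmetric])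
  have u_le: "norm (u \<sigma>) \<le> r" and u_conv: "u \<sigma> = (1 - \<sigma>) *\<^sub>R (x - m) + \<sigma> *\<^sub>R (y - m)"
    if "0 \<le> \<sigma>" "\<sigma> \<le> 1" for \<sigma>
  proof -
    show *: "u \<sigma> = (1 - \<sigma>) *\<^sub>R (x - m) + \<sigma> *\<^sub>R (y - m)" by (simp add: u_def algebra_simps)
    have "norm (u \<sigma>) \<le> (1 - \<sigma>) * norm (x - m) + \<sigma> * norm (y - m)"
      unfolding * using norm_triangle_ineq[of "(1 - \<sigma>) *\<^sub>R (x - m)" "\<sigma> *\<^sub>R (y - m)"] that by simp
    then show "norm (u \<sigma>) \<le> r" by (simp add: xm ym algebra_simps)
  qed
  have u_ne: "u \<sigma> \<noteq> 0" if "0 \<le> \<sigma>" "\<sigma> < 1/2" for \<sigma>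
  proof
    assume "u \<sigma> = 0"
    then have "norm (x - m) = norm (\<sigma> *\<^sub>R (y - x))" unfolding u_def
      by (metis add_eq_0_iff norm_minus_cancel)
    then have "r = \<sigma> * norm (x - y)" using that xm by (simp add: norm_minus_commute)
    also have "\<dots> \<le> (1/2) * norm (x - y)" using that by (intro mult_right_mono) auto
    finally show False using xy by simp
  qed
  have zK: "z \<sigma> \<in> K" if \<sigma>: "0 \<le> \<sigma>" "\<sigma> < 1/2" for \<sigma>
  proof (rule r_convexD[OF rc x y])
    fix c assume c: "norm (x - c) \<le> r" "norm (y - c) \<le> r"
    define p where "p = m - c"
    define l where "l = r / norm (u \<sigma>)"
    have l: "l \<ge> 1" using u_ne[OF \<sigma>] u_le[of \<sigma>] \<sigma> \<open>0 < r\<close> by (simp add: l_def)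
    have xyc: "x - c = (x - m) + p" "y - c = (y - m) + p" by (auto simp: p_def)
    have "((x - m) + p) \<bullet> ((x - m) + p) \<le> r\<^sup>2" "((y - m) + p) \<bullet> ((y - m) + p) \<le> r\<^sup>2"
      using c unfolding xyc norm_le_iff_inner by blast+
    then have 1: "2 * ((x - m) \<bullet> p) \<le> - (p \<bullet> p)" "2 * ((y - m) \<bullet> p) \<le> - (p \<bullet> p)"
      using xx by (simp_all add: inner_add_left inner_add_right inner_commute)
    have "2 * (u \<sigma> \<bullet> p) = (1 - \<sigma>) * (2 * ((x - m) \<bullet> p)) + \<sigma> * (2 * ((y - m) \<bullet> p))"
      using \<sigma> by (simp add: u_conv inner_add_left)
    also have "\<dots> \<le> (1 - \<sigma>) * (- (p \<bullet> p)) + \<sigma> * (- (p \<bullet> p))"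
      using \<sigma> 1 by (intro add_mono mult_left_mono) auto
    finally have 2: "2 * (u \<sigma> \<bullet> p) \<le> - (p \<bullet> p)" by (simp add: algebra_simps)
    have "l * (2 * (u \<sigma> \<bullet> p)) \<le> l * (- (p \<bullet> p))" using 2 l by (intro mult_left_mono) auto
    also have "\<dots> \<le> - (p \<bullet> p)" using l mult_right_mono[OF l, of "p \<bullet> p"] by simp
    finally have 3: "2 * l * (u \<sigma> \<bullet> p) \<le> - (p \<bullet> p)" by simp
    have "norm (l *\<^sub>R u \<sigma>) = r" using u_ne[OF \<sigma>] \<open>0 < r\<close> by (simp add: l_def)
    then have "(l *\<^sub>R u \<sigma>) \<bullet> (l *\<^sub>R u \<sigma>) = r\<^sup>2" by (metis power2_norm_eq_inner)
    then have "(l *\<^sub>R u \<sigma> + p) \<bullet> (l *\<^sub>R u \<sigma> + p) \<le> r\<^sup>2"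
      using 3 by (simp add: inner_add_left inner_add_right inner_commute)
    moreover have "z \<sigma> - c = l *\<^sub>R u \<sigma> + p" by (simp add: z_def l_def p_def)
    ultimately show "norm (z \<sigma> - c) \<le> r" using \<open>0 < r\<close> by (simp add: norm_le_iff_inner)
  qed
  have zm: "norm (z \<sigma> - m) = r" if "0 \<le> \<sigma>" "\<sigma> < 1/2" for \<sigma>
    using u_ne[OF that] \<open>0 < r\<close> by (simp add: z_def)
  have zx: "z \<sigma> \<noteq> x" if \<sigma>: "0 < \<sigma>" "\<sigma> < 1/2" for \<sigma>
  proof
    assume eq: "z \<sigma> = x"
    define l where "l = r / norm (u \<sigma>)"
    have l: "l > 0" using u_ne[of \<sigma>] \<sigma> \<open>0 < r\<close> by (simp add: l_def)
    have "x - m = l *\<^sub>R u \<sigma>" using eq by (simp add: z_def l_def algebra_simps)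
    then have e: "(l * \<sigma>) *\<^sub>R (y - m) = (1 - l * (1 - \<sigma>)) *\<^sub>R (x - m)" using \<sigma> by (simp add: u_conv algebra_simps)
    then have "norm ((l * \<sigma>) *\<^sub>R (y - m)) = norm ((1 - l * (1 - \<sigma>)) *\<^sub>R (x - m))" by simp
    then have "l * \<sigma> = \<bar>1 - l * (1 - \<sigma>)\<bar>" using l \<sigma> \<open>0 < r\<close> by (simp add: xm ym)
    then consider "1 - l * (1 - \<sigma>) = l * \<sigma>" | "1 - l * (1 - \<sigma>) = - (l * \<sigma>)" by linarith
    then show False
    proof cases
      case 1
      then have "y - m = x - m" using e l \<sigma> by simp
      then show False using \<open>x \<noteq> y\<close> by simp
    next
      case 2
      then have "(l * \<sigma>) *\<^sub>R (y - m) = (l * \<sigma>) *\<^sub>R (- (x - m))"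
        using e by (simp only: scaleR_minus_left scaleR_minus_right)
      then have "y - m = - (x - m)" using l \<sigma> by (metis mult_eq_0_iff less_irrefl scaleR_cancel_left)
      then have "x - y = 2 *\<^sub>R (x - m)" by (simp add: algebra_simps scaleR_2)
      then have "norm (x - y) = 2 * r" using xm by simp
      then show False using xy by simp
    qed
  qed
  have "isCont z 0"
    unfolding z_def u_def using u_ne[of 0] by (intro continuous_intros) (auto simp: u_def)
  moreover have "z 0 = x" using \<open>0 < r\<close> xm by (simp add: z_def u_def)
  ultimately obtain e where e: "e > 0" "\<And>\<sigma>. \<bar>\<sigma>\<bar> < e \<Longrightarrow> norm (z \<sigma> - x) < \<delta>"
    using \<open>0 < \<delta>\<close> unfolding continuous_at_eps_delta dist_norm by (metis diff_zero real_norm_def)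
  define \<sigma> where "\<sigma> = min (e / 2) (1/4)"
  have \<sigma>: "0 < \<sigma>" "\<sigma> < 1/2" "\<bar>\<sigma>\<bar> < e" using e by (auto simp: \<sigma>_def)
  show ?thesis using that[of "z \<sigma>"] zK[of \<sigma>] zm[of \<sigma>] zx[of \<sigma>] e(2)[of \<sigma>] \<sigma> by auto
qed

lemma r_convex_singleton:
  assumes "0 < r" shows "r_convex r {p}"
proof (rule r_convexI)
  fix x y w assume "x \<in> {p}" "y \<in> {p}" and w: "\<And>c. norm (x - c) \<le> r \<Longrightarrow> norm (y - c) \<le> r \<Longrightarrow> norm (w - c) \<le> r"
  then have xy: "x = p" "y = p" by auto
  show "w \<in> {p}"
  proof (rule ccontr)
    assume "w \<notin> {p}"
    then have n: "0 < norm (p - w)" by simp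
    define c where "c = p + (r / norm (p - w)) *\<^sub>R (p - w)"
    have "norm (p - c) = r" using n assms by (simp add: c_def)
    then have "norm (w - c) \<le> r" using w[of c] xy by simp
    moreover have "w - c = - ((1 + r / norm (p - w)) *\<^sub>R (p - w))" by (simp add: c_def algebra_simps)
    then have "norm (w - c) = (1 + r / norm (p - w)) * norm (p - w)" using assms n by simp
    then have "norm (w - c) = norm (p - w) + r" using n by (simp add: distrib_right)
    ultimately show False using n by simp
  qed
qed

section \<open>Continuation of supporting balls along a deformation\<close>

text \<open>
  Invariance of domain sends interior points to interior points, so a frontier point of the image
  comes from a frontier point of \<open>\<Omega>\<close>. The vector \<open>q\<close> is not normalized, which keeps the
  inequality linear in the data transported by the flow.
\<close>
lemma r_convex_image_of_supporting_balls:
  fixes \<Phi> :: "real^'n \<Rightarrow> real^'n"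
  assumes \<Omega>: "compact \<Omega>" "interior \<Omega> \<noteq> {}" and "0 < r"
    and cont: "continuous_on \<Omega> \<Phi>" and inj: "inj_on \<Phi> \<Omega>"
    and supp: "\<And>x. x \<in> \<Omega> \<Longrightarrow> x \<notin> interior \<Omega> \<Longrightarrow>
      \<exists>q. q \<noteq> 0 \<and> (\<forall>y\<in>\<Omega>. (norm (\<Phi> y - \<Phi> x))\<^sup>2 * norm q + 2 * r * ((\<Phi> y - \<Phi> x) \<bullet> q) \<le> 0)"
  shows "r_convex r (\<Phi> ` \<Omega>)"
proof (rule r_convex_of_supporting_balls)
  show cl: "closed (\<Phi> ` \<Omega>)" using compact_continuous_image[OF cont \<Omega>(1)] by (rule compact_imp_closed)
  have "open (\<Phi> ` interior \<Omega>)"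
    by (intro invariance_of_domain continuous_on_subset[OF cont] inj_on_subset[OF inj]
        interior_subset open_interior)
  then have int: "\<Phi> ` interior \<Omega> \<subseteq> interior (\<Phi> ` \<Omega>)"
    by (intro interior_maximal image_mono interior_subset)
  then show "interior (\<Phi> ` \<Omega>) \<noteq> {}" using \<Omega> by blast
  show "0 < r" by fact
  fix z assume z: "z \<in> frontier (\<Phi> ` \<Omega>)"
  then obtain x where x: "x \<in> \<Omega>" "z = \<Phi> x" using cl frontier_subset_closed by blast
  then have "x \<notin> interior \<Omega>" using z int by (auto simp: frontier_def)
  then obtain q where q: "q \<noteq> 0"
    "\<And>y. y \<in> \<Omega> \<Longrightarrow> (norm (\<Phi> y - \<Phi> x))\<^sup>2 * norm q + 2 * r * ((\<Phi> y - \<Phi> x) \<bullet> q) \<le> 0"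
    using supp[OF x(1)] by blast
  define u where "u = (1 / norm q) *\<^sub>R q"
  have u: "norm u = 1" using q by (simp add: u_def)
  show "\<exists>c. norm (z - c) = r \<and> (\<forall>y\<in>\<Phi> ` \<Omega>. norm (y - c) \<le> r)"
  proof (intro exI conjI ballI)
    show "norm (z - (\<Phi> x - r *\<^sub>R u)) = r" using x u \<open>0 < r\<close> by simp
    fix w assume "w \<in> \<Phi> ` \<Omega>"
    then obtain y where y: "y \<in> \<Omega>" "w = \<Phi> y" by blast
    have "(norm (\<Phi> y - \<Phi> x))\<^sup>2 + 2 * r * ((\<Phi> y - \<Phi> x) \<bullet> u) \<le> 0"
      using divide_right_mono[OF q(2)[OF y(1)], of "norm q"] q(1)
      by (simp add: u_def add_divide_distrib del: norm_mult)
    then have "norm ((\<Phi> y - \<Phi> x) + r *\<^sub>R u) \<le> r" using norm_le_iff_support[OF u \<open>0 < r\<close>] by blast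
    then show "norm (w - (\<Phi> x - r *\<^sub>R u)) \<le> r" using y by (simp add: algebra_simps)
  qed
qed

text \<open>
  Equality would put \<open>\<Phi> y\<close> on the supporting sphere at \<open>\<Phi> x\<close>. The arc between the two points stays
  in the image and on the sphere, which contradicts the strict inequality near \<open>x\<close>. The expansion
  bound turns closeness in the image into closeness in \<open>\<Omega>\<close>; the bound on the distance excludes
  antipodal points, for which no arc is singled out.
\<close>
lemma support_strict:
  fixes \<Phi> :: "real^'n \<Rightarrow> real^'n"
  assumes rc: "r_convex r (\<Phi> ` \<Omega>)" and "0 < r" and x: "x \<in> \<Omega>" and y: "y \<in> \<Omega>" and "y \<noteq> x" and "q \<noteq> 0"
    and short: "norm (\<Phi> y - \<Phi> x) < 2 * r"
    and expand: "\<And>z. z \<in> \<Omega> \<Longrightarrow> norm (z - x) \<le> E * norm (\<Phi> z - \<Phi> x)" and "0 < E" and "0 < \<delta>"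
    and loc: "\<And>z. z \<in> \<Omega> \<Longrightarrow> z \<noteq> x \<Longrightarrow> norm (z - x) < \<delta> \<Longrightarrow>
       (norm (\<Phi> z - \<Phi> x))\<^sup>2 * norm q + 2 * r * ((\<Phi> z - \<Phi> x) \<bullet> q) < 0"
  shows "(norm (\<Phi> y - \<Phi> x))\<^sup>2 * norm q + 2 * r * ((\<Phi> y - \<Phi> x) \<bullet> q) \<noteq> 0"
proof
  assume eq: "(norm (\<Phi> y - \<Phi> x))\<^sup>2 * norm q + 2 * r * ((\<Phi> y - \<Phi> x) \<bullet> q) = 0"
  define u where "u = (1 / norm q) *\<^sub>R q"
  have "norm u = 1" using \<open>q \<noteq> 0\<close> by (simp add: u_def)
  then have u: "norm u = 1" "u \<bullet> u = 1" by (auto simp: norm_eq_1)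
  define m where "m = \<Phi> x - r *\<^sub>R u"
  have sphere: "(norm (w - m))\<^sup>2 - r\<^sup>2 = (norm (w - \<Phi> x))\<^sup>2 + 2 * r * ((w - \<Phi> x) \<bullet> u)" for w
  proof -
    have wm: "w - m = (w - \<Phi> x) + r *\<^sub>R u" by (simp add: m_def)
    have "(norm (w - m))\<^sup>2 = ((w - \<Phi> x) + r *\<^sub>R u) \<bullet> ((w - \<Phi> x) + r *\<^sub>R u)"
      unfolding wm power2_norm_eq_inner ..
    also have "\<dots> = (w - \<Phi> x) \<bullet> (w - \<Phi> x) + 2 * r * ((w - \<Phi> x) \<bullet> u) + r\<^sup>2"
      unfolding inner_add_self[of "w - \<Phi> x"] using u by (simp add: power2_eq_square)
    finally show ?thesis by (simp add: power2_norm_eq_inner)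
  qed
  have "\<Phi> x \<noteq> \<Phi> y" using expand[OF y] \<open>y \<noteq> x\<close> by auto
  have "norm (\<Phi> x - m) = r" using u \<open>0 < r\<close> by (simp add: m_def)
  have "(norm (\<Phi> y - \<Phi> x))\<^sup>2 + 2 * r * ((\<Phi> y - \<Phi> x) \<bullet> u) = 0"
    using arg_cong[OF eq, of "\<lambda>a. a / norm q"] \<open>q \<noteq> 0\<close> by (simp add: u_def add_divide_distrib)
  then have "norm (\<Phi> y - m) = r" using sphere[of "\<Phi> y"] \<open>0 < r\<close> by simp
  have "norm (\<Phi> x - \<Phi> y) < 2 * r" using short by (simp add: norm_minus_commute)
  have "0 < \<delta> / E" using \<open>0 < E\<close> \<open>0 < \<delta>\<close> by simp
  obtain w where w: "w \<in> \<Phi> ` \<Omega>" "norm (w - m) = r" "w \<noteq> \<Phi> x" "norm (w - \<Phi> x) < \<delta> / E"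
    using r_convex_short_arc[OF rc \<open>0 < r\<close> imageI[OF x] imageI[OF y] \<open>\<Phi> x \<noteq> \<Phi> y\<close>
        \<open>norm (\<Phi> x - m) = r\<close> \<open>norm (\<Phi> y - m) = r\<close> \<open>norm (\<Phi> x - \<Phi> y) < 2 * r\<close> \<open>0 < \<delta> / E\<close>] .
  obtain z where z: "z \<in> \<Omega>" "w = \<Phi> z" using w(1) by blast
  have "E * norm (\<Phi> z - \<Phi> x) < \<delta>" using w(4) z \<open>0 < E\<close> by (simp add: field_simps)
  then have "norm (z - x) < \<delta>" using expand[OF z(1)] by linarith
  moreover have "z \<noteq> x" using w z by blast
  ultimately have "(norm (\<Phi> z - \<Phi> x))\<^sup>2 * norm q + 2 * r * ((\<Phi> z - \<Phi> x) \<bullet> q) < 0" by (rule loc[OF z(1), rotated])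
  then have "(norm (\<Phi> z - \<Phi> x))\<^sup>2 + 2 * r * ((\<Phi> z - \<Phi> x) \<bullet> u) < 0"
    using divide_strict_right_mono[of _ 0 "norm q"] \<open>q \<noteq> 0\<close> by (fastforce simp: u_def add_divide_distrib)
  then show False using sphere[of w] w(2) z by simp
qed

text \<open>
  The times at which the inequality holds and the times at which equality or violation occurs
  for some pair at distance at least \<open>\<delta>\<close> are two closed sets. By local strictness they cover the interval, and by
  \<open>support_strict\<close> they are disjoint. As the interval is connected and time \<open>0\<close> belongs to the
  first set, the second one is empty.
\<close>
lemma support_continuation:
  fixes \<phi> :: "real \<Rightarrow> real^'n \<Rightarrow> real^'n" and q :: "real \<Rightarrow> (real^'n) \<times> (real^'n) \<Rightarrow> real^'n"
    and N :: "((real^'n) \<times> (real^'n)) set"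
  assumes \<Omega>: "compact \<Omega>" "interior \<Omega> \<noteq> {}"
    and N: "compact N" "fst ` N \<subseteq> \<Omega>" "\<And>x. x \<in> \<Omega> \<Longrightarrow> x \<notin> interior \<Omega> \<Longrightarrow> \<exists>\<nu>. (x, \<nu>) \<in> N"
    and "0 \<le> t"
    and cont\<phi>: "continuous_on ({0..t} \<times> \<Omega>) (\<lambda>(\<tau>, x). \<phi> \<tau> x)"
    and contq: "continuous_on ({0..t} \<times> N) (\<lambda>(\<tau>, p). q \<tau> p)"
    and qne: "\<And>\<tau> p. \<tau> \<in> {0..t} \<Longrightarrow> p \<in> N \<Longrightarrow> q \<tau> p \<noteq> 0"
    and contr: "continuous_on {0..t} r" and rpos: "\<And>\<tau>. \<tau> \<in> {0..t} \<Longrightarrow> 0 < r \<tau>"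
    and short: "\<And>\<tau> x y. \<tau> \<in> {0..t} \<Longrightarrow> x \<in> \<Omega> \<Longrightarrow> y \<in> \<Omega> \<Longrightarrow> norm (\<phi> \<tau> y - \<phi> \<tau> x) < 2 * r \<tau>"
    and expand: "\<And>\<tau> x y. \<tau> \<in> {0..t} \<Longrightarrow> x \<in> \<Omega> \<Longrightarrow> y \<in> \<Omega> \<Longrightarrow> norm (y - x) \<le> E * norm (\<phi> \<tau> y - \<phi> \<tau> x)"
    and "0 < E" and "0 < \<delta>"
    and loc: "\<And>\<tau> x \<nu> y. \<tau> \<in> {0..t} \<Longrightarrow> (x, \<nu>) \<in> N \<Longrightarrow> y \<in> \<Omega> \<Longrightarrow> y \<noteq> x \<Longrightarrow> norm (y - x) < \<delta> \<Longrightarrow>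
       (norm (\<phi> \<tau> y - \<phi> \<tau> x))\<^sup>2 * norm (q \<tau> (x, \<nu>)) + 2 * r \<tau> * ((\<phi> \<tau> y - \<phi> \<tau> x) \<bullet> q \<tau> (x, \<nu>)) < 0"
    and init: "\<And>x \<nu> y. (x, \<nu>) \<in> N \<Longrightarrow> y \<in> \<Omega> \<Longrightarrow>
       (norm (\<phi> 0 y - \<phi> 0 x))\<^sup>2 * norm (q 0 (x, \<nu>)) + 2 * r 0 * ((\<phi> 0 y - \<phi> 0 x) \<bullet> q 0 (x, \<nu>)) \<le> 0"
  shows "\<And>\<tau> x \<nu> y. \<tau> \<in> {0..t} \<Longrightarrow> (x, \<nu>) \<in> N \<Longrightarrow> y \<in> \<Omega> \<Longrightarrow>
       (norm (\<phi> \<tau> y - \<phi> \<tau> x))\<^sup>2 * norm (q \<tau> (x, \<nu>)) + 2 * r \<tau> * ((\<phi> \<tau> y - \<phi> \<tau> x) \<bullet> q \<tau> (x, \<nu>)) \<le> 0"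
proof -
  define g where "g = (\<lambda>\<tau> p y. (norm (\<phi> \<tau> y - \<phi> \<tau> (fst p)))\<^sup>2 * norm (q \<tau> p)
    + 2 * r \<tau> * ((\<phi> \<tau> y - \<phi> \<tau> (fst p)) \<bullet> q \<tau> p))"
  define I where "I = {0..t}"
  have contg: "continuous_on (I \<times> N \<times> \<Omega>) (\<lambda>z. g (fst z) (fst (snd z)) (snd (snd z)))"
  proof -
    have 1: "continuous_on (I \<times> N \<times> \<Omega>) (\<lambda>z. \<phi> (fst z) (snd (snd z)))"
    proof -
      have "continuous_on (I \<times> N \<times> \<Omega>) (\<lambda>z. case (fst z, snd (snd z)) of (\<tau>, x) \<Rightarrow> \<phi> \<tau> x)"
        by (rule continuous_on_compose2[OF cont\<phi>]) (auto simp: I_def intro!: continuous_intros)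
      then show ?thesis by simp
    qed
    have 2: "continuous_on (I \<times> N \<times> \<Omega>) (\<lambda>z. \<phi> (fst z) (fst (fst (snd z))))"
    proof -
      have "continuous_on (I \<times> N \<times> \<Omega>) (\<lambda>z. case (fst z, fst (fst (snd z))) of (\<tau>, x) \<Rightarrow> \<phi> \<tau> x)"
        using N(2) by (intro continuous_on_compose2[OF cont\<phi>]) (fastforce simp: I_def intro!: continuous_intros)+
      then show ?thesis by simp
    qed
    have 3: "continuous_on (I \<times> N \<times> \<Omega>) (\<lambda>z. q (fst z) (fst (snd z)))"
    proof -
      have "continuous_on (I \<times> N \<times> \<Omega>) (\<lambda>z. case (fst z, fst (snd z)) of (\<tau>, x) \<Rightarrow> q \<tau> x)"
        by (rule continuous_on_compose2[OF contq]) (auto simp: I_def intro!: continuous_intros)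
      then show ?thesis by simp
    qed
    have 4: "continuous_on (I \<times> N \<times> \<Omega>) (\<lambda>z. r (fst z))"
      by (rule continuous_on_compose2[OF contr]) (auto simp: I_def intro!: continuous_intros)
    show ?thesis unfolding g_def by (intro continuous_intros 1 2 3 4)
  qed
  define S where "S = {\<tau> \<in> I. \<forall>p\<in>N. \<forall>y\<in>\<Omega>. g \<tau> p y \<le> 0}"
  define S' where "S' = {\<tau> \<in> I. \<exists>p\<in>N. \<exists>y\<in>\<Omega>. \<delta> \<le> norm (y - fst p) \<and> 0 \<le> g \<tau> p y}"
  have "closed S"
  proof -
    have "closed {\<tau> \<in> I. g \<tau> p y \<le> 0}" if "p \<in> N" "y \<in> \<Omega>" for p y
    proof -
      have "continuous_on I (\<lambda>\<tau>. g \<tau> p y)"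
      proof -
        have "continuous_on I (\<lambda>\<tau>. g (fst (\<tau>, p, y)) (fst (snd (\<tau>, p, y))) (snd (snd (\<tau>, p, y))))"
          using that by (intro continuous_on_compose2[OF contg]) (auto intro!: continuous_intros)
        then show ?thesis by simp
      qed
      then show ?thesis using continuous_on_closed_Collect_le[of I "\<lambda>\<tau>. g \<tau> p y" "\<lambda>_. 0"]
        by (auto simp: I_def intro!: continuous_intros)
    qed
    then have "closed (I \<inter> (\<Inter>p\<in>N. \<Inter>y\<in>\<Omega>. {\<tau> \<in> I. g \<tau> p y \<le> 0}))"
      by (intro closed_Int closed_INT ballI) (auto simp: I_def)
    moreover have "S = I \<inter> (\<Inter>p\<in>N. \<Inter>y\<in>\<Omega>. {\<tau> \<in> I. g \<tau> p y \<le> 0})" by (auto simp: S_def)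
    ultimately show ?thesis by simp
  qed
  moreover have "closed S'"
  proof -
    define Z where "Z = {z \<in> I \<times> N \<times> \<Omega>. \<delta> \<le> norm (snd (snd z) - fst (fst (snd z)))}"
    have cP: "compact (I \<times> N \<times> \<Omega>)" unfolding I_def by (intro compact_Times compact_Icc N \<Omega>)
    have "closed Z" unfolding Z_def
      by (intro continuous_on_closed_Collect_le continuous_intros compact_imp_closed[OF cP])
    moreover have "Z \<subseteq> I \<times> N \<times> \<Omega>" by (auto simp: Z_def)
    ultimately have cZ: "compact Z" using cP by (metis compact_Int_closed inf.absorb_iff2)
    define Z' where "Z' = {z \<in> Z. 0 \<le> g (fst z) (fst (snd z)) (snd (snd z))}"
    have "closed Z'" unfolding Z'_def
      by (intro continuous_on_closed_Collect_le continuous_intros compact_imp_closed[OF cZ]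
          continuous_on_subset[OF contg] \<open>Z \<subseteq> _\<close>)
    moreover have "Z' \<subseteq> Z" by (auto simp: Z'_def)
    ultimately have "compact Z'" using cZ by (metis compact_Int_closed inf.absorb_iff2)
    then have "compact (fst ` Z')" by (intro compact_continuous_image continuous_intros)
    moreover have "fst ` Z' = S'" by (force simp: Z'_def Z_def S'_def image_iff)
    ultimately show ?thesis using compact_imp_closed by blast
  qed
  moreover have "connected I" by (simp add: I_def)
  moreover have "I \<subseteq> S \<union> S'"
  proof
    fix \<tau> assume \<tau>: "\<tau> \<in> I"
    show "\<tau> \<in> S \<union> S'"
    proof (rule ccontr)
      assume "\<tau> \<notin> S \<union> S'"
      then obtain p y where py: "p \<in> N" "y \<in> \<Omega>" "0 < g \<tau> p y" "\<not> \<delta> \<le> norm (y - fst p)"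
        using \<tau> unfolding S_def S'_def by force
      then have "y \<noteq> fst p" by (auto simp: g_def)
      then show False using loc[of \<tau> "fst p" "snd p" y] \<tau> py by (auto simp: I_def g_def)
    qed
  qed
  moreover have "S \<inter> S' \<inter> I = {}"
  proof (rule ccontr)
    assume "S \<inter> S' \<inter> I \<noteq> {}"
    then obtain \<tau> p y where \<tau>: "\<tau> \<in> S" "\<tau> \<in> I" and p: "p \<in> N" and y: "y \<in> \<Omega>" "\<delta> \<le> norm (y - fst p)" "0 \<le> g \<tau> p y"
      unfolding S'_def by auto
    have x: "fst p \<in> \<Omega>" using p N by auto
    have \<tau>': "\<tau> \<in> {0..t}" using \<tau> by (simp add: I_def)
    have rc: "r_convex (r \<tau>) (\<phi> \<tau> ` \<Omega>)"
    proof (rule r_convex_image_of_supporting_balls[OF \<Omega> rpos[OF \<tau>']])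
      show "continuous_on \<Omega> (\<phi> \<tau>)"
      proof -
        have "continuous_on \<Omega> (\<lambda>x. case (\<tau>, x) of (\<tau>, x) \<Rightarrow> \<phi> \<tau> x)"
          using \<tau>' by (intro continuous_on_compose2[OF cont\<phi>]) (auto intro!: continuous_intros)
        then show ?thesis by simp
      qed
      show "inj_on (\<phi> \<tau>) \<Omega>"
      proof (rule inj_onI)
        fix x y assume "x \<in> \<Omega>" "y \<in> \<Omega>" "\<phi> \<tau> x = \<phi> \<tau> y"
        then show "x = y" using expand[OF \<tau>', of x y] by simp
      qed
      fix x assume "x \<in> \<Omega>" "x \<notin> interior \<Omega>"
      then obtain \<nu> where \<nu>: "(x, \<nu>) \<in> N" using N by blast
      show "\<exists>q. q \<noteq> 0 \<and> (\<forall>y\<in>\<Omega>. (norm (\<phi> \<tau> y - \<phi> \<tau> x))\<^sup>2 * norm q + 2 * r \<tau> * ((\<phi> \<tau> y - \<phi> \<tau> x) \<bullet> q) \<le> 0)"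
        using qne[OF \<tau>' \<nu>] \<tau>(1) \<nu> unfolding S_def g_def by (intro exI[of _ "q \<tau> (x, \<nu>)"]) force
    qed
    have "y \<noteq> fst p" using y \<open>0 < \<delta>\<close> by auto
    have "g \<tau> p y \<noteq> 0" unfolding g_def
      by (rule support_strict[OF rc rpos[OF \<tau>'] x y(1) \<open>y \<noteq> fst p\<close> qne[OF \<tau>' p] short[OF \<tau>' x y(1)]
            expand[OF \<tau>' x] \<open>0 < E\<close> \<open>0 < \<delta>\<close>])
         (use loc[OF \<tau>', of "fst p" "snd p"] p in auto)
    moreover have "g \<tau> p y \<le> 0" using \<tau>(1) p y unfolding S_def by blast
    ultimately show False using y by simp
  qed
  moreover have "0 \<in> S \<inter> I" using init \<open>0 \<le> t\<close> by (auto simp: S_def I_def g_def)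
  ultimately have "S' \<inter> I = {}" unfolding connected_closed by blast
  then have "I \<subseteq> S" using \<open>I \<subseteq> S \<union> S'\<close> by blast
  fix \<tau> x \<nu> y assume "\<tau> \<in> {0..t}" "(x, \<nu>) \<in> N" "y \<in> \<Omega>"
  then have "g \<tau> (x, \<nu>) y \<le> 0" using \<open>I \<subseteq> S\<close> unfolding S_def I_def by blast
  then show "(norm (\<phi> \<tau> y - \<phi> \<tau> x))\<^sup>2 * norm (q \<tau> (x, \<nu>)) + 2 * r \<tau> * ((\<phi> \<tau> y - \<phi> \<tau> x) \<bullet> q \<tau> (x, \<nu>)) \<le> 0"
    by (simp add: g_def)
qed

section \<open>Extremal eigenvalues and quadratic forms\<close>

lemma inner_sym_part: "v \<bullet> (sym_part A *v v) = v \<bullet> (A *v v)"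
proof -
  have "v \<bullet> (transpose A *v v) = v \<bullet> (A *v v)"
    by (simp add: dot_lmul_matrix[symmetric] inner_commute)
  then show ?thesis
    by (simp add: sym_part_def scaleR_matrix_vector_assoc[symmetric] matrix_vector_mult_add_rdistrib inner_add_right)
qed

lemma sym_part_selfadjoint: "v \<bullet> (sym_part A *v w) = (sym_part A *v v) \<bullet> w"
proof -
  have "transpose (sym_part A) = sym_part A"
    by (simp add: sym_part_def transpose_def vec_eq_iff)
  then show ?thesis by (metis dot_lmul_matrix vector_transpose_matrix)
qed

text \<open>
  Eigenvectors of a symmetric matrix for distinct eigenvalues are orthogonal, hence linearly
  independent.
\<close>
lemma finite_eigenvalues_sym_part: "finite (eigenvalues (sym_part A))"
proof -
  let ?S = "sym_part A"
  have "\<forall>c\<in>eigenvalues ?S. \<exists>v. v \<noteq> 0 \<and> ?S *v v = c *\<^sub>R v" by (auto simp: eigenvalues_def)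
  then obtain e where e: "\<And>c. c \<in> eigenvalues ?S \<Longrightarrow> e c \<noteq> 0 \<and> ?S *v e c = c *\<^sub>R e c" by metis
  have orth: "e c \<bullet> e d = 0" if "c \<in> eigenvalues ?S" "d \<in> eigenvalues ?S" "c \<noteq> d" for c d
  proof -
    have "e c \<bullet> (?S *v e d) = (?S *v e c) \<bullet> e d" by (rule sym_part_selfadjoint)
    then show ?thesis using e that by simp
  qed
  have inj: "inj_on e (eigenvalues ?S)"
    by (rule inj_onI) (metis e inner_eq_zero_iff orth)
  have "independent (e ` eigenvalues ?S)"
    by (rule pairwise_orthogonal_independent) (use e orth in \<open>auto simp: pairwise_def orthogonal_def\<close>)
  then have "finite (e ` eigenvalues ?S)" by (rule independent_imp_finite)
  then show ?thesis using inj finite_imageD by blast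
qed

text \<open>
  The quadratic form attains a maximum \<open>c\<close> on the unit sphere; stationarity there is the eigenvalue
  equation.
\<close>
lemma quadratic_form_max_eigenvalue:
  fixes S :: "real^'n^'n"
  assumes sa: "\<And>v w. v \<bullet> (S *v w) = (S *v v) \<bullet> w"
  obtains c where "c \<in> eigenvalues S" "\<And>v. v \<bullet> (S *v v) \<le> c * (v \<bullet> v)"
proof -
  have "compact (sphere (0::real^'n) 1)" by simp
  moreover have "sphere (0::real^'n) 1 \<noteq> {}" by simp
  moreover have "continuous_on (sphere 0 1) (\<lambda>v. v \<bullet> (S *v v))"
    by (intro continuous_intros linear_continuous_on linear_linear[THEN iffD2] matrix_vector_mul_bounded_linear)
  ultimately obtain v0 where v0: "v0 \<in> sphere 0 1" "\<And>v. v \<in> sphere 0 1 \<Longrightarrow> v \<bullet> (S *v v) \<le> v0 \<bullet> (S *v v0)"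
    using continuous_attains_sup by metis
  define c where "c = v0 \<bullet> (S *v v0)"
  have le: "v \<bullet> (S *v v) \<le> c * (v \<bullet> v)" for v
  proof (cases "v = 0")
    case False
    define u where "u = (1 / norm v) *\<^sub>R v"
    have "u \<bullet> (S *v u) \<le> c" using v0(2)[of u] False by (simp add: c_def u_def)
    then have "(v \<bullet> (S *v v)) / (norm v * norm v) \<le> c" by (simp add: u_def matrix_vector_mult_scaleR)
    then show ?thesis using False
      by (simp add: pos_divide_le_eq power2_norm_eq_inner[symmetric] power2_eq_square)
  qed simp
  define z where "z = S *v v0 - c *\<^sub>R v0"
  have v01: "v0 \<bullet> v0 = 1" "v0 \<noteq> 0" using v0 by (auto simp: norm_eq_1[symmetric])
  have "z \<bullet> z = 0"
  proof (rule ccontr)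
    assume "z \<bullet> z \<noteq> 0"
    then have zz: "z \<bullet> z > 0" by simp
    \<comment> \<open>a step \<open>h\<close> along the gradient \<open>z\<close>, short enough for the first-order gain to exceed the second-order terms\<close>
    define B where "B = \<bar>z \<bullet> (S *v z)\<bar> + \<bar>c * (z \<bullet> z)\<bar> + 1"
    have B: "B > 0" by (simp add: B_def)
    define h where "h = (z \<bullet> z) / B"
    have h: "h > 0" using B zz by (simp add: h_def)
    have vz: "v0 \<bullet> (S *v z) = (S *v v0) \<bullet> z" by (rule sa)
    have "(v0 + h *\<^sub>R z) \<bullet> (S *v (v0 + h *\<^sub>R z)) = c + 2 * h * ((S *v v0) \<bullet> z) + h\<^sup>2 * (z \<bullet> (S *v z))"
      using vz by (simp add: matrix_vector_right_distrib matrix_vector_mult_scaleR inner_add_left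
          inner_add_right c_def inner_commute[of z "S *v v0"] power2_eq_square algebra_simps)
    moreover have "c * ((v0 + h *\<^sub>R z) \<bullet> (v0 + h *\<^sub>R z)) = c + 2 * h * (c * (v0 \<bullet> z)) + h\<^sup>2 * (c * (z \<bullet> z))"
      using v01 by (simp add: inner_add_left inner_add_right inner_commute[of z v0] power2_eq_square algebra_simps)
    ultimately have "2 * h * ((S *v v0) \<bullet> z) + h\<^sup>2 * (z \<bullet> (S *v z)) \<le> 2 * h * (c * (v0 \<bullet> z)) + h\<^sup>2 * (c * (z \<bullet> z))"
      using le[of "v0 + h *\<^sub>R z"] by linarith
    moreover have "(S *v v0) \<bullet> z - c * (v0 \<bullet> z) = z \<bullet> z" by (simp add: z_def inner_diff_left)
    then have "(S *v v0) \<bullet> z = c * (v0 \<bullet> z) + z \<bullet> z" by linarith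
    ultimately have "h * (2 * (z \<bullet> z)) \<le> h * (h * (c * (z \<bullet> z) - z \<bullet> (S *v z)))"
      by (simp add: power2_eq_square algebra_simps)
    then have "2 * (z \<bullet> z) \<le> h * (c * (z \<bullet> z) - z \<bullet> (S *v z))" using h by simp
    also have "\<dots> \<le> h * B" using h by (intro mult_left_mono) (auto simp: B_def)
    also have "\<dots> = z \<bullet> z" using B by (simp add: h_def)
    finally show False using zz by simp
  qed
  then have "S *v v0 = c *\<^sub>R v0" by (simp add: z_def)
  then have "c \<in> eigenvalues S" using v01 by (auto simp: eigenvalues_def)
  then show ?thesis using le that by blast
qed

lemma inner_le_mu_plus: "v \<bullet> (A *v v) \<le> mu_plus A * (v \<bullet> v)"
proof -
  obtain c where c: "c \<in> eigenvalues (sym_part A)" "\<And>v. v \<bullet> (sym_part A *v v) \<le> c * (v \<bullet> v)"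
    using quadratic_form_max_eigenvalue[OF sym_part_selfadjoint] by metis
  have "c \<le> mu_plus A" unfolding mu_plus_def using c(1) finite_eigenvalues_sym_part by (intro Max_ge)
  then have "c * (v \<bullet> v) \<le> mu_plus A * (v \<bullet> v)" by (intro mult_right_mono) auto
  then show ?thesis using c(2)[of v] by (simp add: inner_sym_part)
qed

text \<open>
  The statement for the maximum, applied to the negated symmetric part.
\<close>
lemma inner_ge_mu_minus: "mu_minus A * (v \<bullet> v) \<le> v \<bullet> (A *v v)"
proof -
  have mv: "(- M) *v w = - (M *v w)" for M :: "real^'n^'n" and w
    by (simp add: matrix_vector_mult_def vec_eq_iff sum_negf)
  have "w \<bullet> ((- sym_part A) *v u) = ((- sym_part A) *v w) \<bullet> u" for w u
    using sym_part_selfadjoint[of w A u] by (simp add: mv)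
  then obtain c where c: "c \<in> eigenvalues (- sym_part A)" "\<And>v. v \<bullet> ((- sym_part A) *v v) \<le> c * (v \<bullet> v)"
    using quadratic_form_max_eigenvalue by metis
  have "- c \<in> eigenvalues (sym_part A)"
    using c(1) by (auto simp: eigenvalues_def mv) (metis minus_equation_iff)
  then have "mu_minus A \<le> - c" unfolding mu_minus_def using finite_eigenvalues_sym_part by (intro Min_le)
  then have "mu_minus A * (v \<bullet> v) \<le> - c * (v \<bullet> v)" by (intro mult_right_mono) auto
  then show ?thesis using c(2)[of v] by (simp add: mv inner_sym_part)
qed

section \<open>Gronwall estimates\<close>

text \<open>
  The alternative on \<open>a\<close> and \<open>b\<close> allows both uses: growth and decay rates of any sign without
  forcing, and a nonnegative rate with forcing.
\<close>
lemma gronwall_scalar: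
  fixes f f' :: "real \<Rightarrow> real"
  assumes der: "\<And>\<tau>. \<tau> \<in> {0..t} \<Longrightarrow> (f has_real_derivative f' \<tau>) (at \<tau> within {0..t})"
    and le: "\<And>\<tau>. \<tau> \<in> {0..t} \<Longrightarrow> f' \<tau> \<le> a * f \<tau> + b"
    and b: "0 \<le> b" "0 \<le> a \<or> b = 0" and \<tau>: "\<tau> \<in> {0..t}"
  shows "f \<tau> \<le> (f 0 + b * \<tau>) * exp (a * \<tau>)"
proof -
  \<comment> \<open>nonincreasing by the differential inequality\<close>
  define w where "w = (\<lambda>\<sigma>. f \<sigma> * exp (- a * \<sigma>) - b * \<sigma>)"
  have d: "(w has_real_derivative ((f' \<sigma> - a * f \<sigma>) * exp (- a * \<sigma>) - b)) (at \<sigma> within {0..t})"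
    if "\<sigma> \<in> {0..t}" for \<sigma>
    unfolding w_def by (auto intro!: derivative_eq_intros der[OF that] simp: algebra_simps)
  have "w \<tau> \<le> w 0"
  proof (rule DERIV_nonpos_imp_decreasing_open[of 0 \<tau> w])
    show "0 \<le> \<tau>" using \<tau> by simp
    have "continuous_on {0..t} w" using d by (rule DERIV_continuous_on)
    then show "continuous_on {0..\<tau>} w" using \<tau> by (auto elim: continuous_on_subset)
    fix \<sigma> assume \<sigma>: "0 < \<sigma>" "\<sigma> < \<tau>"
    then have \<sigma>t: "\<sigma> \<in> {0..t}" using \<tau> by simp
    have "(w has_real_derivative ((f' \<sigma> - a * f \<sigma>) * exp (- a * \<sigma>) - b)) (at \<sigma>)"
      using d[OF \<sigma>t] at_within_Icc_at[of 0 \<sigma> t] \<sigma> \<tau> by simp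
    moreover have "(f' \<sigma> - a * f \<sigma>) * exp (- a * \<sigma>) \<le> b * exp (- a * \<sigma>)"
      using le[OF \<sigma>t] by (intro mult_right_mono) auto
    moreover have "b * exp (- a * \<sigma>) \<le> b * 1"
      using b \<sigma> by (cases "b = 0") (auto intro!: mult_left_mono)
    ultimately show "\<exists>y. (w has_real_derivative y) (at \<sigma>) \<and> y \<le> 0"
      by (intro exI[of _ "(f' \<sigma> - a * f \<sigma>) * exp (- a * \<sigma>) - b"] conjI) linarith+
  qed
  then have "f \<tau> * exp (- a * \<tau>) \<le> f 0 + b * \<tau>" by (simp add: w_def)
  then have "f \<tau> * exp (- a * \<tau>) * exp (a * \<tau>) \<le> (f 0 + b * \<tau>) * exp (a * \<tau>)"
    by (intro mult_right_mono) auto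
  then show ?thesis by (simp add: mult.assoc exp_add[symmetric])
qed

lemma has_real_derivative_inner_self:
  fixes v :: "real \<Rightarrow> 'a::real_inner"
  assumes "(v has_vector_derivative v') (at \<tau> within S)"
  shows "((\<lambda>\<tau>. v \<tau> \<bullet> v \<tau>) has_real_derivative 2 * (v \<tau> \<bullet> v')) (at \<tau> within S)"
proof -
  have "((\<lambda>\<tau>. v \<tau> \<bullet> v \<tau>) has_derivative (\<lambda>h. v \<tau> \<bullet> (h *\<^sub>R v') + (h *\<^sub>R v') \<bullet> v \<tau>)) (at \<tau> within S)"
    using assms unfolding has_vector_derivative_def by (intro has_derivative_inner)
  moreover have "(\<lambda>h. v \<tau> \<bullet> (h *\<^sub>R v') + (h *\<^sub>R v') \<bullet> v \<tau>) = (*) (2 * (v \<tau> \<bullet> v'))"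
    by (auto simp: inner_commute[of v' "v \<tau>"])
  ultimately show ?thesis unfolding has_field_derivative_def by simp
qed

text \<open>
  Only the quadratic form \<open>v \<bullet> v'\<close> enters, so the rate can be an eigenvalue of a symmetric part
  rather than an operator norm.
\<close>
lemma gronwall_norm_upper:
  fixes v v' :: "real \<Rightarrow> 'a::real_inner"
  assumes der: "\<And>\<tau>. \<tau> \<in> {0..t} \<Longrightarrow> (v has_vector_derivative v' \<tau>) (at \<tau> within {0..t})"
    and le: "\<And>\<tau>. \<tau> \<in> {0..t} \<Longrightarrow> v \<tau> \<bullet> v' \<tau> \<le> a * (v \<tau> \<bullet> v \<tau>)" and \<tau>: "\<tau> \<in> {0..t}"
  shows "norm (v \<tau>) \<le> norm (v 0) * exp (a * \<tau>)"
proof -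
  have "v \<tau> \<bullet> v \<tau> \<le> (v 0 \<bullet> v 0 + 0 * \<tau>) * exp ((2 * a) * \<tau>)"
    by (rule gronwall_scalar[OF has_real_derivative_inner_self[OF der]]) (use le \<tau> in auto)
  then have "(norm (v \<tau>))\<^sup>2 \<le> (norm (v 0) * exp (a * \<tau>))\<^sup>2"
    by (simp add: power2_norm_eq_inner power_mult_distrib exp_double[symmetric] algebra_simps)
  then show ?thesis by (rule power2_le_imp_le) simp
qed

lemma gronwall_norm_lower:
  fixes v v' :: "real \<Rightarrow> 'a::real_inner"
  assumes der: "\<And>\<tau>. \<tau> \<in> {0..t} \<Longrightarrow> (v has_vector_derivative v' \<tau>) (at \<tau> within {0..t})"
    and ge: "\<And>\<tau>. \<tau> \<in> {0..t} \<Longrightarrow> a * (v \<tau> \<bullet> v \<tau>) \<le> v \<tau> \<bullet> v' \<tau>" and \<tau>: "\<tau> \<in> {0..t}"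
  shows "norm (v 0) * exp (a * \<tau>) \<le> norm (v \<tau>)"
proof -
  have "- (v \<tau> \<bullet> v \<tau>) \<le> (- (v 0 \<bullet> v 0) + 0 * \<tau>) * exp ((2 * a) * \<tau>)"
    by (rule gronwall_scalar[OF DERIV_minus[OF has_real_derivative_inner_self[OF der]]])
       (use ge \<tau> in \<open>auto simp: algebra_simps\<close>)
  then have "(norm (v 0) * exp (a * \<tau>))\<^sup>2 \<le> (norm (v \<tau>))\<^sup>2"
    by (simp add: power2_norm_eq_inner power_mult_distrib exp_double[symmetric] algebra_simps)
  then show ?thesis by (rule power2_le_imp_le) simp
qed

text \<open>
  Solutions of a perturbed linear equation that start at \<open>0\<close> are small with the perturbation: here
  \<open>w\<close> is the linear part of the right-hand side and \<open>c\<close> bounds the rest. Every error term below is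
  estimated in this way.
\<close>
lemma gronwall_forced:
  fixes v v' w :: "real \<Rightarrow> 'a::real_inner"
  assumes der: "\<And>\<tau>. \<tau> \<in> {0..t} \<Longrightarrow> (v has_vector_derivative v' \<tau>) (at \<tau> within {0..t})"
    and "v 0 = 0"
    and w: "\<And>\<tau>. \<tau> \<in> {0..t} \<Longrightarrow> norm (w \<tau>) \<le> B * norm (v \<tau>)"
    and c: "\<And>\<tau>. \<tau> \<in> {0..t} \<Longrightarrow> norm (v' \<tau> - w \<tau>) \<le> c" and \<tau>: "\<tau> \<in> {0..t}" and "0 \<le> B"
  shows "norm (v \<tau>) \<le> c * exp ((B + 1) * t)"
proof -
  have "0 \<le> c" using c[OF \<tau>] norm_ge_zero order_trans by blast
  have "v \<tau> \<bullet> v \<tau> \<le> (v 0 \<bullet> v 0 + c\<^sup>2 * \<tau>) * exp ((2 * B + 1) * \<tau>)"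
  proof (rule gronwall_scalar[OF has_real_derivative_inner_self[OF der]])
    fix \<sigma> assume \<sigma>: "\<sigma> \<in> {0..t}"
    have "v \<sigma> \<bullet> v' \<sigma> = v \<sigma> \<bullet> w \<sigma> + v \<sigma> \<bullet> (v' \<sigma> - w \<sigma>)" by (simp add: inner_diff_right)
    also have "\<dots> \<le> norm (v \<sigma>) * norm (w \<sigma>) + norm (v \<sigma>) * norm (v' \<sigma> - w \<sigma>)"
      by (intro add_mono norm_cauchy_schwarz)
    also have "\<dots> \<le> norm (v \<sigma>) * (B * norm (v \<sigma>)) + norm (v \<sigma>) * c"
      using w[OF \<sigma>] c[OF \<sigma>] by (intro add_mono mult_left_mono) auto
    also have "\<dots> \<le> B * (norm (v \<sigma>))\<^sup>2 + ((norm (v \<sigma>))\<^sup>2 + c\<^sup>2) / 2"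
      using sum_squares_bound[of "norm (v \<sigma>)" c] by (simp add: power2_eq_square algebra_simps)
    finally show "2 * (v \<sigma> \<bullet> v' \<sigma>) \<le> (2 * B + 1) * (v \<sigma> \<bullet> v \<sigma>) + c\<^sup>2"
      by (simp add: power2_norm_eq_inner add_divide_distrib algebra_simps)
  qed (use \<tau> \<open>0 \<le> B\<close> in auto)
  also have "\<dots> = c\<^sup>2 * (\<tau> * exp ((2 * B + 1) * \<tau>))" using \<open>v 0 = 0\<close> by simp
  also have "\<dots> \<le> c\<^sup>2 * (exp t * exp ((2 * B + 1) * t))"
  proof (intro mult_left_mono mult_mono)
    have "\<tau> \<le> t" using \<tau> by simp
    also have "t \<le> exp t" using exp_ge_add_one_self[of t] by linarith
    finally show "\<tau> \<le> exp t" .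
    show "exp ((2 * B + 1) * \<tau>) \<le> exp ((2 * B + 1) * t)" using \<tau> \<open>0 \<le> B\<close> by (auto intro!: mult_left_mono)
  qed auto
  also have "\<dots> = (c * exp ((B + 1) * t))\<^sup>2"
    by (simp add: power_mult_distrib exp_double[symmetric] exp_add[symmetric] algebra_simps)
  finally have "(norm (v \<tau>))\<^sup>2 \<le> (c * exp ((B + 1) * t))\<^sup>2" by (simp add: power2_norm_eq_inner)
  then show ?thesis by (rule power2_le_imp_le) (use \<open>0 \<le> c\<close> in simp)
qed

lemma has_vector_derivative_imp_continuous_on:
  assumes "\<And>\<tau>. \<tau> \<in> S \<Longrightarrow> (v has_vector_derivative v' \<tau>) (at \<tau> within S)"
  shows "continuous_on S v"
  using assms has_vector_derivative_continuous unfolding continuous_on_eq_continuous_within by blast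

text \<open>
  The differential inequality is assumed only while \<open>v\<close> has not left the ball of radius \<open>\<eta>\<close>, since
  a vector field on an open set is only locally Lipschitz. A sufficiently small start keeps \<open>v\<close> in
  that ball, as a first exit time would contradict the estimate up to that time.
\<close>
lemma gronwall_bootstrap:
  fixes v v' :: "real \<Rightarrow> 'a::real_inner"
  assumes der: "\<And>\<tau>. \<tau> \<in> {0..t} \<Longrightarrow> (v has_vector_derivative v' \<tau>) (at \<tau> within {0..t})"
    and le: "\<And>\<tau>. \<tau> \<in> {0..t} \<Longrightarrow> norm (v \<tau>) \<le> \<eta> \<Longrightarrow> norm (v' \<tau>) \<le> a * norm (v \<tau>)"
    and small: "norm (v 0) * exp (a * t) < \<eta>" and "0 \<le> a" and \<tau>: "\<tau> \<in> {0..t}"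
  shows "norm (v \<tau>) \<le> norm (v 0) * exp (a * \<tau>)"
proof -
  have upto: "norm (v \<sigma>) \<le> norm (v 0) * exp (a * \<sigma>)"
    if s: "s \<in> {0..t}" and small: "\<And>\<sigma>. \<sigma> \<in> {0..s} \<Longrightarrow> norm (v \<sigma>) \<le> \<eta>" and \<sigma>: "\<sigma> \<in> {0..s}" for s \<sigma>
  proof (rule gronwall_norm_upper[OF _ _ \<sigma>])
    fix \<rho> assume \<rho>: "\<rho> \<in> {0..s}"
    then have \<rho>': "\<rho> \<in> {0..t}" using s by auto
    show "(v has_vector_derivative v' \<rho>) (at \<rho> within {0..s})"
      using der[OF \<rho>'] s by (auto elim: has_vector_derivative_within_subset)
    have "v \<rho> \<bullet> v' \<rho> \<le> norm (v \<rho>) * norm (v' \<rho>)" by (rule norm_cauchy_schwarz)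
    also have "\<dots> \<le> norm (v \<rho>) * (a * norm (v \<rho>))"
      using le[OF \<rho>' small[OF \<rho>]] by (intro mult_left_mono) auto
    finally show "v \<rho> \<bullet> v' \<rho> \<le> a * (v \<rho> \<bullet> v \<rho>)"
      by (simp add: power2_norm_eq_inner[symmetric] power2_eq_square algebra_simps)
  qed
  have cont: "continuous_on {0..t} (\<lambda>\<tau>. norm (v \<tau>))"
    by (intro continuous_on_norm has_vector_derivative_imp_continuous_on[OF der])
  define A where "A = {\<tau> \<in> {0..t}. \<eta> \<le> norm (v \<tau>)}"
  have "A = {}"
  proof (rule ccontr)
    assume "A \<noteq> {}"
    have "closed A" unfolding A_def
      by (intro continuous_on_closed_Collect_le continuous_on_const cont) simp
    moreover have bb: "bdd_below A" by (auto simp: A_def intro!: bdd_belowI[of _ 0])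
    ultimately have T: "Inf A \<in> A" using \<open>A \<noteq> {}\<close> closed_contains_Inf by blast
    \<comment> \<open>the first time at which the norm reaches \<open>\<eta>\<close>\<close>
    define T where "T = Inf A"
    have TA: "T \<in> {0..t}" "\<eta> \<le> norm (v T)" using T by (auto simp: A_def T_def)
    have before: "norm (v \<sigma>) < \<eta>" if "0 \<le> \<sigma>" "\<sigma> < T" for \<sigma>
    proof (rule ccontr)
      assume "\<not> norm (v \<sigma>) < \<eta>"
      then have "\<sigma> \<in> A" using that TA by (auto simp: A_def)
      then have "T \<le> \<sigma>" unfolding T_def by (rule cInf_lower[OF _ bb])
      then show False using that by simp
    qed
    have "norm (v 0) < \<eta>"
      using small TA \<open>0 \<le> a\<close> mult_left_mono[of 1 "exp (a * t)" "norm (v 0)"] by auto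
    then have "T > 0" using TA by (cases "T = 0") auto
    have atT: "norm (v T) \<le> \<eta>"
    proof (rule continuous_on_closure_norm_le[of "{0..<T}" v \<eta> T])
      show "continuous_on (closure {0..<T}) v"
        using \<open>T > 0\<close> TA has_vector_derivative_imp_continuous_on[OF der] by (auto elim: continuous_on_subset)
    qed (use \<open>T > 0\<close> before in \<open>auto intro: less_imp_le\<close>)
    have "norm (v T) \<le> norm (v 0) * exp (a * T)"
    proof (rule upto[OF TA(1)])
      fix \<sigma> assume "\<sigma> \<in> {0..T}"
      then show "norm (v \<sigma>) \<le> \<eta>" using before[of \<sigma>] atT by (cases "\<sigma> = T") auto
    qed (use TA in auto)
    also have "\<dots> \<le> norm (v 0) * exp (a * t)" using TA \<open>0 \<le> a\<close> by (auto intro!: mult_left_mono)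
    finally show False using small TA by linarith
  qed
  then have "norm (v \<sigma>) \<le> \<eta>" if "\<sigma> \<in> {0..t}" for \<sigma> using that unfolding A_def by force
  then show ?thesis using upto[of t \<tau>] \<tau> by auto
qed

lemma continuous_on_Times_locally_lipschitz:
  fixes f :: "'a::metric_space \<Rightarrow> 'b::real_normed_vector \<Rightarrow> 'c::real_normed_vector"
  assumes cont: "\<And>x. x \<in> S \<Longrightarrow> continuous_on I (\<lambda>\<tau>. f \<tau> x)"
    and lip: "\<And>x. x \<in> S \<Longrightarrow> \<exists>L. \<exists>\<rho>>0. \<forall>\<tau>\<in>I. \<forall>y\<in>S. norm (y - x) < \<rho> \<longrightarrow> norm (f \<tau> y - f \<tau> x) \<le> L * norm (y - x)"
  shows "continuous_on (I \<times> S) (\<lambda>(\<tau>, x). f \<tau> x)"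
proof -
  have "((\<lambda>(\<tau>, x). f \<tau> x) \<longlongrightarrow> f \<tau>0 x0) (at (\<tau>0, x0) within I \<times> S)" if \<tau>0: "\<tau>0 \<in> I" and x0: "x0 \<in> S" for \<tau>0 x0
  proof -
    obtain L \<rho> where \<rho>: "\<rho> > 0"
      and L: "\<And>\<tau> y. \<tau> \<in> I \<Longrightarrow> y \<in> S \<Longrightarrow> norm (y - x0) < \<rho> \<Longrightarrow> norm (f \<tau> y - f \<tau> x0) \<le> L * norm (y - x0)"
      using lip[OF x0] by metis
    let ?F = "at (\<tau>0, x0) within I \<times> S"
    have fst: "(fst \<longlongrightarrow> \<tau>0) ?F" and snd: "(snd \<longlongrightarrow> x0) ?F"
      using tendsto_fst[of "\<lambda>z. z" "(\<tau>0, x0)" ?F] tendsto_snd[of "\<lambda>z. z" "(\<tau>0, x0)" ?F] by (auto simp: tendsto_ident_at)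
    have inI: "\<forall>\<^sub>F z in ?F. fst z \<in> I \<and> snd z \<in> S" by (auto simp: eventually_at_filter intro: always_eventually)
    have "((\<lambda>z. f (fst z) x0) \<longlongrightarrow> f \<tau>0 x0) ?F"
      by (rule continuous_on_tendsto_compose[OF cont[OF x0] fst \<tau>0]) (use inI in \<open>auto elim: eventually_mono\<close>)
    moreover have "((\<lambda>z. f (fst z) (snd z) - f (fst z) x0) \<longlongrightarrow> 0) ?F"
    proof (rule Lim_null_comparison)
      have "\<forall>\<^sub>F z in ?F. norm (snd z - x0) < \<rho>"
        using tendstoD[OF snd \<rho>] by (simp add: dist_norm)
      with inI show "\<forall>\<^sub>F z in ?F. norm (f (fst z) (snd z) - f (fst z) x0) \<le> L * norm (snd z - x0)"
        by eventually_elim (use L in auto)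
      show "((\<lambda>z. L * norm (snd z - x0)) \<longlongrightarrow> 0) ?F"
        using tendsto_mult_left[OF tendsto_norm_zero[OF LIM_zero[OF snd]], of L] by simp
    qed
    ultimately have "((\<lambda>z. f (fst z) x0 + (f (fst z) (snd z) - f (fst z) x0)) \<longlongrightarrow> f \<tau>0 x0 + 0) ?F"
      by (rule tendsto_add)
    then show ?thesis by (simp add: case_prod_unfold)
  qed
  then show ?thesis by (auto simp: continuous_on_def)
qed

section \<open>Matrices bounded from below\<close>

lemma invertible_of_lower_bound:
  fixes M :: "real^'n^'n"
  assumes "0 < m" "\<And>k. m * norm k \<le> norm (M *v k)"
  shows "norm (matrix_inv M *v w) \<le> norm w / m"
    "M *v (matrix_inv M *v w) = w" "matrix_inv M *v (M *v w) = w"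
proof -
  have "inj ((*v) M)"
  proof (rule injI)
    fix x y assume "M *v x = M *v y"
    then have "m * norm (x - y) \<le> 0" using assms(2)[of "x - y"] by (simp add: matrix_vector_mult_diff_distrib)
    then show "x = y" using \<open>0 < m\<close> by (simp add: mult_le_0_iff)
  qed
  then have inv: "invertible M"
    unfolding invertible_left_inverse matrix_left_invertible_injective .
  have "M ** matrix_inv M = mat 1 \<and> matrix_inv M ** M = mat 1"
    using someI_ex[OF inv[unfolded invertible_def]] unfolding matrix_inv_def .
  then show r: "M *v (matrix_inv M *v w) = w" "matrix_inv M *v (M *v w) = w"
    by (simp_all add: matrix_vector_mul_assoc)
  show "norm (matrix_inv M *v w) \<le> norm w / m"
    using assms(2)[of "matrix_inv M *v w"] r(1) \<open>0 < m\<close> by (simp add: field_simps)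
qed

lemma continuous_on_matrix_columns:
  fixes M :: "'a::topological_space \<Rightarrow> real^'n^'n"
  assumes "\<And>j. continuous_on S (\<lambda>z. M z *v axis j 1)"
  shows "continuous_on S M"
proof -
  have M: "(\<lambda>z. \<chi> i j. (M z *v axis j 1) $ i) = M"
    by (rule ext) (simp add: vec_eq_iff matrix_vector_mult_basis column_def)
  have "continuous_on S (\<lambda>z. \<chi> i j. (M z *v axis j 1) $ i)"
    by (intro continuous_on_vec_lambda continuous_on_component assms)
  then show ?thesis unfolding M .
qed

lemma continuous_on_matrix_vector_mult:
  fixes M :: "'a::topological_space \<Rightarrow> real^'n^'n"
  assumes "continuous_on S M" "continuous_on S v"
  shows "continuous_on S (\<lambda>z. M z *v v z)" "continuous_on S (\<lambda>z. v z v* M z)"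
proof -
  show "continuous_on S (\<lambda>z. M z *v v z)"
    unfolding matrix_vector_mult_def
    by (intro continuous_on_vec_lambda continuous_on_sum continuous_on_mult continuous_on_component assms)
  show "continuous_on S (\<lambda>z. v z v* M z)"
    unfolding vector_matrix_mult_def
    by (intro continuous_on_vec_lambda continuous_on_sum continuous_on_mult continuous_on_component assms)
qed

text \<open>
  From \<open>N w - N\<^sub>0 w = N (M\<^sub>0 - M) N\<^sub>0 w\<close> for the inverses \<open>N\<close>, \<open>N\<^sub>0\<close> of \<open>M\<close>, \<open>M\<^sub>0\<close>, with \<open>N\<close> bounded
  uniformly by the lower bound on \<open>M\<close>.
\<close>
lemma continuous_on_matrix_inv:
  fixes M :: "'a::topological_space \<Rightarrow> real^'n^'n"
  assumes M: "continuous_on S M" and m: "0 < m" "\<And>z k. z \<in> S \<Longrightarrow> m * norm k \<le> norm (M z *v k)"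
  shows "continuous_on S (\<lambda>z. matrix_inv (M z))"
proof (rule continuous_on_matrix_columns)
  fix j :: 'n
  let ?w = "axis j 1 :: real^'n"
  show "continuous_on S (\<lambda>z. matrix_inv (M z) *v ?w)"
    unfolding continuous_on_def
  proof
    fix z0 assume z0: "z0 \<in> S"
    define u where "u = matrix_inv (M z0) *v ?w"
    have "((\<lambda>z. M z0 *v u - M z *v u) \<longlongrightarrow> M z0 *v u - M z0 *v u) (at z0 within S)"
      using continuous_on_matrix_vector_mult(1)[OF M continuous_on_const[of S u]] z0
      by (intro tendsto_diff tendsto_const) (simp add: continuous_on_def)
    then have lim: "((\<lambda>z. norm (M z0 *v u - M z *v u) / m) \<longlongrightarrow> 0) (at z0 within S)"
      by (intro tendsto_divide_zero tendsto_norm_zero) simp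
    have "((\<lambda>z. matrix_inv (M z) *v ?w - u) \<longlongrightarrow> 0) (at z0 within S)"
    proof (rule Lim_null_comparison[OF _ lim])
      show "\<forall>\<^sub>F z in at z0 within S. norm (matrix_inv (M z) *v ?w - u) \<le> norm (M z0 *v u - M z *v u) / m"
        unfolding eventually_at_filter
      proof (rule always_eventually, safe)
        fix z assume z: "z \<in> S"
        have w: "?w = M z0 *v u" using invertible_of_lower_bound(2)[OF m(1) m(2)[OF z0]] by (simp add: u_def)
        have "matrix_inv (M z) *v ?w - u = matrix_inv (M z) *v (M z0 *v u - M z *v u)"
          using invertible_of_lower_bound(3)[OF m(1) m(2)[OF z], of u]
          by (simp add: w matrix_vector_mult_diff_distrib)
        then show "norm (matrix_inv (M z) *v ?w - u) \<le> norm (M z0 *v u - M z *v u) / m"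
          using invertible_of_lower_bound(1)[OF m(1) m(2)[OF z]] by simp
      qed
    qed
    then show "((\<lambda>z. matrix_inv (M z) *v ?w) \<longlongrightarrow> matrix_inv (M z0) *v ?w) (at z0 within S)"
      unfolding u_def by (rule LIM_zero_cancel)
  qed
qed

text \<open>
  A product rule that needs the derivative of \<open>M\<close> only on fixed vectors, which is what the
  variational equation provides.
\<close>
lemma has_vector_derivative_matrix_vector_mult:
  fixes M :: "real \<Rightarrow> real^'n^'n"
  assumes M: "\<And>k. ((\<lambda>\<tau>. M \<tau> *v k) has_vector_derivative L k) (at \<tau> within S)" and L: "linear L"
    and p: "(p has_vector_derivative p') (at \<tau> within S)"
  shows "((\<lambda>\<tau>. M \<tau> *v p \<tau>) has_vector_derivative (L (p \<tau>) + M \<tau> *v p')) (at \<tau> within S)"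
proof -
  have expand: "f v = (\<Sum>j\<in>UNIV. v $ j *\<^sub>R f (axis j 1))" if "linear f" for f :: "real^'n \<Rightarrow> real^'n" and v
  proof -
    have "f v = f (\<Sum>j\<in>UNIV. v $ j *\<^sub>R axis j 1)"
      using basis_expansion[of v] by (simp add: scalar_mult_eq_scaleR)
    then show ?thesis using that by (simp add: linear_sum linear_scale)
  qed
  have pj: "((\<lambda>\<tau>. p \<tau> $ j) has_real_derivative p' $ j) (at \<tau> within S)" for j
    using bounded_linear.has_vector_derivative[OF bounded_linear_vec_nth p]
    by (simp add: has_real_derivative_iff_has_vector_derivative)
  have "((\<lambda>\<tau>. \<Sum>j\<in>UNIV. p \<tau> $ j *\<^sub>R (M \<tau> *v axis j 1)) has_vector_derivative
      (\<Sum>j\<in>UNIV. p \<tau> $ j *\<^sub>R L (axis j 1) + p' $ j *\<^sub>R (M \<tau> *v axis j 1))) (at \<tau> within S)"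
    by (intro has_vector_derivative_sum has_vector_derivative_scaleR pj M)
  moreover have "(\<Sum>j\<in>UNIV. v $ j *\<^sub>R (M \<sigma> *v axis j 1)) = M \<sigma> *v v" for \<sigma> v
    by (rule expand[OF matrix_vector_mul_linear, symmetric])
  moreover have "(\<Sum>j\<in>UNIV. p \<tau> $ j *\<^sub>R L (axis j 1)) = L (p \<tau>)"
    by (rule expand[OF L, symmetric])
  ultimately show ?thesis by (simp add: sum.distrib)
qed

section \<open>Lipschitz dependence of the flow on the initial value\<close>

lemma onorm_scaleR_const_le: "norm w \<le> b \<Longrightarrow> onorm (\<lambda>s::real. s *\<^sub>R w) \<le> b"
  by (rule onorm_le) (simp add: mult.commute[of b] mult_left_mono)

locale C2_flow =
  fixes X :: "(real^'n) set" and F :: "real^'n \<Rightarrow> real^'n"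
    and F' :: "real^'n \<Rightarrow> ((real^'n) \<Rightarrow>\<^sub>L (real^'n))"
    and F'' :: "real^'n \<Rightarrow> ((real^'n) \<Rightarrow>\<^sub>L ((real^'n) \<Rightarrow>\<^sub>L (real^'n)))"
    and \<phi> :: "real \<Rightarrow> real^'n \<Rightarrow> real^'n"
  assumes open_X: "open X" and C2: "C2_on X F F' F''" and flow: "is_flow X F \<phi>"
begin

lemma F_deriv: "x \<in> X \<Longrightarrow> (F has_derivative blinfun_apply (F' x)) (at x within S)"
  using C2 unfolding C2_on_def by (blast intro: has_derivative_at_withinI)

lemma F'_deriv: "x \<in> X \<Longrightarrow> (F' has_derivative blinfun_apply (F'' x)) (at x within S)"
  using C2 unfolding C2_on_def by (blast intro: has_derivative_at_withinI)

lemma continuous_F: "continuous_on X F"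
  by (rule has_derivative_continuous_on[OF F_deriv])

lemma continuous_F': "continuous_on X F'"
  by (rule has_derivative_continuous_on[OF F'_deriv])

lemma continuous_F'': "continuous_on X F''"
  using C2 by (simp add: C2_on_def)

lemma flow_0: "x \<in> X \<Longrightarrow> \<phi> 0 x = x"
  using flow by (simp add: is_flow_def solves_ivp_def)

lemma flow_in: "x \<in> X \<Longrightarrow> 0 \<le> \<tau> \<Longrightarrow> \<phi> \<tau> x \<in> X"
  using flow by (simp add: is_flow_def solves_ivp_def)

lemma flow_deriv: "x \<in> X \<Longrightarrow> \<tau> \<in> {0..t} \<Longrightarrow>
    ((\<lambda>\<tau>. \<phi> \<tau> x) has_vector_derivative F (\<phi> \<tau> x)) (at \<tau> within {0..t})"
proof -
  assume x: "x \<in> X" and \<tau>: "\<tau> \<in> {0..t}"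
  have "((\<lambda>\<tau>. \<phi> \<tau> x) has_vector_derivative F (\<phi> \<tau> x)) (at \<tau> within {0..})"
    using flow x \<tau> unfolding is_flow_def solves_ivp_def by auto
  then show ?thesis by (rule has_vector_derivative_within_subset) auto
qed

lemma continuous_flow_time: "x \<in> X \<Longrightarrow> continuous_on {0..t} (\<lambda>\<tau>. \<phi> \<tau> x)"
  by (rule has_vector_derivative_imp_continuous_on[OF flow_deriv])

end

text \<open>
  The trajectories that start in \<open>\<Omega>\<close> stay in the compact set \<open>C\<close> up to time \<open>t\<close>, and one constant
  bounds the derivatives of \<open>F\<close> on the \<open>\<eta>\<close>-neighbourhood of \<open>C\<close>. All estimates for the flow are
  uniform in terms of \<open>\<eta>\<close>, \<open>B\<close> and \<open>t\<close>.
\<close>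
locale flow_tube = C2_flow +
  fixes \<Omega> C :: "(real^'n) set" and t \<eta> B :: real
  assumes t: "0 \<le> t" and \<Omega>X: "\<Omega> \<subseteq> X" and flow_C: "x \<in> \<Omega> \<Longrightarrow> \<tau> \<in> {0..t} \<Longrightarrow> \<phi> \<tau> x \<in> C"
    and compact_C: "compact C" and \<eta>: "0 < \<eta>" and tube: "a \<in> C \<Longrightarrow> cball a \<eta> \<subseteq> X" and B: "1 \<le> B"
    and F'_bound: "a \<in> C \<Longrightarrow> z \<in> cball a \<eta> \<Longrightarrow> norm (F' z) \<le> B"
    and F''_bound: "a \<in> C \<Longrightarrow> z \<in> cball a \<eta> \<Longrightarrow> norm (F'' z) \<le> B"

context C2_flow begin

lemma flow_tube_exists:
  assumes "0 \<le> t" "\<Omega> \<subseteq> X" "compact C" "C \<subseteq> X" "\<And>x \<tau>. x \<in> \<Omega> \<Longrightarrow> \<tau> \<in> {0..t} \<Longrightarrow> \<phi> \<tau> x \<in> C"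
  obtains \<eta> B where "flow_tube X F F' F'' \<phi> \<Omega> C t \<eta> B"
proof -
  obtain \<eta> where \<eta>: "0 < \<eta>" "(\<Union>x\<in>C. cball x \<eta>) \<subseteq> X"
    using compact_subset_open_imp_cball_epsilon_subset[OF assms(3) open_X assms(4)] .
  define K where "K = (\<Union>x\<in>C. cball x \<eta>)"
  have K: "compact K" unfolding K_def by (rule compact_minkowski_sum_cball[OF assms(3)])
  have KX: "K \<subseteq> X" using \<eta> by (simp add: K_def)
  have "bounded (F' ` K)" "bounded (F'' ` K)"
    by (intro compact_imp_bounded compact_continuous_image K
        continuous_on_subset[OF continuous_F' KX] continuous_on_subset[OF continuous_F'' KX])+
  then obtain B1 B2 where B: "\<And>z. z \<in> K \<Longrightarrow> norm (F' z) \<le> B1" "\<And>z. z \<in> K \<Longrightarrow> norm (F'' z) \<le> B2"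
    unfolding bounded_iff by (metis imageI)
  have "flow_tube X F F' F'' \<phi> \<Omega> C t \<eta> (max 1 (max B1 B2))"
  proof unfold_locales
    fix a z assume "a \<in> C" "z \<in> cball a \<eta>"
    then have "z \<in> K" unfolding K_def by blast
    then show "norm (F' z) \<le> max 1 (max B1 B2)" "norm (F'' z) \<le> max 1 (max B1 B2)"
      using B[of z] by linarith+
  next
    fix a assume "a \<in> C"
    then show "cball a \<eta> \<subseteq> X" using \<eta> by blast
  qed (use assms \<eta> in auto)
  then show ?thesis by (rule that)
qed

end

context flow_tube begin

definition flow_lip where "flow_lip = exp (B * t)"

lemma flow_lip: "1 \<le> flow_lip" "0 < flow_lip"
  using t B by (auto simp: flow_lip_def)

lemma C_subset: "C \<subseteq> X" using tube \<eta> by fastforce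

lemma F_lipschitz:
  assumes a: "a \<in> C" and u: "norm u \<le> \<eta>"
  shows "norm (F (a + u) - F a) \<le> B * norm u"
    "norm (F (a + u) - F a - F' a u) \<le> B * (norm u)\<^sup>2"
proof -
  have sub: "cball a (norm u) \<subseteq> cball a \<eta>" using u by auto
  have in_X: "z \<in> X" if "z \<in> cball a (norm u)" for z using that sub tube[OF a] by blast
  have au: "a + u \<in> cball a (norm u)" "a \<in> cball a (norm u)" by (auto simp: dist_norm)
  have "norm (F (a + u) - F a) \<le> B * norm (a + u - a)"
    by (rule differentiable_bound[OF convex_cball F_deriv _ au])
       (use in_X sub F'_bound[OF a] in \<open>auto simp: norm_blinfun.rep_eq[symmetric]\<close>)
  then show "norm (F (a + u) - F a) \<le> B * norm u" by simp
  have F'_lip: "norm (F' z - F' a) \<le> B * norm (z - a)" if z: "z \<in> cball a (norm u)" for z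
    by (rule differentiable_bound[OF convex_cball F'_deriv _ z au(2)])
       (use in_X sub F''_bound[OF a] in \<open>auto simp: norm_blinfun.rep_eq[symmetric]\<close>)
  have "norm ((F (a + u) - F' a (a + u)) - (F a - F' a a)) \<le> (B * norm u) * norm (a + u - a)"
  proof (rule differentiable_bound[OF convex_cball _ _ au])
    fix z assume z: "z \<in> cball a (norm u)"
    show "((\<lambda>z. F z - F' a z) has_derivative blinfun_apply (F' z - F' a)) (at z within cball a (norm u))"
      using has_derivative_diff[OF F_deriv[OF in_X[OF z]]
          bounded_linear_imp_has_derivative[OF blinfun.bounded_linear_right[of "F' a"]]]
      by (simp add: minus_blinfun.rep_eq)
    have "norm (F' z - F' a) \<le> B * norm (z - a)" by (rule F'_lip[OF z])
    also have "\<dots> \<le> B * norm u" using z B by (intro mult_left_mono) (auto simp: dist_norm norm_minus_commute)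
    finally show "onorm (blinfun_apply (F' z - F' a)) \<le> B * norm u" by (simp add: norm_blinfun.rep_eq)
  qed
  then show "norm (F (a + u) - F a - F' a u) \<le> B * (norm u)\<^sup>2"
    by (simp add: blinfun.add_right power2_eq_square algebra_simps)
qed

lemma F'_apply_bound: "a \<in> C \<Longrightarrow> norm (F' a v) \<le> B * norm v"
  using norm_blinfun[of "F' a" v] F'_bound[of a a] \<eta> mult_right_mono[of "norm (F' a)" B "norm v"] by force

lemma F''_apply_bound: "a \<in> C \<Longrightarrow> norm (F'' a u v) \<le> B * norm u * norm v"
proof -
  assume a: "a \<in> C"
  have "norm (F'' a u v) \<le> norm (F'' a u) * norm v" by (rule norm_blinfun)
  also have "\<dots> \<le> (norm (F'' a) * norm u) * norm v" by (intro mult_right_mono norm_blinfun) auto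
  also have "\<dots> \<le> (B * norm u) * norm v" using F''_bound[OF a, of a] \<eta> by (intro mult_right_mono) auto
  finally show ?thesis .
qed

text \<open>
  The remainder is uniform over \<open>C\<close> because \<open>F''\<close> is uniformly continuous near \<open>C\<close>. The estimate
  comes from integrating twice along the segment from \<open>a\<close> to \<open>a + u\<close>.
\<close>
lemma F_taylor2:
  assumes "0 < \<omega>"
  obtains \<rho> where "0 < \<rho>" "\<rho> \<le> \<eta>"
    "\<And>a u. a \<in> C \<Longrightarrow> norm u \<le> \<rho> \<Longrightarrow> norm (F (a + u) - F a - F' a u - (1/2) *\<^sub>R F'' a u u) \<le> \<omega> * (norm u)\<^sup>2"
proof -
  define Q where "Q = (\<Union>x\<in>C. cball x \<eta>)"
  have Q: "compact Q" unfolding Q_def by (rule compact_minkowski_sum_cball[OF compact_C])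
  have "continuous_on Q F''" using continuous_F'' tube by (auto simp: Q_def elim!: continuous_on_subset)
  then have "uniformly_continuous_on Q F''" using Q by (rule compact_uniformly_continuous)
  then obtain d where d: "d > 0" "\<And>x y. x \<in> Q \<Longrightarrow> y \<in> Q \<Longrightarrow> dist y x < d \<Longrightarrow> dist (F'' y) (F'' x) < \<omega>"
    using \<open>0 < \<omega>\<close> unfolding uniformly_continuous_on_def by metis
  define \<rho> where "\<rho> = min \<eta> (d / 2)"
  have \<rho>: "0 < \<rho>" "\<rho> \<le> \<eta>" "\<rho> < d" using d \<eta> by (auto simp: \<rho>_def)
  show ?thesis
  proof (rule that[OF \<rho>(1,2)])
    fix a u :: "real^'n" assume a: "a \<in> C" and u: "norm u \<le> \<rho>"
    have F''_near: "norm (F'' (a + \<sigma> *\<^sub>R u) - F'' a) \<le> \<omega>" and in_X: "a + \<sigma> *\<^sub>R u \<in> X"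
      if \<sigma>: "\<sigma> \<in> {0..1}" for \<sigma>
    proof -
      have "norm (\<sigma> *\<^sub>R u) \<le> 1 * norm u" using \<sigma> by (simp add: mult_left_le_one_le)
      then have n: "norm (\<sigma> *\<^sub>R u) \<le> \<rho>" using u by simp
      then have "a + \<sigma> *\<^sub>R u \<in> cball a \<eta>" using \<rho> by (simp add: dist_norm)
      then show "a + \<sigma> *\<^sub>R u \<in> X" using tube[OF a] by blast
      have "a \<in> Q" "a + \<sigma> *\<^sub>R u \<in> Q" using a \<eta> \<open>a + \<sigma> *\<^sub>R u \<in> cball a \<eta>\<close>
        by (auto simp: Q_def intro!: bexI[of _ a])
      then have "dist (F'' (a + \<sigma> *\<^sub>R u)) (F'' a) < \<omega>" using n \<rho> by (intro d(2)) (auto simp: dist_norm)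
      then show "norm (F'' (a + \<sigma> *\<^sub>R u) - F'' a) \<le> \<omega>" by (simp add: dist_norm)
    qed
    define h where "h = (\<lambda>\<sigma>. F' (a + \<sigma> *\<^sub>R u) u - F' a u - \<sigma> *\<^sub>R F'' a u u)"
    define g where "g = (\<lambda>\<sigma>. F (a + \<sigma> *\<^sub>R u) - \<sigma> *\<^sub>R F' a u - (\<sigma>\<^sup>2 / 2) *\<^sub>R F'' a u u)"
    have line: "((\<lambda>\<sigma>. a + \<sigma> *\<^sub>R u) has_derivative (\<lambda>s. s *\<^sub>R u)) (at \<sigma> within {0..1})" for \<sigma> :: real
      by (auto intro!: derivative_eq_intros)
    have h: "norm (h \<sigma>) \<le> \<omega> * (norm u)\<^sup>2" if \<sigma>: "\<sigma> \<in> {0..1}" for \<sigma>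
    proof -
      have "norm (h \<sigma> - h 0) \<le> (\<omega> * (norm u)\<^sup>2) * norm (\<sigma> - 0)"
      proof (rule differentiable_bound[of "{0..1}" h "\<lambda>\<sigma> s. s *\<^sub>R (F'' (a + \<sigma> *\<^sub>R u) u u - F'' a u u)"])
        fix \<sigma> :: real assume \<sigma>: "\<sigma> \<in> {0..1}"
        have "((\<lambda>\<sigma>. F' (a + \<sigma> *\<^sub>R u)) has_derivative (\<lambda>s. F'' (a + \<sigma> *\<^sub>R u) (s *\<^sub>R u))) (at \<sigma> within {0..1})"
          using diff_chain_within[OF line F'_deriv[OF in_X[OF \<sigma>]]] by (simp add: o_def)
        note [derivative_intros] = bounded_linear.has_derivative[OF blinfun.bounded_linear_left this]
        show "(h has_derivative (\<lambda>s. s *\<^sub>R (F'' (a + \<sigma> *\<^sub>R u) u u - F'' a u u))) (at \<sigma> within {0..1})"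
          unfolding h_def
          by (auto intro!: derivative_eq_intros simp: blinfun.scaleR_right blinfun.scaleR_left algebra_simps)
        have "norm (F'' (a + \<sigma> *\<^sub>R u) u u - F'' a u u) = norm ((F'' (a + \<sigma> *\<^sub>R u) - F'' a) u u)"
          by (simp add: blinfun.diff_left)
        also have "\<dots> \<le> norm ((F'' (a + \<sigma> *\<^sub>R u) - F'' a) u) * norm u" by (rule norm_blinfun)
        also have "\<dots> \<le> (norm (F'' (a + \<sigma> *\<^sub>R u) - F'' a) * norm u) * norm u"
          by (intro mult_right_mono norm_blinfun) auto
        also have "\<dots> \<le> (\<omega> * norm u) * norm u" using F''_near[OF \<sigma>] by (intro mult_right_mono) auto
        finally show "onorm (\<lambda>s. s *\<^sub>R (F'' (a + \<sigma> *\<^sub>R u) u u - F'' a u u)) \<le> \<omega> * (norm u)\<^sup>2"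
          by (intro onorm_scaleR_const_le) (simp add: power2_eq_square mult.assoc)
      qed (use \<sigma> in auto)
      also have "\<dots> \<le> (\<omega> * (norm u)\<^sup>2) * 1" using \<sigma> \<open>0 < \<omega>\<close> by (intro mult_left_mono) auto
      finally show ?thesis by (simp add: h_def)
    qed
    have "norm (g 1 - g 0) \<le> (\<omega> * (norm u)\<^sup>2) * norm (1 - 0 :: real)"
    proof (rule differentiable_bound[of "{0..1}" g "\<lambda>\<sigma> s. s *\<^sub>R h \<sigma>"])
      fix \<sigma> :: real assume \<sigma>: "\<sigma> \<in> {0..1}"
      have [derivative_intros]: "((\<lambda>\<sigma>. F (a + \<sigma> *\<^sub>R u)) has_derivative (\<lambda>s. F' (a + \<sigma> *\<^sub>R u) (s *\<^sub>R u))) (at \<sigma> within {0..1})"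
        using diff_chain_within[OF line F_deriv[OF in_X[OF \<sigma>]]] by (simp add: o_def)
      show "(g has_derivative (\<lambda>s. s *\<^sub>R h \<sigma>)) (at \<sigma> within {0..1})"
        unfolding g_def h_def
        by (auto intro!: derivative_eq_intros simp: blinfun.scaleR_right algebra_simps)
      show "onorm (\<lambda>s. s *\<^sub>R h \<sigma>) \<le> \<omega> * (norm u)\<^sup>2"
        by (rule onorm_scaleR_const_le[OF h[OF \<sigma>]])
    qed auto
    then show "norm (F (a + u) - F a - F' a u - (1/2) *\<^sub>R F'' a u u) \<le> \<omega> * (norm u)\<^sup>2"
      by (simp add: g_def algebra_simps)
  qed
qed

text \<open>
  Here \<open>y\<close> ranges over a full neighbourhood of \<open>x\<close>, as differentiability of the flow at \<open>x\<close> demands. The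
  smallness condition keeps both trajectories within distance \<open>\<eta>\<close>, where \<open>B\<close> is a Lipschitz constant.
\<close>
lemma flow_lipschitz:
  assumes x: "x \<in> \<Omega>" and y: "y \<in> X" and small: "norm (y - x) * flow_lip < \<eta>" and \<tau>: "\<tau> \<in> {0..t}"
  shows "norm (\<phi> \<tau> y - \<phi> \<tau> x) \<le> norm (y - x) * flow_lip" "norm (\<phi> \<tau> y - \<phi> \<tau> x) \<le> \<eta>"
proof -
  have x': "x \<in> X" using x \<Omega>X by blast
  have "norm (\<phi> \<tau> y - \<phi> \<tau> x) \<le> norm (\<phi> 0 y - \<phi> 0 x) * exp (B * \<tau>)"
  proof (rule gronwall_bootstrap[OF has_vector_derivative_diff[OF flow_deriv[OF y] flow_deriv[OF x']], of t \<eta> B])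
    fix \<sigma> assume \<sigma>: "\<sigma> \<in> {0..t}" and n: "norm (\<phi> \<sigma> y - \<phi> \<sigma> x) \<le> \<eta>"
    show "norm (F (\<phi> \<sigma> y) - F (\<phi> \<sigma> x)) \<le> B * norm (\<phi> \<sigma> y - \<phi> \<sigma> x)"
      using F_lipschitz(1)[OF flow_C[OF x \<sigma>] n] by simp
  qed (use B \<tau> small in \<open>auto simp: flow_0 x' y flow_lip_def\<close>)
  also have "\<dots> \<le> norm (y - x) * flow_lip"
    using \<tau> B by (auto simp: flow_0 x' y flow_lip_def intro!: mult_left_mono)
  finally show "norm (\<phi> \<tau> y - \<phi> \<tau> x) \<le> norm (y - x) * flow_lip" .
  then show "norm (\<phi> \<tau> y - \<phi> \<tau> x) \<le> \<eta>" using small by linarith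
qed

end

context C2_flow begin

text \<open>
  Each single trajectory is a compact set, so a tube around it gives a Lipschitz bound near its
  initial value.
\<close>
lemma continuous_flow:
  assumes "0 \<le> t"
  shows "continuous_on ({0..t} \<times> X) (\<lambda>(\<tau>, x). \<phi> \<tau> x)"
proof (rule continuous_on_Times_locally_lipschitz)
  fix x assume x: "x \<in> X"
  then show "continuous_on {0..t} (\<lambda>\<tau>. \<phi> \<tau> x)" by (rule continuous_flow_time)
  have "compact ((\<lambda>\<tau>. \<phi> \<tau> x) ` {0..t})" using continuous_flow_time[OF x] by (rule compact_continuous_image) simp
  then obtain \<eta> B where "flow_tube X F F' F'' \<phi> {x} ((\<lambda>\<tau>. \<phi> \<tau> x) ` {0..t}) t \<eta> B"
    by (rule flow_tube_exists[OF assms, of "{x}", rotated]) (use x flow_in in auto)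
  then interpret T: flow_tube X F F' F'' \<phi> "{x}" "(\<lambda>\<tau>. \<phi> \<tau> x) ` {0..t}" t \<eta> B .
  show "\<exists>L. \<exists>\<rho>>0. \<forall>\<tau>\<in>{0..t}. \<forall>y\<in>X. norm (y - x) < \<rho> \<longrightarrow> norm (\<phi> \<tau> y - \<phi> \<tau> x) \<le> L * norm (y - x)"
  proof (intro exI conjI ballI impI)
    show "0 < \<eta> / T.flow_lip" using T.\<eta> T.flow_lip by simp
    fix \<tau> y assume "\<tau> \<in> {0..t}" "y \<in> X" "norm (y - x) < \<eta> / T.flow_lip"
    then show "norm (\<phi> \<tau> y - \<phi> \<tau> x) \<le> T.flow_lip * norm (y - x)"
      using T.flow_lipschitz(1)[of x y \<tau>] T.flow_lip by (simp add: pos_less_divide_eq mult.commute)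
  qed
qed

end

section \<open>First and second variation of the flow\<close>

context flow_tube begin

definition forcing_gain where "forcing_gain = exp ((B + 1) * t)"

definition quad_err where "quad_err = B * flow_lip\<^sup>2 * forcing_gain"

lemma forcing_gain: "0 < forcing_gain" by (simp add: forcing_gain_def)

lemma quad_err: "0 < quad_err" using B flow_lip forcing_gain by (simp add: quad_err_def)

lemma near_in_X: "x \<in> \<Omega> \<Longrightarrow> norm (y - x) * flow_lip < \<eta> \<Longrightarrow> y \<in> X"
proof -
  assume x: "x \<in> \<Omega>" and y: "norm (y - x) * flow_lip < \<eta>"
  have "x \<in> C" using flow_C[OF x, of 0] flow_0[of x] \<Omega>X x t by auto
  moreover have "norm (y - x) * 1 \<le> norm (y - x) * flow_lip" using flow_lip by (intro mult_left_mono) auto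
  ultimately show ?thesis using tube[of x] y by (auto simp: dist_norm norm_minus_commute)
qed

text \<open>
  The error \<open>\<phi> \<tau> y - \<phi> \<tau> x - v \<tau>\<close> solves the variational equation up to a term that is quadratic in
  \<open>y - x\<close>.
\<close>
lemma flow_linearization:
  assumes x: "x \<in> \<Omega>" and small: "norm (y - x) * flow_lip < \<eta>" and \<tau>: "\<tau> \<in> {0..t}"
    and v: "\<And>\<tau>. \<tau> \<in> {0..t} \<Longrightarrow> (v has_vector_derivative F' (\<phi> \<tau> x) (v \<tau>)) (at \<tau> within {0..t})"
    and v0: "v 0 = y - x"
  shows "norm (\<phi> \<tau> y - \<phi> \<tau> x - v \<tau>) \<le> quad_err * (norm (y - x))\<^sup>2"
proof -
  have x': "x \<in> X" using x \<Omega>X by blast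
  have y: "y \<in> X" by (rule near_in_X[OF x small])
  have "norm (\<phi> \<tau> y - \<phi> \<tau> x - v \<tau>) \<le> (B * (norm (y - x) * flow_lip)\<^sup>2) * exp ((B + 1) * t)"
  proof (rule gronwall_forced[OF has_vector_derivative_diff[OF has_vector_derivative_diff[OF flow_deriv[OF y] flow_deriv[OF x']] v],
        where w = "\<lambda>\<tau>. F' (\<phi> \<tau> x) (\<phi> \<tau> y - \<phi> \<tau> x - v \<tau>)"])
    fix \<sigma> assume \<sigma>: "\<sigma> \<in> {0..t}"
    show "norm (F' (\<phi> \<sigma> x) (\<phi> \<sigma> y - \<phi> \<sigma> x - v \<sigma>)) \<le> B * norm (\<phi> \<sigma> y - \<phi> \<sigma> x - v \<sigma>)"
      by (rule F'_apply_bound[OF flow_C[OF x \<sigma>]])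
    define \<Delta> where "\<Delta> = \<phi> \<sigma> y - \<phi> \<sigma> x"
    have "norm (F (\<phi> \<sigma> x + \<Delta>) - F (\<phi> \<sigma> x) - F' (\<phi> \<sigma> x) \<Delta>) \<le> B * (norm \<Delta>)\<^sup>2"
      using flow_lipschitz(2)[OF x y small \<sigma>] by (intro F_lipschitz(2) flow_C[OF x \<sigma>]) (simp add: \<Delta>_def)
    also have "\<dots> \<le> B * (norm (y - x) * flow_lip)\<^sup>2"
      using flow_lipschitz(1)[OF x y small \<sigma>] B by (intro mult_left_mono power_mono) (auto simp: \<Delta>_def)
    finally have rem: "norm (F (\<phi> \<sigma> x + \<Delta>) - F (\<phi> \<sigma> x) - F' (\<phi> \<sigma> x) \<Delta>) \<le> B * (norm (y - x) * flow_lip)\<^sup>2" .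
    have "F (\<phi> \<sigma> y) - F (\<phi> \<sigma> x) - F' (\<phi> \<sigma> x) (v \<sigma>) - F' (\<phi> \<sigma> x) (\<Delta> - v \<sigma>)
        = F (\<phi> \<sigma> x + \<Delta>) - F (\<phi> \<sigma> x) - F' (\<phi> \<sigma> x) \<Delta>"
      unfolding blinfun.diff_right by (simp add: \<Delta>_def)
    then show "norm (F (\<phi> \<sigma> y) - F (\<phi> \<sigma> x) - F' (\<phi> \<sigma> x) (v \<sigma>) - F' (\<phi> \<sigma> x) (\<phi> \<sigma> y - \<phi> \<sigma> x - v \<sigma>))
        \<le> B * (norm (y - x) * flow_lip)\<^sup>2"
      using rem unfolding \<Delta>_def[symmetric] by (rule ssubst[of _ _ "\<lambda>z. norm z \<le> _"])
  qed (use \<tau> B v0 in \<open>auto simp: flow_0 x' y\<close>)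
  then show ?thesis by (simp add: quad_err_def forcing_gain_def power_mult_distrib mult_ac)
qed

lemma variational_unique:
  assumes x: "x \<in> \<Omega>"
    and v: "\<And>\<tau>. \<tau> \<in> {0..t} \<Longrightarrow> (v has_vector_derivative F' (\<phi> \<tau> x) (v \<tau>)) (at \<tau> within {0..t})"
    and w: "\<And>\<tau>. \<tau> \<in> {0..t} \<Longrightarrow> (w has_vector_derivative F' (\<phi> \<tau> x) (w \<tau>)) (at \<tau> within {0..t})"
    and "v 0 = w 0" and \<tau>: "\<tau> \<in> {0..t}"
  shows "v \<tau> = w \<tau>"
proof -
  have "norm (v \<tau> - w \<tau>) \<le> 0 * exp ((B + 1) * t)"
  proof (rule gronwall_forced[OF has_vector_derivative_diff[OF v w],
        where w = "\<lambda>\<tau>. F' (\<phi> \<tau> x) (v \<tau> - w \<tau>)"])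
    show "norm (F' (\<phi> \<sigma> x) (v \<sigma> - w \<sigma>)) \<le> B * norm (v \<sigma> - w \<sigma>)" if "\<sigma> \<in> {0..t}" for \<sigma>
      by (rule F'_apply_bound[OF flow_C[OF x that]])
  qed (use \<open>v 0 = w 0\<close> \<tau> B in \<open>auto simp: blinfun.diff_right\<close>)
  then show ?thesis by simp
qed

text \<open>
  The difference quotients of the flow in direction \<open>k\<close> solve the variational equation up to an
  error proportional to the step size \<open>\<epsilon>\<close>. By \<open>gronwall_forced\<close> they converge uniformly in time, and
  so do their derivatives; the limit is the solution.
\<close>
lemma variational_exists:
  assumes x: "x \<in> \<Omega>"
  shows "\<exists>v. v 0 = k \<and> (\<forall>\<tau>\<in>{0..t}. (v has_vector_derivative F' (\<phi> \<tau> x) (v \<tau>)) (at \<tau> within {0..t}))"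
proof -
  have x': "x \<in> X" using x \<Omega>X by blast
  obtain N where N: "norm k * flow_lip / \<eta> < real N" using reals_Archimedean2 by blast
  define \<epsilon> where "\<epsilon> = (\<lambda>n. 1 / real (Suc (n + N)))"
  have \<epsilon>: "0 < \<epsilon> n" for n by (simp add: \<epsilon>_def)
  have \<epsilon>0: "\<epsilon> \<longlonglongrightarrow> 0"
    using LIMSEQ_ignore_initial_segment[OF LIMSEQ_inverse_real_of_nat, of N]
    by (simp add: \<epsilon>_def inverse_eq_divide)
  define y where "y = (\<lambda>n. x + \<epsilon> n *\<^sub>R k)"
  have yx: "norm (y n - x) = \<epsilon> n * norm k" for n using \<epsilon>[of n] by (simp add: y_def)
  have small: "norm (y n - x) * flow_lip < \<eta>" for n
  proof -
    have "norm k * flow_lip < \<eta> * real N" using N \<eta> by (simp add: field_simps)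
    also have "\<dots> \<le> \<eta> * real (Suc (n + N))" using \<eta> by (intro mult_left_mono) auto
    finally show ?thesis unfolding yx by (simp add: \<epsilon>_def field_simps)
  qed
  have y: "y n \<in> X" for n by (rule near_in_X[OF x small])
  define f where "f = (\<lambda>n \<tau>. (1 / \<epsilon> n) *\<^sub>R (\<phi> \<tau> (y n) - \<phi> \<tau> x))"
  define f' where "f' = (\<lambda>n \<tau>. (1 / \<epsilon> n) *\<^sub>R (F (\<phi> \<tau> (y n)) - F (\<phi> \<tau> x)))"
  have f_deriv: "(f n has_vector_derivative f' n \<tau>) (at \<tau> within {0..t})" if "\<tau> \<in> {0..t}" for n \<tau>
    unfolding f_def f'_def
    using bounded_linear.has_vector_derivative[OF bounded_linear_scaleR_right
        has_vector_derivative_diff[OF flow_deriv[OF y that] flow_deriv[OF x' that]]] .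
  have f0: "f n 0 = k" for n using \<epsilon>[of n] by (simp add: f_def flow_0 x' y) (simp add: y_def)
  define D where "D = B * (norm k * flow_lip)\<^sup>2"
  have D: "0 \<le> D" using B by (simp add: D_def)
  have f'_near: "norm (f' n \<tau> - F' (\<phi> \<tau> x) (f n \<tau>)) \<le> D * \<epsilon> n" if \<tau>: "\<tau> \<in> {0..t}" for n \<tau>
  proof -
    define \<Delta> where "\<Delta> = \<phi> \<tau> (y n) - \<phi> \<tau> x"
    have "norm (F (\<phi> \<tau> x + \<Delta>) - F (\<phi> \<tau> x) - F' (\<phi> \<tau> x) \<Delta>) \<le> B * (norm \<Delta>)\<^sup>2"
      using flow_lipschitz(2)[OF x y small \<tau>] by (intro F_lipschitz(2) flow_C[OF x \<tau>]) (simp add: \<Delta>_def)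
    also have "\<dots> \<le> B * (norm (y n - x) * flow_lip)\<^sup>2"
      using flow_lipschitz(1)[OF x y small \<tau>] B by (intro mult_left_mono power_mono) (auto simp: \<Delta>_def)
    also have "\<dots> = D * (\<epsilon> n * \<epsilon> n)" by (simp add: yx D_def power2_eq_square)
    finally have "(1 / \<epsilon> n) * norm (F (\<phi> \<tau> x + \<Delta>) - F (\<phi> \<tau> x) - F' (\<phi> \<tau> x) \<Delta>) \<le> (1 / \<epsilon> n) * (D * (\<epsilon> n * \<epsilon> n))"
      using \<epsilon>[of n] by (intro mult_left_mono) auto
    moreover have "f' n \<tau> - F' (\<phi> \<tau> x) (f n \<tau>) = (1 / \<epsilon> n) *\<^sub>R (F (\<phi> \<tau> x + \<Delta>) - F (\<phi> \<tau> x) - F' (\<phi> \<tau> x) \<Delta>)"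
      unfolding f_def f'_def \<Delta>_def blinfun.scaleR_right by (simp add: scaleR_diff_right)
    ultimately show ?thesis using \<epsilon>[of n] by simp
  qed
  have Cauchy_est: "norm (f n \<tau> - f m \<tau>) \<le> D * forcing_gain * (\<epsilon> n + \<epsilon> m)" if \<tau>: "\<tau> \<in> {0..t}" for n m \<tau>
  proof -
    have "norm (f n \<tau> - f m \<tau>) \<le> (D * \<epsilon> n + D * \<epsilon> m) * exp ((B + 1) * t)"
    proof (rule gronwall_forced[OF has_vector_derivative_diff[OF f_deriv f_deriv],
          where w = "\<lambda>\<tau>. F' (\<phi> \<tau> x) (f n \<tau> - f m \<tau>)"])
      fix \<sigma> assume \<sigma>: "\<sigma> \<in> {0..t}"
      show "norm (F' (\<phi> \<sigma> x) (f n \<sigma> - f m \<sigma>)) \<le> B * norm (f n \<sigma> - f m \<sigma>)"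
        by (rule F'_apply_bound[OF flow_C[OF x \<sigma>]])
      have "f' n \<sigma> - f' m \<sigma> - F' (\<phi> \<sigma> x) (f n \<sigma> - f m \<sigma>)
        = (f' n \<sigma> - F' (\<phi> \<sigma> x) (f n \<sigma>)) - (f' m \<sigma> - F' (\<phi> \<sigma> x) (f m \<sigma>))"
        by (simp add: blinfun.diff_right)
      then show "norm (f' n \<sigma> - f' m \<sigma> - F' (\<phi> \<sigma> x) (f n \<sigma> - f m \<sigma>)) \<le> D * \<epsilon> n + D * \<epsilon> m"
        using norm_triangle_ineq4[of "f' n \<sigma> - F' (\<phi> \<sigma> x) (f n \<sigma>)" "f' m \<sigma> - F' (\<phi> \<sigma> x) (f m \<sigma>)"]
          f'_near[OF \<sigma>, of n] f'_near[OF \<sigma>, of m] by (simp only:)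
    qed (use \<tau> B f0 in auto)
    then show ?thesis by (simp add: forcing_gain_def algebra_simps)
  qed
  have DG: "0 \<le> D * forcing_gain" using D forcing_gain by simp
  have "convergent (\<lambda>n. f n \<tau>)" if \<tau>: "\<tau> \<in> {0..t}" for \<tau>
  proof (rule Cauchy_convergent, rule CauchyI)
    fix e :: real assume "0 < e"
    then have e: "0 < e / (D * forcing_gain + 1) / 2" using DG by (simp add: add_nonneg_pos)
    obtain M where M: "\<And>n. n \<ge> M \<Longrightarrow> \<epsilon> n < e / (D * forcing_gain + 1) / 2"
      using order_tendstoD(2)[OF \<epsilon>0 e] by (auto simp: eventually_sequentially)
    show "\<exists>M. \<forall>m\<ge>M. \<forall>n\<ge>M. norm (f m \<tau> - f n \<tau>) < e"
    proof (intro exI allI impI)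
      fix m n assume "M \<le> m" "M \<le> n"
      then have s: "\<epsilon> m + \<epsilon> n < e / (D * forcing_gain + 1)" using M[of m] M[of n] by linarith
      have "norm (f m \<tau> - f n \<tau>) \<le> D * forcing_gain * (\<epsilon> m + \<epsilon> n)" by (rule Cauchy_est[OF \<tau>])
      also have "\<dots> \<le> (D * forcing_gain + 1) * (\<epsilon> m + \<epsilon> n)" using \<epsilon>[of m] \<epsilon>[of n] by (intro mult_right_mono) auto
      also have "\<dots> < (D * forcing_gain + 1) * (e / (D * forcing_gain + 1))" using s DG by (intro mult_strict_left_mono) auto
      finally show "norm (f m \<tau> - f n \<tau>) < e" using DG by simp
    qed
  qed
  then have lim: "(\<lambda>n. f n \<tau>) \<longlonglongrightarrow> lim (\<lambda>n. f n \<tau>)" if "\<tau> \<in> {0..t}" for \<tau>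
    using that convergent_LIMSEQ_iff by blast
  define v where "v = (\<lambda>\<tau>. lim (\<lambda>n. f n \<tau>))"
  have near: "norm (f n \<tau> - v \<tau>) \<le> D * forcing_gain * \<epsilon> n" if \<tau>: "\<tau> \<in> {0..t}" for n \<tau>
  proof -
    have "(\<lambda>m. norm (f n \<tau> - f m \<tau>)) \<longlonglongrightarrow> norm (f n \<tau> - v \<tau>)"
      unfolding v_def by (intro tendsto_intros lim[OF \<tau>])
    moreover have "(\<lambda>m. D * forcing_gain * (\<epsilon> n + \<epsilon> m)) \<longlonglongrightarrow> D * forcing_gain * (\<epsilon> n + 0)" by (intro tendsto_intros \<epsilon>0)
    ultimately have "norm (f n \<tau> - v \<tau>) \<le> D * forcing_gain * (\<epsilon> n + 0)"
      by (rule LIMSEQ_le) (intro exI allI impI Cauchy_est[OF \<tau>])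
    then show ?thesis by simp
  qed
  have "\<exists>g. \<forall>\<tau>\<in>{0..t}. (\<lambda>n. f n \<tau>) \<longlonglongrightarrow> g \<tau> \<and> (g has_derivative (\<lambda>h. h *\<^sub>R F' (\<phi> \<tau> x) (v \<tau>))) (at \<tau> within {0..t})"
  proof (rule has_derivative_sequence[where f' = "\<lambda>n \<tau> h. h *\<^sub>R f' n \<tau>"])
    show "\<And>n \<tau>. \<tau> \<in> {0..t} \<Longrightarrow> (f n has_derivative (\<lambda>h. h *\<^sub>R f' n \<tau>)) (at \<tau> within {0..t})"
      using f_deriv by (simp add: has_vector_derivative_def)
    show "0 \<in> {0..t}" using t by simp
    then show "(\<lambda>n. f n 0) \<longlonglongrightarrow> v 0" using lim by (simp add: v_def)
    fix e :: real assume "0 < e"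
    have "(\<lambda>n. (D + B * (D * forcing_gain)) * \<epsilon> n) \<longlonglongrightarrow> 0" using tendsto_mult_right_zero[OF \<epsilon>0] .
    then have "\<forall>\<^sub>F n in sequentially. (D + B * (D * forcing_gain)) * \<epsilon> n < e" using \<open>0 < e\<close> by (rule order_tendstoD)
    then show "\<forall>\<^sub>F n in sequentially. \<forall>\<tau>\<in>{0..t}. \<forall>h. norm (h *\<^sub>R f' n \<tau> - h *\<^sub>R F' (\<phi> \<tau> x) (v \<tau>)) \<le> e * norm h"
    proof (eventually_elim, intro ballI allI)
      fix n \<tau> and h :: real assume n: "(D + B * (D * forcing_gain)) * \<epsilon> n < e" and \<tau>: "\<tau> \<in> {0..t}"
      have "norm (F' (\<phi> \<tau> x) (f n \<tau> - v \<tau>)) \<le> B * norm (f n \<tau> - v \<tau>)"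
        by (rule F'_apply_bound[OF flow_C[OF x \<tau>]])
      also have "\<dots> \<le> B * (D * forcing_gain * \<epsilon> n)" using near[OF \<tau>] B by (intro mult_left_mono) auto
      finally have F'_near: "norm (F' (\<phi> \<tau> x) (f n \<tau> - v \<tau>)) \<le> B * (D * forcing_gain * \<epsilon> n)" .
      have split: "f' n \<tau> - F' (\<phi> \<tau> x) (v \<tau>) = (f' n \<tau> - F' (\<phi> \<tau> x) (f n \<tau>)) + F' (\<phi> \<tau> x) (f n \<tau> - v \<tau>)"
        by (simp add: blinfun.diff_right)
      have "norm (f' n \<tau> - F' (\<phi> \<tau> x) (v \<tau>)) \<le> D * \<epsilon> n + B * (D * forcing_gain * \<epsilon> n)"
        unfolding split by (rule order_trans[OF norm_triangle_ineq add_mono[OF f'_near[OF \<tau>] F'_near]])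
      also have "\<dots> = (D + B * (D * forcing_gain)) * \<epsilon> n" by (simp add: algebra_simps)
      finally have le: "norm (f' n \<tau> - F' (\<phi> \<tau> x) (v \<tau>)) \<le> e" using n by linarith
      have "norm (h *\<^sub>R f' n \<tau> - h *\<^sub>R F' (\<phi> \<tau> x) (v \<tau>)) = \<bar>h\<bar> * norm (f' n \<tau> - F' (\<phi> \<tau> x) (v \<tau>))"
        by (metis norm_scaleR scaleR_diff_right)
      also have "\<dots> \<le> \<bar>h\<bar> * e" using le by (intro mult_left_mono) auto
      finally show "norm (h *\<^sub>R f' n \<tau> - h *\<^sub>R F' (\<phi> \<tau> x) (v \<tau>)) \<le> e * norm h"
        by (simp add: mult.commute)
    qed
  qed simp
  then obtain g where g: "\<And>\<tau>. \<tau> \<in> {0..t} \<Longrightarrow> (\<lambda>n. f n \<tau>) \<longlonglongrightarrow> g \<tau>"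
    "\<And>\<tau>. \<tau> \<in> {0..t} \<Longrightarrow> (g has_vector_derivative F' (\<phi> \<tau> x) (v \<tau>)) (at \<tau> within {0..t})"
    unfolding has_vector_derivative_def by blast
  have gv: "v \<tau> = g \<tau>" if "\<tau> \<in> {0..t}" for \<tau> using LIMSEQ_unique[OF lim g(1)] that by (simp add: v_def)
  have "g 0 = k" using LIMSEQ_unique[OF g(1)[of 0], of k] t by (simp add: f0)
  show ?thesis
  proof (intro exI[of _ g] conjI ballI)
    show "g 0 = k" by fact
    fix \<tau> assume \<tau>: "\<tau> \<in> {0..t}"
    show "(g has_vector_derivative F' (\<phi> \<tau> x) (g \<tau>)) (at \<tau> within {0..t})"
      using g(2)[OF \<tau>] unfolding gv[OF \<tau>] .
  qed
qed

text \<open>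
  The solutions of the variational equation depend linearly on their initial value and approximate
  the differences of the flow up to a quadratic error, so those starting at the basis vectors are the columns of its Jacobian.
\<close>
lemma
  assumes x: "x \<in> \<Omega>"
  shows flow_has_D2: "\<tau> \<in> {0..t} \<Longrightarrow> (\<phi> \<tau> has_derivative (*v) (D2 \<phi> \<tau> x)) (at x)"
    and D2_deriv: "\<tau> \<in> {0..t} \<Longrightarrow> ((\<lambda>\<tau>. D2 \<phi> \<tau> x *v k) has_vector_derivative F' (\<phi> \<tau> x) (D2 \<phi> \<tau> x *v k)) (at \<tau> within {0..t})"
    and D2_0: "D2 \<phi> 0 x *v k = k"
proof -
  define V where "V = (\<lambda>k. SOME v. v 0 = k \<and>
    (\<forall>\<tau>\<in>{0..t}. (v has_vector_derivative F' (\<phi> \<tau> x) (v \<tau>)) (at \<tau> within {0..t})))"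
  have V_props: "V k 0 = k \<and> (\<forall>\<tau>\<in>{0..t}. (V k has_vector_derivative F' (\<phi> \<tau> x) (V k \<tau>)) (at \<tau> within {0..t}))" for k
    unfolding V_def by (rule someI_ex[OF variational_exists[OF x]])
  have V0: "V k 0 = k" for k using V_props by blast
  have V: "(V k has_vector_derivative F' (\<phi> \<tau> x) (V k \<tau>)) (at \<tau> within {0..t})" if "\<tau> \<in> {0..t}" for k \<tau>
    using V_props that by blast
  have lin: "linear (\<lambda>k. V k \<tau>)" if \<tau>: "\<tau> \<in> {0..t}" for \<tau>
  proof (rule linearI)
    fix a b :: "real^'n" and c :: real
    show "V (a + b) \<tau> = V a \<tau> + V b \<tau>"
      by (rule variational_unique[OF x, where v = "V (a + b)" and w = "\<lambda>\<tau>. V a \<tau> + V b \<tau>"])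
        (use \<tau> in \<open>auto simp: V0 blinfun.add_right intro!: has_vector_derivative_add V\<close>)
    show "V (c *\<^sub>R a) \<tau> = c *\<^sub>R V a \<tau>"
      by (rule variational_unique[OF x, where v = "V (c *\<^sub>R a)" and w = "\<lambda>\<tau>. c *\<^sub>R V a \<tau>"])
        (use \<tau> in \<open>auto simp: V0 blinfun.scaleR_right
          intro!: bounded_linear.has_vector_derivative[OF bounded_linear_scaleR_right] V\<close>)
  qed
  have der: "(\<phi> \<tau> has_derivative (\<lambda>k. V k \<tau>)) (at x)" if \<tau>: "\<tau> \<in> {0..t}" for \<tau>
    unfolding has_derivative_at_alt
  proof (intro conjI allI impI)
    show "bounded_linear (\<lambda>k. V k \<tau>)" using lin[OF \<tau>] by (simp add: linear_conv_bounded_linear)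
    fix e :: real assume "0 < e"
    show "\<exists>d>0. \<forall>y. norm (y - x) < d \<longrightarrow> norm (\<phi> \<tau> y - \<phi> \<tau> x - V (y - x) \<tau>) \<le> e * norm (y - x)"
    proof (intro exI conjI allI impI)
      show "0 < min (\<eta> / flow_lip) (e / quad_err)" using \<eta> flow_lip quad_err \<open>0 < e\<close> by simp
      fix y assume y: "norm (y - x) < min (\<eta> / flow_lip) (e / quad_err)"
      then have small: "norm (y - x) * flow_lip < \<eta>" and yA: "quad_err * norm (y - x) \<le> e"
        using flow_lip quad_err by (simp_all add: field_simps)
      have "norm (\<phi> \<tau> y - \<phi> \<tau> x - V (y - x) \<tau>) \<le> quad_err * (norm (y - x))\<^sup>2"
        by (rule flow_linearization[OF x small \<tau> V V0])
      also have "\<dots> = (quad_err * norm (y - x)) * norm (y - x)" by (simp add: power2_eq_square)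
      also have "\<dots> \<le> e * norm (y - x)" using yA by (intro mult_right_mono) auto
      finally show "norm (\<phi> \<tau> y - \<phi> \<tau> x - V (y - x) \<tau>) \<le> e * norm (y - x)" .
    qed
  qed
  have D2V: "D2 \<phi> \<tau> x *v k = V k \<tau>" if \<tau>: "\<tau> \<in> {0..t}" for \<tau> k
    unfolding D2_def jacobian_def frechet_derivative_at[OF der[OF \<tau>], symmetric]
    by (simp add: matrix_works linear_matrix_vector_mul_eq lin[OF \<tau>])
  show "(\<phi> \<tau> has_derivative (*v) (D2 \<phi> \<tau> x)) (at x)" if \<tau>: "\<tau> \<in> {0..t}"
  proof -
    have "(*v) (D2 \<phi> \<tau> x) = (\<lambda>k. V k \<tau>)" by (rule ext) (rule D2V[OF \<tau>])
    then show ?thesis using der[OF \<tau>] by simp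
  qed
  show "((\<lambda>\<tau>. D2 \<phi> \<tau> x *v k) has_vector_derivative F' (\<phi> \<tau> x) (D2 \<phi> \<tau> x *v k)) (at \<tau> within {0..t})"
    if \<tau>: "\<tau> \<in> {0..t}"
    unfolding D2V[OF \<tau>]
    by (rule has_vector_derivative_transform[OF \<tau> _ V[OF \<tau>]]) (rule D2V)
  show "D2 \<phi> 0 x *v k = k" using D2V[of 0 k] V0 t by simp
qed

lemma flow_expansion1:
  assumes x: "x \<in> \<Omega>" and small: "norm (y - x) * flow_lip < \<eta>" and \<tau>: "\<tau> \<in> {0..t}"
  shows "norm (\<phi> \<tau> y - \<phi> \<tau> x - D2 \<phi> \<tau> x *v (y - x)) \<le> quad_err * (norm (y - x))\<^sup>2"
  by (rule flow_linearization[OF x small \<tau> D2_deriv[OF x] D2_0[OF x]])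

lemma D2_upper:
  assumes x: "x \<in> \<Omega>" and \<tau>: "\<tau> \<in> {0..t}" and le: "\<And>\<tau> v. \<tau> \<in> {0..t} \<Longrightarrow> v \<bullet> F' (\<phi> \<tau> x) v \<le> b * (v \<bullet> v)"
  shows "norm (D2 \<phi> \<tau> x *v k) \<le> norm k * exp (b * \<tau>)"
  using gronwall_norm_upper[OF D2_deriv[OF x] le \<tau>, of k] by (simp add: D2_0[OF x])

lemma D2_lower:
  assumes x: "x \<in> \<Omega>" and \<tau>: "\<tau> \<in> {0..t}" and ge: "\<And>\<tau> v. \<tau> \<in> {0..t} \<Longrightarrow> b * (v \<bullet> v) \<le> v \<bullet> F' (\<phi> \<tau> x) v"
  shows "exp (b * \<tau>) * norm k \<le> norm (D2 \<phi> \<tau> x *v k)"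
  using gronwall_norm_lower[OF D2_deriv[OF x] ge \<tau>, of k] by (simp add: D2_0[OF x] mult.commute)

lemma F'_form_bound:
  assumes "a \<in> C" shows "\<bar>v \<bullet> F' a v\<bar> \<le> B * (v \<bullet> v)"
proof -
  have "\<bar>v \<bullet> F' a v\<bar> \<le> norm v * norm (F' a v)" by (rule Cauchy_Schwarz_ineq2)
  also have "\<dots> \<le> norm v * (B * norm v)" using F'_apply_bound[OF assms] by (intro mult_left_mono) auto
  finally show ?thesis by (simp add: power2_norm_eq_inner[symmetric] power2_eq_square mult.left_commute)
qed

lemma D2_bounds:
  assumes x: "x \<in> \<Omega>" and \<tau>: "\<tau> \<in> {0..t}"
  shows "norm (D2 \<phi> \<tau> x *v k) \<le> flow_lip * norm k" "(1 / flow_lip) * norm k \<le> norm (D2 \<phi> \<tau> x *v k)"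
proof -
  have Kb: "exp (B * \<tau>) \<le> flow_lip" "1 / flow_lip \<le> exp (- B * \<tau>)"
    using \<tau> B by (auto simp: flow_lip_def exp_minus divide_inverse)
  have b: "v \<bullet> F' (\<phi> \<sigma> x) v \<le> B * (v \<bullet> v)" "- B * (v \<bullet> v) \<le> v \<bullet> F' (\<phi> \<sigma> x) v" if "\<sigma> \<in> {0..t}" for \<sigma> v
    using F'_form_bound[OF flow_C[OF x that], of v] by auto
  have "norm (D2 \<phi> \<tau> x *v k) \<le> norm k * exp (B * \<tau>)" by (rule D2_upper[OF x \<tau> b(1)])
  also have "\<dots> \<le> norm k * flow_lip" using Kb by (intro mult_left_mono) auto
  finally show "norm (D2 \<phi> \<tau> x *v k) \<le> flow_lip * norm k" by (simp add: mult.commute)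
  have "(1 / flow_lip) * norm k \<le> exp (- B * \<tau>) * norm k" using Kb by (intro mult_right_mono) auto
  also have "\<dots> \<le> norm (D2 \<phi> \<tau> x *v k)" by (rule D2_lower[OF x \<tau> b(2)])
  finally show "(1 / flow_lip) * norm k \<le> norm (D2 \<phi> \<tau> x *v k)" .
qed

text \<open>
  Expand the flow at \<open>x\<close> and at \<open>y\<close> towards a third point at distance \<open>norm (y - x)\<close> from \<open>y\<close> in direction
  \<open>k\<close>. The flow values cancel, and \<open>norm (y - x)\<close> times the difference of the two derivatives is left
  equal to remainders that are quadratic in \<open>norm (y - x)\<close>.
\<close>
lemma D2_lipschitz:
  assumes x: "x \<in> \<Omega>" and y: "y \<in> \<Omega>" and small: "2 * norm (y - x) * flow_lip < \<eta>" and \<tau>: "\<tau> \<in> {0..t}"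
    and k: "norm k = 1"
  shows "norm (D2 \<phi> \<tau> y *v k - D2 \<phi> \<tau> x *v k) \<le> 6 * quad_err * norm (y - x)"
proof (cases "y = x")
  case False
  define h where "h = norm (y - x)"
  have h: "0 < h" using False by (simp add: h_def)
  have hK: "2 * h * flow_lip < \<eta>" using small by (simp add: h_def)
  define z where "z = y + h *\<^sub>R k"
  have zy: "norm (z - y) = h" using h k by (simp add: z_def)
  have zx: "norm (z - x) \<le> 2 * h" using norm_triangle_ineq[of "z - y" "y - x"] zy by (simp add: h_def)
  have s1: "norm (z - x) * flow_lip < \<eta>" using mult_right_mono[OF zx, of flow_lip] flow_lip hK by linarith
  have s2: "norm (z - y) * flow_lip < \<eta>" "norm (y - x) * flow_lip < \<eta>"
    using hK mult_pos_pos[OF h flow_lip(2)] by (auto simp: zy h_def[symmetric])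
  have "norm (\<phi> \<tau> z - \<phi> \<tau> x - D2 \<phi> \<tau> x *v (z - x)) \<le> quad_err * (norm (z - x))\<^sup>2"
    by (rule flow_expansion1[OF x s1 \<tau>])
  also have "\<dots> \<le> quad_err * (2 * h)\<^sup>2" using quad_err zx by (intro mult_left_mono power_mono) auto
  finally have e1: "norm (\<phi> \<tau> z - \<phi> \<tau> x - D2 \<phi> \<tau> x *v (z - x)) \<le> 4 * quad_err * h\<^sup>2" by (simp add: power_mult_distrib)
  have e2: "norm (\<phi> \<tau> z - \<phi> \<tau> y - D2 \<phi> \<tau> y *v (z - y)) \<le> quad_err * h\<^sup>2"
    using flow_expansion1[OF y s2(1) \<tau>] zy by simp
  have e3: "norm (\<phi> \<tau> y - \<phi> \<tau> x - D2 \<phi> \<tau> x *v (y - x)) \<le> quad_err * h\<^sup>2"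
    using flow_expansion1[OF x s2(2) \<tau>] by (simp add: h_def)
  \<comment> \<open>the expansions from \<open>x\<close> to \<open>z\<close>, from \<open>y\<close> to \<open>z\<close> and from \<open>x\<close> to \<open>y\<close> cancel except for the difference of the derivatives\<close>
  have zx_split: "z - x = (y - x) + h *\<^sub>R k" and zy_eq: "z - y = h *\<^sub>R k" by (simp_all add: z_def)
  have "h *\<^sub>R (D2 \<phi> \<tau> y *v k - D2 \<phi> \<tau> x *v k)
    = (\<phi> \<tau> z - \<phi> \<tau> x - D2 \<phi> \<tau> x *v (z - x)) - (\<phi> \<tau> z - \<phi> \<tau> y - D2 \<phi> \<tau> y *v (z - y))
      - (\<phi> \<tau> y - \<phi> \<tau> x - D2 \<phi> \<tau> x *v (y - x))"
    unfolding zx_split zy_eq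
    by (simp add: matrix_vector_right_distrib matrix_vector_mult_scaleR scaleR_diff_right)
  then have "norm (h *\<^sub>R (D2 \<phi> \<tau> y *v k - D2 \<phi> \<tau> x *v k)) \<le> (4 * quad_err * h\<^sup>2 + quad_err * h\<^sup>2) + quad_err * h\<^sup>2"
    by (metis order_trans[OF norm_triangle_ineq4 add_mono[OF order_trans[OF norm_triangle_ineq4 add_mono[OF e1 e2]] e3]])
  also have "\<dots> = h * (6 * quad_err * h)" by (simp add: power2_eq_square)
  finally have "h * norm (D2 \<phi> \<tau> y *v k - D2 \<phi> \<tau> x *v k) \<le> h * (6 * quad_err * h)"
    unfolding norm_scaleR using h by simp
  then show ?thesis using h by (simp add: h_def[symmetric])
qed simp

lemma continuous_D2: "continuous_on ({0..t} \<times> \<Omega>) (\<lambda>(\<tau>, x). D2 \<phi> \<tau> x)"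
proof (rule continuous_on_matrix_columns)
  fix j :: 'n
  have "continuous_on ({0..t} \<times> \<Omega>) (\<lambda>(\<tau>, x). D2 \<phi> \<tau> x *v axis j 1)"
  proof (rule continuous_on_Times_locally_lipschitz)
    fix x assume x: "x \<in> \<Omega>"
    show "continuous_on {0..t} (\<lambda>\<tau>. D2 \<phi> \<tau> x *v axis j 1)"
      by (rule has_vector_derivative_imp_continuous_on[OF D2_deriv[OF x]])
    show "\<exists>L. \<exists>\<rho>>0. \<forall>\<tau>\<in>{0..t}. \<forall>y\<in>\<Omega>. norm (y - x) < \<rho> \<longrightarrow>
        norm (D2 \<phi> \<tau> y *v axis j 1 - D2 \<phi> \<tau> x *v axis j 1) \<le> L * norm (y - x)"
    proof (intro exI conjI ballI impI)
      show "0 < \<eta> / (2 * flow_lip)" using \<eta> flow_lip by simp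
      fix \<tau> y assume "\<tau> \<in> {0..t}" "y \<in> \<Omega>" "norm (y - x) < \<eta> / (2 * flow_lip)"
      then show "norm (D2 \<phi> \<tau> y *v axis j 1 - D2 \<phi> \<tau> x *v axis j 1) \<le> (6 * quad_err) * norm (y - x)"
        using flow_lip by (intro D2_lipschitz x) (auto simp: field_simps norm_axis_1)
    qed
  qed
  then show "continuous_on ({0..t} \<times> \<Omega>) (\<lambda>z. (case z of (\<tau>, x) \<Rightarrow> D2 \<phi> \<tau> x) *v axis j 1)"
    by (simp add: case_prod_unfold)
qed

lemma continuous_D2_time:
  assumes "x \<in> \<Omega>" shows "continuous_on {0..t} (\<lambda>\<tau>. D2 \<phi> \<tau> x)"
  by (rule continuous_on_matrix_columns, rule has_vector_derivative_imp_continuous_on[OF D2_deriv[OF assms]])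

text \<open>
  \<open>F\<close> is Lipschitz on the whole of \<open>C\<close>, by its derivative for close points and by boundedness for
  distant ones. Hence distinct trajectories approach each other at most exponentially fast, which
  makes the flow injective with a uniform bound.
\<close>
lemma flow_expanding:
  obtains E where "0 < E" "\<And>\<tau> x y. \<tau> \<in> {0..t} \<Longrightarrow> x \<in> \<Omega> \<Longrightarrow> y \<in> \<Omega> \<Longrightarrow> norm (y - x) \<le> E * norm (\<phi> \<tau> y - \<phi> \<tau> x)"
proof -
  have "bounded (F ` C)"
    using compact_C continuous_on_subset[OF continuous_F C_subset] by (intro compact_imp_bounded compact_continuous_image)
  then obtain m where m: "\<And>a. a \<in> C \<Longrightarrow> norm (F a) \<le> m" unfolding bounded_iff by (metis imageI)
  define L where "L = max B (2 * m / \<eta>)"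
  have L: "norm (F b - F a) \<le> L * norm (b - a)" if "a \<in> C" "b \<in> C" for a b
  proof (cases "norm (b - a) \<le> \<eta>")
    case True
    then have "norm (F b - F a) \<le> B * norm (b - a)" using F_lipschitz(1)[OF that(1) True] by simp
    also have "\<dots> \<le> L * norm (b - a)" by (intro mult_right_mono) (auto simp: L_def)
    finally show ?thesis .
  next
    case False
    have "norm (F b - F a) \<le> m + m" by (rule order_trans[OF norm_triangle_ineq4 add_mono[OF m[OF that(2)] m[OF that(1)]]])
    also have "\<dots> = (2 * m / \<eta>) * \<eta>" using \<eta> by simp
    also have "\<dots> \<le> L * norm (b - a)"
      using False \<eta> B by (intro mult_mono) (auto simp: L_def le_max_iff_disj)
    finally show ?thesis .
  qed
  have "0 \<le> L" using B by (simp add: L_def le_max_iff_disj)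
  show ?thesis
  proof (rule that[of "exp (L * t)"])
    fix \<tau> x y assume \<tau>: "\<tau> \<in> {0..t}" and x: "x \<in> \<Omega>" and y: "y \<in> \<Omega>"
    have x': "x \<in> X" and y': "y \<in> X" using x y \<Omega>X by auto
    have "norm (\<phi> 0 y - \<phi> 0 x) * exp (- L * \<tau>) \<le> norm (\<phi> \<tau> y - \<phi> \<tau> x)"
    proof (rule gronwall_norm_lower[OF has_vector_derivative_diff[OF flow_deriv[OF y'] flow_deriv[OF x']] _ \<tau>])
      fix \<sigma> assume \<sigma>: "\<sigma> \<in> {0..t}"
      define v where "v = \<phi> \<sigma> y - \<phi> \<sigma> x"
      have "\<bar>v \<bullet> (F (\<phi> \<sigma> y) - F (\<phi> \<sigma> x))\<bar> \<le> norm v * norm (F (\<phi> \<sigma> y) - F (\<phi> \<sigma> x))" by (rule Cauchy_Schwarz_ineq2)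
      also have "\<dots> \<le> norm v * (L * norm v)"
        unfolding v_def by (intro mult_left_mono L flow_C x y \<sigma>) auto
      also have "\<dots> = L * (v \<bullet> v)" by (simp add: power2_norm_eq_inner[symmetric] power2_eq_square)
      finally show "- L * ((\<phi> \<sigma> y - \<phi> \<sigma> x) \<bullet> (\<phi> \<sigma> y - \<phi> \<sigma> x)) \<le> (\<phi> \<sigma> y - \<phi> \<sigma> x) \<bullet> (F (\<phi> \<sigma> y) - F (\<phi> \<sigma> x))"
        by (simp add: v_def[symmetric])
    qed
    then have le: "norm (y - x) * exp (- L * \<tau>) \<le> norm (\<phi> \<tau> y - \<phi> \<tau> x)" by (simp only: flow_0 x' y')
    have "norm (y - x) = exp (L * \<tau>) * (norm (y - x) * exp (- L * \<tau>))" by (simp add: exp_minus)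
    also have "\<dots> \<le> exp (L * \<tau>) * norm (\<phi> \<tau> y - \<phi> \<tau> x)" using le by (rule mult_left_mono) simp
    also have "\<dots> \<le> exp (L * t) * norm (\<phi> \<tau> y - \<phi> \<tau> x)"
      using \<tau> \<open>0 \<le> L\<close> by (intro mult_right_mono) (simp_all add: mult_left_mono)
    finally show "norm (y - x) \<le> exp (L * t) * norm (\<phi> \<tau> y - \<phi> \<tau> x)" .
  qed simp
qed

text \<open>
  The integrand whose integral \<open>L1\<close> bounds. Its integral, transported by \<open>D2 \<phi> \<tau> x\<close>, is the second
  derivative of the flow, by variation of constants.
\<close>
definition D2_inv_F'' where
  "D2_inv_F'' \<tau> x k = matrix_inv (D2 \<phi> \<tau> x) *v F'' (\<phi> \<tau> x) (D2 \<phi> \<tau> x *v k) (D2 \<phi> \<tau> x *v k)"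

lemma continuous_D2_inv_F'':
  assumes x: "x \<in> \<Omega>" shows "continuous_on {0..t} (\<lambda>\<tau>. D2_inv_F'' \<tau> x k)"
proof -
  have inv: "continuous_on {0..t} (\<lambda>\<tau>. matrix_inv (D2 \<phi> \<tau> x))"
    by (rule continuous_on_matrix_inv[OF continuous_D2_time[OF x], of "1 / flow_lip"]) (use flow_lip D2_bounds(2)[OF x] in auto)
  have D: "continuous_on {0..t} (\<lambda>\<tau>. D2 \<phi> \<tau> x *v k)"
    by (rule continuous_on_matrix_vector_mult(1)[OF continuous_D2_time[OF x] continuous_on_const])
  have "continuous_on {0..t} (\<lambda>\<tau>. F'' (\<phi> \<tau> x))"
    using flow_in x \<Omega>X by (intro continuous_on_compose2[OF continuous_F''] continuous_flow_time) auto
  then show ?thesis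
    unfolding D2_inv_F''_def
    by (intro continuous_on_matrix_vector_mult(1)[OF inv] bounded_bilinear.continuous_on[OF bounded_bilinear_blinfun_apply] D)
qed

text \<open>
  Differentiating the variation of constants formula as a product recovers the equation of second
  variation; the inverse of the Jacobian enters through the integrand, so its continuity in time suffices.
\<close>
lemma second_variation_deriv:
  assumes x: "x \<in> \<Omega>" and \<tau>: "\<tau> \<in> {0..t}"
  shows "((\<lambda>\<tau>. D2 \<phi> \<tau> x *v integral {0..\<tau>} (\<lambda>\<sigma>. D2_inv_F'' \<sigma> x k)) has_vector_derivative
    (F' (\<phi> \<tau> x) (D2 \<phi> \<tau> x *v integral {0..\<tau>} (\<lambda>\<sigma>. D2_inv_F'' \<sigma> x k))
      + F'' (\<phi> \<tau> x) (D2 \<phi> \<tau> x *v k) (D2 \<phi> \<tau> x *v k))) (at \<tau> within {0..t})"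
proof -
  have p: "((\<lambda>\<tau>. integral {0..\<tau>} (\<lambda>\<sigma>. D2_inv_F'' \<sigma> x k)) has_vector_derivative D2_inv_F'' \<tau> x k) (at \<tau> within {0..t})"
    by (rule integral_has_vector_derivative[OF continuous_D2_inv_F''[OF x] \<tau>])
  have lin: "linear (\<lambda>v. F' (\<phi> \<tau> x) (D2 \<phi> \<tau> x *v v))"
    by (rule linearI) (simp_all add: matrix_vector_right_distrib matrix_vector_mult_scaleR blinfun.add_right blinfun.scaleR_right)
  have "D2 \<phi> \<tau> x *v D2_inv_F'' \<tau> x k = F'' (\<phi> \<tau> x) (D2 \<phi> \<tau> x *v k) (D2 \<phi> \<tau> x *v k)"
    unfolding D2_inv_F''_def
    by (rule invertible_of_lower_bound(2)[of "1 / flow_lip"]) (use flow_lip D2_bounds(2)[OF x \<tau>] in auto)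
  then show ?thesis
    using has_vector_derivative_matrix_vector_mult[OF D2_deriv[OF x \<tau>] lin p] by simp
qed

lemma F''_diff_bound:
  assumes a: "a \<in> C"
  shows "norm (F'' a u u - F'' a v v) \<le> B * norm (u - v) * (norm u + norm v)"
proof -
  have split: "F'' a u u - F'' a v v = F'' a (u - v) u + F'' a v (u - v)"
    by (simp add: blinfun.diff_right blinfun.diff_left)
  have "norm (F'' a u u - F'' a v v) \<le> B * norm (u - v) * norm u + B * norm v * norm (u - v)"
    unfolding split
    by (rule order_trans[OF norm_triangle_ineq add_mono[OF F''_apply_bound[OF a] F''_apply_bound[OF a]]])
  then show ?thesis by (simp add: algebra_simps)
qed

text \<open>
  The remainder solves the variational equation with a forcing of order \<open>o((norm (y - x))\<^sup>2)\<close>, namely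
  the Taylor remainder of \<open>F\<close> plus the error of replacing the difference of the trajectories by its
  linearization inside \<open>F''\<close>.
\<close>
lemma flow_expansion2:
  assumes "0 < \<omega>"
  obtains \<delta> where "0 < \<delta>"
    "\<And>x y \<tau>. x \<in> \<Omega> \<Longrightarrow> norm (y - x) < \<delta> \<Longrightarrow> \<tau> \<in> {0..t} \<Longrightarrow>
      norm (\<phi> \<tau> y - \<phi> \<tau> x - D2 \<phi> \<tau> x *v ((y - x) + (1/2) *\<^sub>R integral {0..\<tau>} (\<lambda>\<sigma>. D2_inv_F'' \<sigma> x (y - x))))
        \<le> \<omega> * (norm (y - x))\<^sup>2"
proof -
  define \<omega>1 where "\<omega>1 = \<omega> / (2 * flow_lip\<^sup>2 * forcing_gain)"
  have "0 < \<omega>1" using assms flow_lip forcing_gain by (simp add: \<omega>1_def)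
  then obtain \<rho> where \<rho>: "0 < \<rho>"
    "\<And>a u. a \<in> C \<Longrightarrow> norm u \<le> \<rho> \<Longrightarrow> norm (F (a + u) - F a - F' a u - (1/2) *\<^sub>R F'' a u u) \<le> \<omega>1 * (norm u)\<^sup>2"
    using F_taylor2 by metis
  define \<delta> where "\<delta> = min (\<eta> / flow_lip) (min (\<rho> / flow_lip) (\<omega> / (2 * B * quad_err * flow_lip * forcing_gain)))"
  have "0 < \<delta>" using \<eta> flow_lip \<rho> assms B quad_err forcing_gain by (simp add: \<delta>_def)
  show ?thesis
  proof (rule that[OF \<open>0 < \<delta>\<close>])
    fix x y \<tau> assume x: "x \<in> \<Omega>" and near: "norm (y - x) < \<delta>" and \<tau>: "\<tau> \<in> {0..t}"
    define k where "k = y - x"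
    have small: "norm (y - x) * flow_lip < \<eta>" and small\<rho>: "norm k * flow_lip \<le> \<rho>" and smallA: "2 * B * quad_err * flow_lip * forcing_gain * norm k \<le> \<omega>"
    proof -
      have "norm k < \<eta> / flow_lip" "norm k < \<rho> / flow_lip" "norm k < \<omega> / (2 * B * quad_err * flow_lip * forcing_gain)"
        using near by (auto simp: \<delta>_def k_def)
      moreover have "0 < 2 * B * quad_err * flow_lip * forcing_gain" using B quad_err flow_lip forcing_gain by simp
      ultimately show "norm (y - x) * flow_lip < \<eta>" "norm k * flow_lip \<le> \<rho>" "2 * B * quad_err * flow_lip * forcing_gain * norm k \<le> \<omega>"
        using flow_lip by (simp_all add: pos_less_divide_eq k_def mult.commute)
    qed
    have x': "x \<in> X" using x \<Omega>X by blast
    have y: "y \<in> X" by (rule near_in_X[OF x small])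
    \<comment> \<open>\<open>e\<close> is the remainder of the expansion as a function of time\<close>
    define p where "p = (\<lambda>\<tau>. integral {0..\<tau>} (\<lambda>\<sigma>. D2_inv_F'' \<sigma> x k))"
    define c where "c = (\<omega>1 * flow_lip\<^sup>2 + B * quad_err * flow_lip * norm k) * (norm k)\<^sup>2"
    define e where "e = (\<lambda>\<sigma>. \<phi> \<sigma> y - \<phi> \<sigma> x - (D2 \<phi> \<sigma> x *v k + (1/2) *\<^sub>R (D2 \<phi> \<sigma> x *v p \<sigma>)))"
    define e' where "e' = (\<lambda>\<sigma>. F (\<phi> \<sigma> y) - F (\<phi> \<sigma> x) - (F' (\<phi> \<sigma> x) (D2 \<phi> \<sigma> x *v k)
      + (1/2) *\<^sub>R (F' (\<phi> \<sigma> x) (D2 \<phi> \<sigma> x *v p \<sigma>) + F'' (\<phi> \<sigma> x) (D2 \<phi> \<sigma> x *v k) (D2 \<phi> \<sigma> x *v k))))"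
    have e_deriv: "(e has_vector_derivative e' \<sigma>) (at \<sigma> within {0..t})" if \<sigma>: "\<sigma> \<in> {0..t}" for \<sigma>
      unfolding e_def e'_def p_def
      by (intro has_vector_derivative_diff has_vector_derivative_add flow_deriv y x' \<sigma> D2_deriv x
          bounded_linear.has_vector_derivative[OF bounded_linear_scaleR_right] second_variation_deriv)
    have "norm (e \<tau>) \<le> c * exp ((B + 1) * t)"
    proof (rule gronwall_forced[OF e_deriv, where w = "\<lambda>\<sigma>. F' (\<phi> \<sigma> x) (e \<sigma>)"])
      show "e 0 = 0" by (simp add: e_def p_def flow_0 x' y D2_0[OF x] k_def)
      fix \<sigma> assume \<sigma>: "\<sigma> \<in> {0..t}"
      show "norm (F' (\<phi> \<sigma> x) (e \<sigma>)) \<le> B * norm (e \<sigma>)" by (rule F'_apply_bound[OF flow_C[OF x \<sigma>]])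
      define a where "a = \<phi> \<sigma> x"
      define \<Delta> where "\<Delta> = \<phi> \<sigma> y - \<phi> \<sigma> x"
      define v where "v = D2 \<phi> \<sigma> x *v k"
      have a: "a \<in> C" unfolding a_def by (rule flow_C[OF x \<sigma>])
      have \<Delta>: "norm \<Delta> \<le> flow_lip * norm k"
        using flow_lipschitz(1)[OF x y small \<sigma>] by (simp add: \<Delta>_def k_def mult.commute)
      have v: "norm v \<le> flow_lip * norm k" unfolding v_def by (rule D2_bounds(1)[OF x \<sigma>])
      have \<Delta>v: "norm (\<Delta> - v) \<le> quad_err * (norm k)\<^sup>2"
        using flow_expansion1[OF x small \<sigma>] by (simp add: \<Delta>_def v_def k_def)
      have "norm (F (a + \<Delta>) - F a - F' a \<Delta> - (1/2) *\<^sub>R F'' a \<Delta> \<Delta>) \<le> \<omega>1 * (norm \<Delta>)\<^sup>2"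
        using \<Delta> small\<rho> by (intro \<rho>(2)[OF a]) (simp add: mult.commute)
      also have "\<dots> \<le> \<omega>1 * (flow_lip * norm k)\<^sup>2" using \<Delta> \<open>0 < \<omega>1\<close> by (intro mult_left_mono power_mono) auto
      finally have rem: "norm (F (a + \<Delta>) - F a - F' a \<Delta> - (1/2) *\<^sub>R F'' a \<Delta> \<Delta>) \<le> \<omega>1 * (flow_lip * norm k)\<^sup>2" .
      have "norm (F'' a \<Delta> \<Delta> - F'' a v v) \<le> B * norm (\<Delta> - v) * (norm \<Delta> + norm v)" by (rule F''_diff_bound[OF a])
      also have "\<dots> \<le> B * (quad_err * (norm k)\<^sup>2) * (flow_lip * norm k + flow_lip * norm k)"
        using \<Delta>v B \<Delta> v quad_err by (intro mult_mono mult_left_mono add_mono) auto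
      also have "\<dots> = 2 * (B * quad_err * flow_lip * norm k * (norm k)\<^sup>2)" by (simp add: algebra_simps)
      finally have quad: "norm ((1/2) *\<^sub>R (F'' a \<Delta> \<Delta> - F'' a v v)) \<le> B * quad_err * flow_lip * norm k * (norm k)\<^sup>2" by simp
      have e_eq: "e \<sigma> = \<Delta> - (v + (1/2) *\<^sub>R (D2 \<phi> \<sigma> x *v p \<sigma>))" by (simp add: e_def \<Delta>_def v_def)
      have e'_eq: "e' \<sigma> = F (a + \<Delta>) - F a - (F' a v + (1/2) *\<^sub>R (F' a (D2 \<phi> \<sigma> x *v p \<sigma>) + F'' a v v))"
        by (simp add: e'_def \<Delta>_def v_def a_def)
      have "e' \<sigma> - F' a (e \<sigma>) = (F (a + \<Delta>) - F a - F' a \<Delta> - (1/2) *\<^sub>R F'' a \<Delta> \<Delta>)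
          + (1/2) *\<^sub>R (F'' a \<Delta> \<Delta> - F'' a v v)"
        unfolding e_eq e'_eq
        by (simp add: blinfun.diff_right blinfun.add_right blinfun.scaleR_right scaleR_add_right scaleR_diff_right)
      then have "norm (e' \<sigma> - F' a (e \<sigma>)) \<le> \<omega>1 * (flow_lip * norm k)\<^sup>2 + B * quad_err * flow_lip * norm k * (norm k)\<^sup>2"
        using order_trans[OF norm_triangle_ineq add_mono[OF rem quad]] by (simp only:)
      then show "norm (e' \<sigma> - F' (\<phi> \<sigma> x) (e \<sigma>)) \<le> c"
        by (simp add: a_def c_def algebra_simps power_mult_distrib)
    qed (use \<tau> B in auto)
    also have "\<dots> = (\<omega>1 * flow_lip\<^sup>2 * forcing_gain + B * quad_err * flow_lip * forcing_gain * norm k) * (norm k)\<^sup>2"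
      by (simp add: c_def forcing_gain_def algebra_simps)
    also have "\<dots> \<le> (\<omega> / 2 + \<omega> / 2) * (norm k)\<^sup>2"
    proof (intro mult_right_mono add_mono)
      show "\<omega>1 * flow_lip\<^sup>2 * forcing_gain \<le> \<omega> / 2" using flow_lip forcing_gain by (simp add: \<omega>1_def)
      show "B * quad_err * flow_lip * forcing_gain * norm k \<le> \<omega> / 2" using smallA by simp
    qed simp
    finally have "norm (e \<tau>) \<le> \<omega> * (norm k)\<^sup>2" by simp
    then show "norm (\<phi> \<tau> y - \<phi> \<tau> x - D2 \<phi> \<tau> x *v ((y - x) + (1/2) *\<^sub>R integral {0..\<tau>} (\<lambda>\<sigma>. D2_inv_F'' \<sigma> x (y - x))))
        \<le> \<omega> * (norm (y - x))\<^sup>2"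
      by (simp add: e_def p_def k_def matrix_vector_right_distrib matrix_vector_mult_scaleR)
  qed
qed

end

section \<open>The attainable set\<close>

text \<open>
  The unit normals \<open>\<nu>\<close> at \<open>x\<close> for which \<open>\<Omega>\<close> lies in the ball of radius \<open>s\<close> centred at \<open>x - s *\<^sub>R \<nu>\<close>.
\<close>
definition normal_bundle :: "real \<Rightarrow> (real^'n) set \<Rightarrow> ((real^'n) \<times> (real^'n)) set" where
  "normal_bundle s \<Omega> = {(x, \<nu>). x \<in> \<Omega> \<and> norm \<nu> = 1 \<and>
     (\<forall>y\<in>\<Omega>. (norm (y - x))\<^sup>2 + 2 * s * ((y - x) \<bullet> \<nu>) \<le> 0)}"

lemma compact_normal_bundle:
  fixes \<Omega> :: "(real^'n) set"
  assumes "compact \<Omega>" shows "compact (normal_bundle s \<Omega>)"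
proof -
  have "closed (\<Inter>y\<in>\<Omega>. {p :: (real^'n) \<times> (real^'n). (norm (y - fst p))\<^sup>2 + 2 * s * ((y - fst p) \<bullet> snd p) \<le> 0})"
    by (intro closed_INT ballI closed_Collect_le continuous_intros)
  then have "compact ((\<Omega> \<times> sphere 0 1) \<inter>
      (\<Inter>y\<in>\<Omega>. {p :: (real^'n) \<times> (real^'n). (norm (y - fst p))\<^sup>2 + 2 * s * ((y - fst p) \<bullet> snd p) \<le> 0}))"
    using assms by (intro compact_Int_closed compact_Times) auto
  moreover have "normal_bundle s \<Omega> = (\<Omega> \<times> sphere 0 1) \<inter>
      (\<Inter>y\<in>\<Omega>. {p. (norm (y - fst p))\<^sup>2 + 2 * s * ((y - fst p) \<bullet> snd p) \<le> 0})"
    by (auto simp: normal_bundle_def)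
  ultimately show ?thesis by simp
qed

lemma normal_bundle_frontier:
  assumes "r_convex s \<Omega>" "0 < s" "x \<in> \<Omega>" "x \<notin> interior \<Omega>"
  obtains \<nu> where "(x, \<nu>) \<in> normal_bundle s \<Omega>"
proof (rule r_convex_supporting_ball[OF assms])
  fix \<nu> assume "norm \<nu> = 1" "\<And>y. y \<in> \<Omega> \<Longrightarrow> (norm (y - x))\<^sup>2 + 2 * s * ((y - x) \<bullet> \<nu>) \<le> 0"
  then show ?thesis using assms(3) by (intro that[of \<nu>]) (simp add: normal_bundle_def)
qed

context flow_tube begin

text \<open>
  The row vector product with the inverse matrix is the inverse transpose of the Jacobian applied to
  the normal: the normal to the image of the tangent hyperplane.
\<close>
definition transported_normal where
  "transported_normal \<tau> p = snd p v* matrix_inv (D2 \<phi> \<tau> (fst p))"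

lemma transported_normal_inner:
  assumes "x \<in> \<Omega>" "\<tau> \<in> {0..t}"
  shows "(D2 \<phi> \<tau> x *v z) \<bullet> transported_normal \<tau> (x, \<nu>) = z \<bullet> \<nu>"
proof -
  have "transported_normal \<tau> (x, \<nu>) \<bullet> (D2 \<phi> \<tau> x *v z) = \<nu> \<bullet> (matrix_inv (D2 \<phi> \<tau> x) *v (D2 \<phi> \<tau> x *v z))"
    by (simp add: transported_normal_def dot_lmul_matrix)
  also have "matrix_inv (D2 \<phi> \<tau> x) *v (D2 \<phi> \<tau> x *v z) = z"
    by (rule invertible_of_lower_bound(3)[of "1 / flow_lip"]) (use flow_lip D2_bounds(2)[OF assms] in auto)
  finally show ?thesis by (simp add: inner_commute)
qed

lemma transported_normal_nonzero:
  assumes "x \<in> \<Omega>" "\<tau> \<in> {0..t}" "norm \<nu> = 1"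
  shows "transported_normal \<tau> (x, \<nu>) \<noteq> 0"
  using transported_normal_inner[OF assms(1,2), of \<nu> \<nu>] assms(3) by (auto simp: norm_eq_1)

lemma transported_normal_norm:
  assumes x: "x \<in> \<Omega>" and \<tau>: "\<tau> \<in> {0..t}" and \<nu>: "norm \<nu> = 1"
    and ge: "\<And>\<tau> v. \<tau> \<in> {0..t} \<Longrightarrow> b * (v \<bullet> v) \<le> v \<bullet> F' (\<phi> \<tau> x) v"
  shows "norm (transported_normal \<tau> (x, \<nu>)) \<le> exp (- b * \<tau>)"
proof -
  define q where "q = transported_normal \<tau> (x, \<nu>)"
  have "(norm q)\<^sup>2 = \<nu> \<bullet> (matrix_inv (D2 \<phi> \<tau> x) *v q)"
    by (simp add: power2_norm_eq_inner q_def transported_normal_def dot_lmul_matrix)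
  also have "\<dots> \<le> norm \<nu> * norm (matrix_inv (D2 \<phi> \<tau> x) *v q)" by (rule norm_cauchy_schwarz)
  also have "\<dots> \<le> norm q / exp (b * \<tau>)"
    unfolding \<nu> mult_1 by (rule invertible_of_lower_bound(1)[OF _ D2_lower[OF x \<tau> ge]]) auto
  finally have "norm q * norm q \<le> norm q * exp (- b * \<tau>)"
    by (simp add: power2_eq_square exp_minus divide_inverse)
  moreover have "norm q > 0" using transported_normal_nonzero[OF x \<tau> \<nu>] by (simp add: q_def)
  ultimately show ?thesis unfolding q_def[symmetric] by simp
qed

lemma continuous_transported_normal:
  assumes "fst ` N \<subseteq> \<Omega>"
  shows "continuous_on ({0..t} \<times> N) (\<lambda>(\<tau>, p). transported_normal \<tau> p)"
proof -
  have "continuous_on ({0..t} \<times> \<Omega>) (\<lambda>z. matrix_inv (case z of (\<tau>, x) \<Rightarrow> D2 \<phi> \<tau> x))"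
    by (rule continuous_on_matrix_inv[OF continuous_D2, of "1 / flow_lip"]) (use flow_lip D2_bounds(2) in auto)
  then have "continuous_on ({0..t} \<times> N) (\<lambda>z. matrix_inv (case (fst z, fst (snd z)) of (\<tau>, x) \<Rightarrow> D2 \<phi> \<tau> x))"
    by (rule continuous_on_compose2) (use assms in \<open>auto intro!: continuous_intros\<close>)
  then have "continuous_on ({0..t} \<times> N) (\<lambda>z. snd (snd z) v* matrix_inv (D2 \<phi> (fst z) (fst (snd z))))"
    by (intro continuous_on_matrix_vector_mult(2)) (auto intro!: continuous_intros)
  then show ?thesis by (simp add: transported_normal_def case_prod_unfold)
qed

text \<open>
  Unlike the estimate for general neighbours, this has the sharp rate, and it holds at any distance
  because the segment between two points of \<open>\<Omega>\<close> stays in \<open>\<Omega>\<close>.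
\<close>
lemma flow_lipschitz_convex:
  assumes cv: "convex \<Omega>" and x: "x \<in> \<Omega>" and y: "y \<in> \<Omega>" and \<tau>: "\<tau> \<in> {0..t}"
    and le: "\<And>x \<tau> v. x \<in> \<Omega> \<Longrightarrow> \<tau> \<in> {0..t} \<Longrightarrow> v \<bullet> F' (\<phi> \<tau> x) v \<le> b * (v \<bullet> v)"
  shows "norm (\<phi> \<tau> y - \<phi> \<tau> x) \<le> exp (b * \<tau>) * norm (y - x)"
proof (rule differentiable_bound[OF cv has_derivative_at_withinI[OF flow_has_D2[OF _ \<tau>]] _ y x])
  fix z assume z: "z \<in> \<Omega>"
  show "onorm ((*v) (D2 \<phi> \<tau> z)) \<le> exp (b * \<tau>)"
    by (rule onorm_le) (use D2_upper[OF z \<tau> le[OF z]] in \<open>simp add: mult.commute\<close>)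
qed auto

text \<open>
  The factor \<open>1 + \<epsilon>\<close> on the radius makes the local inequality strict, as the continuation argument
  requires, and excludes antipodal points of a supporting sphere.
\<close>
lemma support_inequality:
  assumes \<Omega>: "compact \<Omega>" "interior \<Omega> \<noteq> {}" "\<Omega> \<noteq> UNIV" and s: "0 < s" and rc: "r_convex s \<Omega>"
    and upper: "\<And>x \<tau> v. x \<in> \<Omega> \<Longrightarrow> \<tau> \<in> {0..t} \<Longrightarrow> v \<bullet> F' (\<phi> \<tau> x) v \<le> lp * (v \<bullet> v)"
    and lower: "\<And>x \<tau> v. x \<in> \<Omega> \<Longrightarrow> \<tau> \<in> {0..t} \<Longrightarrow> lm * (v \<bullet> v) \<le> v \<bullet> F' (\<phi> \<tau> x) v"
    and "lm \<le> lp" and "0 \<le> L1" and sL: "s * L1 < 1"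
    and L1: "\<And>x \<tau> k. x \<in> \<Omega> \<Longrightarrow> \<tau> \<in> {0..t} \<Longrightarrow>
      norm (integral {0..\<tau>} (\<lambda>\<sigma>. D2_inv_F'' \<sigma> x k)) \<le> L1 * (norm k)\<^sup>2"
    and "0 < \<epsilon>"
  shows "\<And>\<tau> x \<nu> y. \<tau> \<in> {0..t} \<Longrightarrow> (x, \<nu>) \<in> normal_bundle s \<Omega> \<Longrightarrow> y \<in> \<Omega> \<Longrightarrow>
    (norm (\<phi> \<tau> y - \<phi> \<tau> x))\<^sup>2 * norm (transported_normal \<tau> (x, \<nu>))
      + 2 * ((1 + \<epsilon>) * (s * exp ((2 * lp - lm) * \<tau>) / (1 - s * L1)))
          * ((\<phi> \<tau> y - \<phi> \<tau> x) \<bullet> transported_normal \<tau> (x, \<nu>)) \<le> 0"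
proof -
  define c where "c = s / (1 - s * L1)"
  have c: "0 < c" "s \<le> c" "1 / c = 1 / s - L1"
  proof -
    show "0 < c" using s sL by (simp add: c_def)
    have "s * (1 - s * L1) \<le> s * 1" using s \<open>0 \<le> L1\<close> by (intro mult_left_mono) auto
    then show "s \<le> c" using sL by (simp add: c_def pos_le_divide_eq)
    show "1 / c = 1 / s - L1" using s by (simp add: c_def diff_divide_distrib)
  qed
  define r where "r = (\<lambda>\<tau>. (1 + \<epsilon>) * (c * exp ((2 * lp - lm) * \<tau>)))"
  have r_eq: "r \<tau> = (1 + \<epsilon>) * (s * exp ((2 * lp - lm) * \<tau>) / (1 - s * L1))" for \<tau>
    by (simp add: r_def c_def)
  have rpos: "0 < r \<tau>" for \<tau> using c \<open>0 < \<epsilon>\<close> by (simp add: r_def)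
  have cv: "convex \<Omega>" using rc by (rule r_convex_imp_convex)
  define N where "N = normal_bundle s \<Omega>"
  have N_fst: "fst ` N \<subseteq> \<Omega>" by (auto simp: N_def normal_bundle_def)
  have ND: "x \<in> \<Omega>" "norm \<nu> = 1" "\<And>y. y \<in> \<Omega> \<Longrightarrow> (norm (y - x))\<^sup>2 + 2 * s * ((y - x) \<bullet> \<nu>) \<le> 0" if "(x, \<nu>) \<in> N" for x \<nu>
    using that by (auto simp: N_def normal_bundle_def)
  obtain E where E: "0 < E"
    "\<And>\<tau> x y. \<tau> \<in> {0..t} \<Longrightarrow> x \<in> \<Omega> \<Longrightarrow> y \<in> \<Omega> \<Longrightarrow> norm (y - x) \<le> E * norm (\<phi> \<tau> y - \<phi> \<tau> x)"
    using flow_expanding by metis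
  define E0 where "E0 = exp (\<bar>lm\<bar> * t)"
  \<comment> \<open>\<open>E0\<close> bounds the norms of all transported normals; then \<open>\<omega>\<close> is small enough to use up only half of the slack \<open>\<epsilon>\<close>\<close>
  define z where "z = (1 + \<epsilon>) * c * E0"
  have "0 < z" using c \<open>0 < \<epsilon>\<close> by (simp add: z_def E0_def)
  define \<omega> where "\<omega> = \<epsilon> / (4 * z)"
  have "0 < \<omega>" using \<open>0 < z\<close> \<open>0 < \<epsilon>\<close> by (simp add: \<omega>_def)
  then obtain \<delta> where \<delta>: "0 < \<delta>"
    and expansion: "\<And>x y \<tau>. x \<in> \<Omega> \<Longrightarrow> norm (y - x) < \<delta> \<Longrightarrow> \<tau> \<in> {0..t} \<Longrightarrow>
      norm (\<phi> \<tau> y - \<phi> \<tau> x - D2 \<phi> \<tau> x *v ((y - x) + (1/2) *\<^sub>R integral {0..\<tau>} (\<lambda>\<sigma>. D2_inv_F'' \<sigma> x (y - x))))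
        \<le> \<omega> * (norm (y - x))\<^sup>2"
    using flow_expansion2 by metis
  have local_strict: "(norm (\<phi> \<tau> y - \<phi> \<tau> x))\<^sup>2 * norm (transported_normal \<tau> (x, \<nu>))
      + 2 * r \<tau> * ((\<phi> \<tau> y - \<phi> \<tau> x) \<bullet> transported_normal \<tau> (x, \<nu>)) < 0"
    if \<tau>: "\<tau> \<in> {0..t}" and xN: "(x, \<nu>) \<in> N" and y: "y \<in> \<Omega>" "y \<noteq> x" "norm (y - x) < \<delta>" for \<tau> x \<nu> y
  proof -
    note x = ND(1)[OF xN] and \<nu> = ND(2)[OF xN]
    define k where "k = y - x"
    define I where "I = integral {0..\<tau>} (\<lambda>\<sigma>. D2_inv_F'' \<sigma> x k)"
    define \<Delta> where "\<Delta> = \<phi> \<tau> y - \<phi> \<tau> x"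
    define q where "q = transported_normal \<tau> (x, \<nu>)"
    \<comment> \<open>\<open>P\<close> bounds the squared stretching of \<open>k\<close>, and \<open>Q\<close> bounds \<open>norm q\<close>\<close>
    define P where "P = exp (2 * lp * \<tau>)"
    define Q where "Q = exp (- lm * \<tau>)"
    have PQ: "0 < P" "0 < Q" by (simp_all add: P_def Q_def)
    have r: "r \<tau> = (1 + \<epsilon>) * c * P * Q"
      by (simp add: r_def P_def Q_def exp_add[symmetric] algebra_simps)
    have k: "0 < (norm k)\<^sup>2" using y by (simp add: k_def)
    have q: "norm q \<le> Q" unfolding q_def Q_def by (rule transported_normal_norm[OF x \<tau> \<nu> lower[OF x]])
    have QE0: "Q \<le> E0"
    proof -
      have "- lm * \<tau> \<le> \<bar>lm\<bar> * \<tau>" using \<tau> by (intro mult_right_mono) auto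
      also have "\<dots> \<le> \<bar>lm\<bar> * t" using \<tau> by (intro mult_left_mono) auto
      finally show ?thesis by (simp add: Q_def E0_def)
    qed
    have "norm \<Delta> \<le> exp (lp * \<tau>) * norm k"
      unfolding \<Delta>_def k_def by (rule flow_lipschitz_convex[OF cv x y(1) \<tau> upper])
    then have "(norm \<Delta>)\<^sup>2 \<le> (exp (lp * \<tau>) * norm k)\<^sup>2" by (intro power_mono) auto
    also have "\<dots> = P * (norm k)\<^sup>2" by (simp add: P_def power_mult_distrib exp_double[symmetric] mult.assoc)
    finally have \<Delta>2: "(norm \<Delta>)\<^sup>2 \<le> P * (norm k)\<^sup>2" .
    define d where "d = \<Delta> - D2 \<phi> \<tau> x *v (k + (1/2) *\<^sub>R I)"
    have d: "norm d \<le> \<omega> * (norm k)\<^sup>2"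
      using expansion[OF x y(3) \<tau>] by (simp add: d_def \<Delta>_def k_def I_def)
    have "\<Delta> \<bullet> q = (D2 \<phi> \<tau> x *v (k + (1/2) *\<^sub>R I)) \<bullet> q + d \<bullet> q" by (simp add: d_def inner_diff_left)
    also have "(D2 \<phi> \<tau> x *v (k + (1/2) *\<^sub>R I)) \<bullet> q = k \<bullet> \<nu> + (I \<bullet> \<nu>) / 2"
      unfolding q_def transported_normal_inner[OF x \<tau>] by (simp add: inner_add_left)
    finally have "\<Delta> \<bullet> q = k \<bullet> \<nu> + (I \<bullet> \<nu>) / 2 + d \<bullet> q" .
    moreover have "k \<bullet> \<nu> \<le> - (norm k)\<^sup>2 / (2 * s)"
      using ND(3)[OF xN y(1)] s by (simp add: k_def field_simps)
    moreover have "I \<bullet> \<nu> \<le> L1 * (norm k)\<^sup>2"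
      using norm_cauchy_schwarz[of I \<nu>] L1[OF x \<tau>, of k] \<nu> by (simp add: I_def)
    moreover have "d \<bullet> q \<le> \<omega> * (norm k)\<^sup>2 * Q"
    proof -
      have "d \<bullet> q \<le> norm d * norm q" by (rule norm_cauchy_schwarz)
      also have "\<dots> \<le> \<omega> * (norm k)\<^sup>2 * Q" using d q \<open>0 < \<omega>\<close> by (intro mult_mono) auto
      finally show ?thesis .
    qed
    ultimately have "\<Delta> \<bullet> q \<le> - (norm k)\<^sup>2 / (2 * s) + L1 * (norm k)\<^sup>2 / 2 + \<omega> * (norm k)\<^sup>2 * Q"
      by linarith
    also have "\<dots> = (\<omega> * Q - (1 / c) / 2) * (norm k)\<^sup>2" unfolding c(3) using s by (simp add: field_simps)
    finally have \<Delta>q: "\<Delta> \<bullet> q \<le> (\<omega> * Q - (1 / c) / 2) * (norm k)\<^sup>2" .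
    have \<omega>Q: "2 * (1 + \<epsilon>) * c * (\<omega> * Q) \<le> \<epsilon> / 2"
    proof -
      have "2 * (1 + \<epsilon>) * c * (\<omega> * Q) \<le> 2 * (1 + \<epsilon>) * c * (\<omega> * E0)"
        using c \<open>0 < \<epsilon>\<close> \<open>0 < \<omega>\<close> QE0 by (intro mult_left_mono) auto
      also have "\<dots> = 2 * z * \<omega>" by (simp only: z_def mult_ac)
      also have "\<dots> = \<epsilon> / 2" using \<open>0 < z\<close> by (simp add: \<omega>_def)
      finally show ?thesis .
    qed
    have "(norm \<Delta>)\<^sup>2 * norm q + 2 * r \<tau> * (\<Delta> \<bullet> q)
      \<le> (P * (norm k)\<^sup>2) * Q + 2 * r \<tau> * ((\<omega> * Q - (1 / c) / 2) * (norm k)\<^sup>2)"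
    proof (rule add_mono)
      show "(norm \<Delta>)\<^sup>2 * norm q \<le> (P * (norm k)\<^sup>2) * Q" using \<Delta>2 q PQ by (intro mult_mono) auto
      show "2 * r \<tau> * (\<Delta> \<bullet> q) \<le> 2 * r \<tau> * ((\<omega> * Q - (1 / c) / 2) * (norm k)\<^sup>2)"
        using \<Delta>q rpos[of \<tau>] by (intro mult_left_mono) auto
    qed
    also have "\<dots> = P * Q * (norm k)\<^sup>2 * (2 * (1 + \<epsilon>) * c * (\<omega> * Q) - \<epsilon>)"
      using c(1) unfolding r by (simp add: field_simps)
    also have "\<dots> \<le> P * Q * (norm k)\<^sup>2 * (\<epsilon> / 2 - \<epsilon>)"
      using \<omega>Q PQ by (intro mult_left_mono) auto
    also have "\<dots> < 0" using PQ k \<open>0 < \<epsilon>\<close> by (simp add: mult_less_0_iff)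
    finally show ?thesis by (simp add: \<Delta>_def q_def)
  qed
  have short: "norm (\<phi> \<tau> y - \<phi> \<tau> x) < 2 * r \<tau>" if \<tau>: "\<tau> \<in> {0..t}" and xy: "x \<in> \<Omega>" "y \<in> \<Omega>" for \<tau> x y
  proof -
    have "norm (\<phi> \<tau> y - \<phi> \<tau> x) \<le> exp (lp * \<tau>) * norm (y - x)"
      by (rule flow_lipschitz_convex[OF cv xy \<tau> upper])
    also have "\<dots> \<le> exp ((2 * lp - lm) * \<tau>) * (2 * s)"
      using \<tau> \<open>lm \<le> lp\<close> s r_convex_dist_le[OF rc \<Omega>(3) xy(2,1)]
      by (intro mult_mono) (auto intro!: mult_right_mono)
    also have "\<dots> \<le> exp ((2 * lp - lm) * \<tau>) * (2 * c)" using c by (intro mult_left_mono) auto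
    also have "\<dots> < 2 * r \<tau>" using c \<open>0 < \<epsilon>\<close> by (simp add: r_def algebra_simps)
    finally show ?thesis .
  qed
  have init: "(norm (\<phi> 0 y - \<phi> 0 x))\<^sup>2 * norm (transported_normal 0 (x, \<nu>))
      + 2 * r 0 * ((\<phi> 0 y - \<phi> 0 x) \<bullet> transported_normal 0 (x, \<nu>)) \<le> 0"
    if xN: "(x, \<nu>) \<in> N" and y: "y \<in> \<Omega>" for x \<nu> y
  proof -
    note x = ND(1)[OF xN]
    have "z \<bullet> transported_normal 0 (x, \<nu>) = z \<bullet> \<nu>" for z
      using transported_normal_inner[OF x, of 0 z \<nu>] t D2_0[OF x] by simp
    then have "transported_normal 0 (x, \<nu>) = \<nu>" using vector_eq_ldot by blast
    moreover have "\<phi> 0 x = x" "\<phi> 0 y = y" using flow_0 x y \<Omega>X by auto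
    moreover have le: "(norm (y - x))\<^sup>2 + 2 * s * ((y - x) \<bullet> \<nu>) \<le> 0" by (rule ND(3)[OF xN y])
    then have "s * ((y - x) \<bullet> \<nu>) \<le> 0" using zero_le_power2[of "norm (y - x)"] by linarith
    then have "(y - x) \<bullet> \<nu> \<le> 0" using s by (simp add: mult_le_0_iff)
    moreover have "s \<le> r 0"
    proof -
      have "1 * c \<le> (1 + \<epsilon>) * c" using c \<open>0 < \<epsilon>\<close> by (intro mult_right_mono) auto
      moreover have "r 0 = (1 + \<epsilon>) * c" by (simp add: r_def)
      ultimately show ?thesis using c(2) by linarith
    qed
    ultimately show ?thesis
      using le ND(2)[OF xN] mult_right_mono_neg[of s "r 0" "(y - x) \<bullet> \<nu>"] by simp
  qed
  fix \<tau> x \<nu> y assume \<tau>: "\<tau> \<in> {0..t}" and xN: "(x, \<nu>) \<in> normal_bundle s \<Omega>" and y: "y \<in> \<Omega>"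
  show "(norm (\<phi> \<tau> y - \<phi> \<tau> x))\<^sup>2 * norm (transported_normal \<tau> (x, \<nu>))
      + 2 * ((1 + \<epsilon>) * (s * exp ((2 * lp - lm) * \<tau>) / (1 - s * L1)))
          * ((\<phi> \<tau> y - \<phi> \<tau> x) \<bullet> transported_normal \<tau> (x, \<nu>)) \<le> 0"
    unfolding r_eq[symmetric]
  proof (rule support_continuation[where N = N and r = r and q = transported_normal and E = E and \<delta> = \<delta>])
    show "compact N" unfolding N_def by (rule compact_normal_bundle[OF \<Omega>(1)])
    show "\<exists>\<nu>. (x, \<nu>) \<in> N" if "x \<in> \<Omega>" "x \<notin> interior \<Omega>" for x
      using normal_bundle_frontier[OF rc s that] unfolding N_def by blast
    show "continuous_on ({0..t} \<times> \<Omega>) (\<lambda>(\<tau>, x). \<phi> \<tau> x)"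
      by (rule continuous_on_subset[OF continuous_flow[OF t]]) (use \<Omega>X in auto)
    show "continuous_on ({0..t} \<times> N) (\<lambda>(\<tau>, p). transported_normal \<tau> p)"
      by (rule continuous_transported_normal[OF N_fst])
    show "transported_normal \<tau> p \<noteq> 0" if "\<tau> \<in> {0..t}" "p \<in> N" for \<tau> p
      using transported_normal_nonzero[of "fst p" \<tau> "snd p"] ND[of "fst p" "snd p"] that by simp
    show "continuous_on {0..t} r" unfolding r_def by (intro continuous_intros)
    show "(x, \<nu>) \<in> N" using xN by (simp add: N_def)
    show "0 < r \<tau>" for \<tau> by (rule rpos)
  qed (fact \<Omega> N_fst t short E \<delta> local_strict init \<tau> y)+
qed

text \<open>
  The support inequality is affine in \<open>\<epsilon>\<close> and therefore survives the limit \<open>\<epsilon> \<rightarrow> 0\<close>. A set \<open>\<Omega>\<close> without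
  interior points has at most one element.
\<close>
lemma attainable_set_r_convex:
  assumes \<Omega>: "compact \<Omega>" "\<Omega> \<noteq> UNIV" and s: "0 < s" and rc: "r_convex s \<Omega>"
    and upper: "\<And>x \<tau> v. x \<in> \<Omega> \<Longrightarrow> \<tau> \<in> {0..t} \<Longrightarrow> v \<bullet> F' (\<phi> \<tau> x) v \<le> lp * (v \<bullet> v)"
    and lower: "\<And>x \<tau> v. x \<in> \<Omega> \<Longrightarrow> \<tau> \<in> {0..t} \<Longrightarrow> lm * (v \<bullet> v) \<le> v \<bullet> F' (\<phi> \<tau> x) v"
    and "0 \<le> L1" and sL: "s * L1 < 1"
    and L1: "\<And>x \<tau> k. x \<in> \<Omega> \<Longrightarrow> \<tau> \<in> {0..t} \<Longrightarrow>
      norm (integral {0..\<tau>} (\<lambda>\<sigma>. D2_inv_F'' \<sigma> x k)) \<le> L1 * (norm k)\<^sup>2"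
    and \<tau>: "\<tau> \<in> {0..t}"
  shows "r_convex (s * exp ((2 * lp - lm) * \<tau>) / (1 - s * L1)) (\<phi> \<tau> ` \<Omega>)"
    (is "r_convex ?r _")
proof (cases "interior \<Omega> = {}")
  case True
  have "0 < ?r" using s sL by simp
  show ?thesis
  proof (cases "\<Omega> = {}")
    case False
    then obtain p where "p \<in> \<Omega>" by blast
    then have "\<Omega> = {p}" using r_convex_interior_nonempty[OF rc s] True by blast
    then show ?thesis using r_convex_singleton[OF \<open>0 < ?r\<close>] by simp
  qed (auto intro: r_convexI)
next
  case False
  have "0 < ?r" using s sL by simp
  obtain E where E: "\<And>\<tau> x y. \<tau> \<in> {0..t} \<Longrightarrow> x \<in> \<Omega> \<Longrightarrow> y \<in> \<Omega> \<Longrightarrow> norm (y - x) \<le> E * norm (\<phi> \<tau> y - \<phi> \<tau> x)"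
    using flow_expanding by metis
  obtain x0 where x0: "x0 \<in> \<Omega>" using False interior_subset by blast
  have "lm \<le> lp"
  proof -
    obtain v :: "real^'n" where v: "v \<bullet> v = 1" using norm_axis_1 norm_eq_1 by metis
    show ?thesis using order_trans[OF lower[OF x0 \<tau>, of v] upper[OF x0 \<tau>, of v]] v by simp
  qed
  show ?thesis
  proof (rule r_convex_image_of_supporting_balls[OF \<Omega>(1) False \<open>0 < ?r\<close>])
    have "\<phi> \<tau> differentiable_on \<Omega>"
      using flow_has_D2[OF _ \<tau>] unfolding differentiable_on_def differentiable_def
      by (meson has_derivative_at_withinI)
    then show "continuous_on \<Omega> (\<phi> \<tau>)" by (rule differentiable_imp_continuous_on)
    show "inj_on (\<phi> \<tau>) \<Omega>"
    proof (rule inj_onI)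
      fix x y assume "x \<in> \<Omega>" "y \<in> \<Omega>" "\<phi> \<tau> x = \<phi> \<tau> y"
      then show "x = y" using E[OF \<tau>, of x y] by simp
    qed
    fix x assume x: "x \<in> \<Omega>" "x \<notin> interior \<Omega>"
    obtain \<nu> where \<nu>: "(x, \<nu>) \<in> normal_bundle s \<Omega>"
      using normal_bundle_frontier[OF rc s x] .
    define q where "q = transported_normal \<tau> (x, \<nu>)"
    have "q \<noteq> 0" using transported_normal_nonzero[OF x(1) \<tau>] \<nu> by (simp add: q_def normal_bundle_def)
    moreover have "(norm (\<phi> \<tau> y - \<phi> \<tau> x))\<^sup>2 * norm q + 2 * ?r * ((\<phi> \<tau> y - \<phi> \<tau> x) \<bullet> q) \<le> 0" if y: "y \<in> \<Omega>" for y
    proof -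
      define a where "a = (norm (\<phi> \<tau> y - \<phi> \<tau> x))\<^sup>2 * norm q"
      define b where "b = 2 * ?r * ((\<phi> \<tau> y - \<phi> \<tau> x) \<bullet> q)"
      have "a + (1 + \<epsilon>) * b \<le> 0" if "0 < \<epsilon>" for \<epsilon>
      proof -
        have "a + 2 * ((1 + \<epsilon>) * ?r) * ((\<phi> \<tau> y - \<phi> \<tau> x) \<bullet> q) \<le> 0"
          unfolding a_def q_def
          by (rule support_inequality[OF \<Omega>(1) False \<Omega>(2) s rc upper lower \<open>lm \<le> lp\<close> \<open>0 \<le> L1\<close> sL L1 that \<tau> \<nu> y])
        moreover have "2 * ((1 + \<epsilon>) * ?r) * ((\<phi> \<tau> y - \<phi> \<tau> x) \<bullet> q) = (1 + \<epsilon>) * b"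
          unfolding b_def by (simp only: mult.assoc mult.left_commute)
        ultimately show ?thesis by simp
      qed
      then have "\<forall>\<^sub>F \<epsilon> in at_right 0. a + (1 + \<epsilon>) * b \<le> 0"
        using eventually_at_right_less[of "0::real"] by (rule eventually_mono[rotated])
      moreover have "((\<lambda>\<epsilon>. a + (1 + \<epsilon>) * b) \<longlongrightarrow> a + (1 + 0) * b) (at_right 0)"
        by (intro tendsto_intros)
      ultimately have "a + (1 + 0) * b \<le> 0"
        by (intro tendsto_upperbound[where F = "at_right (0::real)"]) simp_all
      then show ?thesis by (simp add: a_def b_def)
    qed
    ultimately show "\<exists>q. q \<noteq> 0 \<and> (\<forall>y\<in>\<Omega>. (norm (\<phi> \<tau> y - \<phi> \<tau> x))\<^sup>2 * norm q + 2 * ?r * ((\<phi> \<tau> y - \<phi> \<tau> x) \<bullet> q) \<le> 0)"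
      by blast
  qed
qed

end

theorem theorem4p3:
  fixes X \<Omega> :: "(real^'n) set"
    and F :: "real^'n \<Rightarrow> real^'n"
    and F' :: "real^'n \<Rightarrow> ((real^'n) \<Rightarrow>\<^sub>L (real^'n))"
    and F'' :: "real^'n \<Rightarrow> ((real^'n) \<Rightarrow>\<^sub>L ((real^'n) \<Rightarrow>\<^sub>L (real^'n)))"
    and \<phi> :: "real \<Rightarrow> real^'n \<Rightarrow> real^'n"
    and s t lm lp L1 :: real
  assumes "open X"
    and "C2_on X F F' F''"
    and "\<forall>x0\<in>X. \<exists>u. solves_ivp X F x0 u"
    and "is_flow X F \<phi>"
    and "s > 0" and "t > 0"
    and "\<Omega> \<subseteq> X" and "r_convex s \<Omega>" and "closed \<Omega>" and "\<Omega> \<noteq> UNIV"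
    and "\<forall>x \<in> (\<lambda>(\<tau>, y). \<phi> \<tau> y) ` ({0..t} \<times> \<Omega>).
           lm \<le> mu_minus (matrix (blinfun_apply (F' x))) \<and>
           mu_minus (matrix (blinfun_apply (F' x))) \<le> mu_plus (matrix (blinfun_apply (F' x))) \<and>
           mu_plus (matrix (blinfun_apply (F' x))) \<le> lp"
    and "L1 \<ge> 0"
    and "\<forall>x\<in>\<Omega>. \<forall>\<delta>\<in>{0..t}. \<forall>h.
           norm (integral {0..\<delta>} (\<lambda>\<tau>. matrix_inv (D2 \<phi> \<tau> x) *v
             blinfun_apply (blinfun_apply (F'' (\<phi> \<tau> x)) (D2 \<phi> \<tau> x *v h)) (D2 \<phi> \<tau> x *v h)))
           \<le> L1 * (norm h)\<^sup>2"
    and "s * L1 < 1"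
  shows "(\<forall>\<tau>\<in>{0..t}. r_convex (s * exp ((2 * lp - lm) * \<tau>) / (1 - s * L1)) (\<phi> \<tau> ` \<Omega>)) \<and>
    (2 * lp - lm \<ge> 0 \<longrightarrow>
      (\<forall>\<tau>\<in>{0..t}. r_convex (s * exp ((2 * lp - lm) * t) / (1 - s * L1)) (\<phi> \<tau> ` \<Omega>)))"
proof -
  note s = \<open>s > 0\<close> and rc = \<open>r_convex s \<Omega>\<close> and \<Omega>X = \<open>\<Omega> \<subseteq> X\<close> and sL = \<open>s * L1 < 1\<close>
  interpret flow: C2_flow X F F' F'' \<phi>
    using assms(1,2,4) by unfold_locales
  have "0 \<le> t" using \<open>t > 0\<close> by simp
  have "bounded \<Omega>"
    unfolding bounded_two_points using r_convex_dist_le[OF rc \<open>\<Omega> \<noteq> UNIV\<close>] by (auto simp: dist_norm)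
  then have compact\<Omega>: "compact \<Omega>" using \<open>closed \<Omega>\<close> by (simp add: compact_eq_bounded_closed)
  define C where "C = (\<lambda>(\<tau>, y). \<phi> \<tau> y) ` ({0..t} \<times> \<Omega>)"
  have "continuous_on ({0..t} \<times> \<Omega>) (\<lambda>(\<tau>, y). \<phi> \<tau> y)"
    by (rule continuous_on_subset[OF flow.continuous_flow[OF \<open>0 \<le> t\<close>]]) (use \<Omega>X in auto)
  then have "compact C" unfolding C_def using compact\<Omega> by (intro compact_continuous_image compact_Times) auto
  have "C \<subseteq> X" using flow.flow_in \<Omega>X by (auto simp: C_def)
  have in_C: "\<phi> \<tau> x \<in> C" if "x \<in> \<Omega>" "\<tau> \<in> {0..t}" for x \<tau> using that by (auto simp: C_def)
  obtain \<eta> B where "flow_tube X F F' F'' \<phi> \<Omega> C t \<eta> B"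
    using flow.flow_tube_exists[OF \<open>0 \<le> t\<close> \<Omega>X \<open>compact C\<close> \<open>C \<subseteq> X\<close> in_C] .
  then interpret flow_tube X F F' F'' \<phi> \<Omega> C t \<eta> B .
  have F'_matrix: "matrix (blinfun_apply f) *v v = f v" for f :: "(real^'n) \<Rightarrow>\<^sub>L (real^'n)" and v
    using fun_cong[OF matrix_vector_mul(3)[OF blinfun.bounded_linear_right[of f]], of v] .
  have upper: "v \<bullet> F' (\<phi> \<tau> x) v \<le> lp * (v \<bullet> v)" and lower: "lm * (v \<bullet> v) \<le> v \<bullet> F' (\<phi> \<tau> x) v"
    if "x \<in> \<Omega>" "\<tau> \<in> {0..t}" for x \<tau> v
  proof -
    let ?A = "matrix (blinfun_apply (F' (\<phi> \<tau> x)))"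
    have "lm \<le> mu_minus ?A" "mu_plus ?A \<le> lp" using assms(11) in_C[OF that] unfolding C_def by blast+
    then have "lm * (v \<bullet> v) \<le> mu_minus ?A * (v \<bullet> v)" "mu_plus ?A * (v \<bullet> v) \<le> lp * (v \<bullet> v)"
      by (intro mult_right_mono; simp)+
    then show "v \<bullet> F' (\<phi> \<tau> x) v \<le> lp * (v \<bullet> v)" "lm * (v \<bullet> v) \<le> v \<bullet> F' (\<phi> \<tau> x) v"
      using inner_le_mu_plus[of v ?A] inner_ge_mu_minus[of ?A v] unfolding F'_matrix by linarith+
  qed
  have L1: "norm (integral {0..\<tau>} (\<lambda>\<sigma>. D2_inv_F'' \<sigma> x k)) \<le> L1 * (norm k)\<^sup>2" if "x \<in> \<Omega>" "\<tau> \<in> {0..t}" for x \<tau> k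
    unfolding D2_inv_F''_def using assms(13) that by blast
  have main: "r_convex (s * exp ((2 * lp - lm) * \<tau>) / (1 - s * L1)) (\<phi> \<tau> ` \<Omega>)" if \<tau>: "\<tau> \<in> {0..t}" for \<tau>
    by (rule attainable_set_r_convex[OF compact\<Omega> \<open>\<Omega> \<noteq> UNIV\<close> s rc upper lower \<open>L1 \<ge> 0\<close> sL L1 \<tau>])
  moreover have "r_convex (s * exp ((2 * lp - lm) * t) / (1 - s * L1)) (\<phi> \<tau> ` \<Omega>)"
    if ge: "2 * lp - lm \<ge> 0" and \<tau>: "\<tau> \<in> {0..t}" for \<tau>
  proof (rule r_convex_mono[OF main[OF \<tau>]])
    show "0 < s * exp ((2 * lp - lm) * \<tau>) / (1 - s * L1)" using s sL by simp
    have "exp ((2 * lp - lm) * \<tau>) \<le> exp ((2 * lp - lm) * t)" using mult_left_mono[OF _ ge, of \<tau> t] \<tau> by simp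
    then show "s * exp ((2 * lp - lm) * \<tau>) / (1 - s * L1) \<le> s * exp ((2 * lp - lm) * t) / (1 - s * L1)"
      using s sL by (intro divide_right_mono mult_left_mono) auto
  qed
  ultimately show ?thesis by blast
qed

end
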